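(* There is an algorithm that, for every sequence $S[1:n]$ of $n$ distinct real numbers and every integer $k\geq 3$, computes the length of a longest subsequence of $S$ that is a $k$-rollercoaster in $O(nk^2)$ time.
   Context: A subsequence of $S[1:n]=(S[1],\dots,S[n])$ is a sequence $(S[i_1],\dots,S[i_m])$ with $1\le i_1<\dots<i_m\le n$ (not necessarily contiguous). A run of a sequence is a maximal contiguous subsequence that is increasing or decreasing. For $k\geq 3$, a $k$-rollercoaster is a sequence of numbers every run of which has length at least $k$. *)

theory Defs
  imports Complex_Main "HOL-Library.Sublist"
begin

section \<open>Rollercoasters\<close>

definition monotone_list :: "'a::linorder list \<Rightarrow> bool" where
  "monotone_list xs \<longleftrightarrow> sorted_wrt (<) xs \<or> sorted_wrt (>) xs"

text \<open>The contiguous part of a list at the (zero-based) positions \<open>i, \<dots>, j - 1\<close>.\<close>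

definition slice :: "'a list \<Rightarrow> nat \<Rightarrow> nat \<Rightarrow> 'a list" where
  "slice xs i j = take (j - i) (drop i xs)"

text \<open>
  Maximality is among all monotone slices, increasing or decreasing. Runs are nonempty, so the
  empty list has none, while a one-element list has exactly one run, of length 1.
\<close>

definition is_run :: "'a::linorder list \<Rightarrow> nat \<Rightarrow> nat \<Rightarrow> bool" where
  "is_run xs i j \<longleftrightarrow>
     i < j \<and> j \<le> length xs \<and> monotone_list (slice xs i j) \<and>
     (\<forall>i' j'. i' \<le> i \<and> j \<le> j' \<and> j' \<le> length xs \<and> monotone_list (slice xs i' j')
        \<longrightarrow> i' = i \<and> j' = j)"

definition rollercoaster :: "nat \<Rightarrow> 'a::linorder list \<Rightarrow> bool" where
  "rollercoaster k xs \<longleftrightarrow> (\<forall>i j. is_run xs i j \<longrightarrow> k \<le> j - i)"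

text \<open>
  The empty list is vacuously a rollercoaster; hence the value is 0 if there is no nonempty
  rollercoaster subsequence. The HOL-Library predicate \<open>subseq\<close> does not require contiguity.
\<close>

definition longest_rollercoaster :: "nat \<Rightarrow> 'a::linorder list \<Rightarrow> nat" where
  "longest_rollercoaster k xs = Max (length ` {ys. subseq ys xs \<and> rollercoaster k ys})"

lemma longest_rollercoaster_Max:
  "finite (length ` {ys. subseq ys xs \<and> rollercoaster k ys})"
  "length ` {ys. subseq ys xs \<and> rollercoaster k ys} \<noteq> {}"
proof -
  have "length ` {ys. subseq ys xs \<and> rollercoaster k ys} \<subseteq> {..length xs}"
    by (auto dest: list_emb_length)
  then show "finite (length ` {ys. subseq ys xs \<and> rollercoaster k ys})"
    by (rule finite_subset) simp
  have "rollercoaster k []"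
    by (simp add: rollercoaster_def is_run_def)
  then show "length ` {ys. subseq ys xs \<and> rollercoaster k ys} \<noteq> {}"
    by auto
qed


section \<open>A unit-cost word RAM with comparison access to the input\<close>

text \<open>
  The machine has named registers and named arrays, all holding natural numbers. The input numbers
  are read-only and are not words: they can only be compared with each other, by position. Every
  word must stay below a bound \<open>W\<close>; an execution in which some intermediate value reaches \<open>W\<close>, or
  which inspects an input position that does not exist, gets stuck. Every expression node and
  every command costs one time unit.
\<close>

type_synonym vname = string

record state =
  reg :: "vname \<Rightarrow> nat"
  arr :: "vname \<Rightarrow> nat \<Rightarrow> nat"

datatype aexp =
    Const nat
  | Reg vname
  | Arr vname aexp
  | Plus aexp aexp
  | Minus aexp aexp
  | Times aexp aexp
  | Div aexp aexp

datatype bexp =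
    Less aexp aexp
  | InLess aexp aexp
  | Neg bexp
  | Conj bexp bexp

datatype com =
    Skip
  | Assign vname aexp
  | Store vname aexp aexp
  | Seq com com
  | If bexp com com
  | While bexp com

fun aval :: "aexp \<Rightarrow> state \<Rightarrow> nat" where
  "aval (Const c) s = c"
| "aval (Reg x) s = reg s x"
| "aval (Arr a e) s = arr s a (aval e s)"
| "aval (Plus e f) s = aval e s + aval f s"
| "aval (Minus e f) s = aval e s - aval f s"
| "aval (Times e f) s = aval e s * aval f s"
| "aval (Div e f) s = aval e s div aval f s"

fun afits :: "nat \<Rightarrow> aexp \<Rightarrow> state \<Rightarrow> bool" where
  "afits W (Const c) s \<longleftrightarrow> c < W"
| "afits W (Reg x) s \<longleftrightarrow> reg s x < W"
| "afits W (Arr a e) s \<longleftrightarrow> afits W e s \<and> arr s a (aval e s) < W"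
| "afits W (Plus e f) s \<longleftrightarrow> afits W e s \<and> afits W f s \<and> aval e s + aval f s < W"
| "afits W (Minus e f) s \<longleftrightarrow> afits W e s \<and> afits W f s"
| "afits W (Times e f) s \<longleftrightarrow> afits W e s \<and> afits W f s \<and> aval e s * aval f s < W"
| "afits W (Div e f) s \<longleftrightarrow> afits W e s \<and> afits W f s"

fun acost :: "aexp \<Rightarrow> nat" where
  "acost (Const c) = 1"
| "acost (Reg x) = 1"
| "acost (Arr a e) = 1 + acost e"
| "acost (Plus e f) = 1 + acost e + acost f"
| "acost (Minus e f) = 1 + acost e + acost f"
| "acost (Times e f) = 1 + acost e + acost f"
| "acost (Div e f) = 1 + acost e + acost f"

text \<open>\<open>InLess e f\<close> compares two input numbers; positions are zero-based.\<close>

fun bval :: "real list \<Rightarrow> bexp \<Rightarrow> state \<Rightarrow> bool" where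
  "bval S (Less e f) s \<longleftrightarrow> aval e s < aval f s"
| "bval S (InLess e f) s \<longleftrightarrow> S ! aval e s < S ! aval f s"
| "bval S (Neg b) s \<longleftrightarrow> \<not> bval S b s"
| "bval S (Conj b b') s \<longleftrightarrow> bval S b s \<and> bval S b' s"

text \<open>As \<open>Conj\<close> is a short-circuit conjunction, its second argument only has to be defined if
  the first one is true; its cost is nevertheless always charged.\<close>

fun bfits :: "nat \<Rightarrow> real list \<Rightarrow> bexp \<Rightarrow> state \<Rightarrow> bool" where
  "bfits W S (Less e f) s \<longleftrightarrow> afits W e s \<and> afits W f s"
| "bfits W S (InLess e f) s \<longleftrightarrow>
     afits W e s \<and> afits W f s \<and> aval e s < length S \<and> aval f s < length S"
| "bfits W S (Neg b) s \<longleftrightarrow> bfits W S b s"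
| "bfits W S (Conj b b') s \<longleftrightarrow> bfits W S b s \<and> (bval S b s \<longrightarrow> bfits W S b' s)"

fun bcost :: "bexp \<Rightarrow> nat" where
  "bcost (Less e f) = 1 + acost e + acost f"
| "bcost (InLess e f) = 1 + acost e + acost f"
| "bcost (Neg b) = 1 + bcost b"
| "bcost (Conj b b') = 1 + bcost b + bcost b'"

text \<open>\<open>exec W S c s t s'\<close>: with word bound \<open>W\<close> and input \<open>S\<close>, the program \<open>c\<close> started in state \<open>s\<close>
  terminates after \<open>t\<close> time units in state \<open>s'\<close>.\<close>

inductive exec :: "nat \<Rightarrow> real list \<Rightarrow> com \<Rightarrow> state \<Rightarrow> nat \<Rightarrow> state \<Rightarrow> bool"
  for W :: nat and S :: "real list" where
  Skip: "exec W S Skip s 1 s"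
| Assign: "afits W e s \<Longrightarrow>
    exec W S (Assign x e) s (1 + acost e) (s\<lparr>reg := (reg s)(x := aval e s)\<rparr>)"
| Store: "afits W e s \<Longrightarrow> afits W f s \<Longrightarrow>
    exec W S (Store a e f) s (1 + acost e + acost f)
      (s\<lparr>arr := (arr s)(a := (arr s a)(aval e s := aval f s))\<rparr>)"
| Seq: "exec W S c s t s' \<Longrightarrow> exec W S c' s' t' s'' \<Longrightarrow>
    exec W S (Seq c c') s (1 + t + t') s''"
| IfTrue: "bfits W S b s \<Longrightarrow> bval S b s \<Longrightarrow> exec W S c s t s' \<Longrightarrow>
    exec W S (If b c c') s (1 + bcost b + t) s'"
| IfFalse: "bfits W S b s \<Longrightarrow> \<not> bval S b s \<Longrightarrow> exec W S c' s t s' \<Longrightarrow>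
    exec W S (If b c c') s (1 + bcost b + t) s'"
| WhileFalse: "bfits W S b s \<Longrightarrow> \<not> bval S b s \<Longrightarrow>
    exec W S (While b c) s (1 + bcost b) s"
| WhileTrue: "bfits W S b s \<Longrightarrow> bval S b s \<Longrightarrow> exec W S c s t s' \<Longrightarrow>
    exec W S (While b c) s' t' s'' \<Longrightarrow>
    exec W S (While b c) s (1 + bcost b + t + t') s''"

lemma exec_deterministic:
  "exec W S c s t s' \<Longrightarrow> exec W S c s u s'' \<Longrightarrow> t = u \<and> s' = s''"
proof (induction arbitrary: u s'' rule: exec.induct)
  case (Seq c s t s' c' t' s'')
  from Seq.prems show ?case
    by (cases rule: exec.cases) (use Seq.IH in blast)+
next
  case (WhileTrue b s c t s' t' s'')
  from WhileTrue.prems show ?case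
    by (cases rule: exec.cases) (use WhileTrue in blast)+
qed (erule exec.cases; fastforce)+

text \<open>
  The sequence length and the parameter \<open>k\<close> are supplied in the registers \<open>n\<close> and \<open>k\<close>; all other
  registers and all arrays are initially 0. The result is returned in the register \<open>out\<close>.
\<close>

definition initial_state :: "real list \<Rightarrow> nat \<Rightarrow> state" where
  "initial_state S k =
     \<lparr>reg = (\<lambda>x. 0)(''n'' := length S, ''k'' := k), arr = (\<lambda>a i. 0)\<rparr>"

text \<open>
  With \<open>W = (n + k) ^ d\<close>, words have at most \<open>d * log 2 (n + k)\<close> bits.
\<close>

definition computes :: "nat \<Rightarrow> com \<Rightarrow> real list \<Rightarrow> nat \<Rightarrow> nat \<Rightarrow> nat \<Rightarrow> bool" where
  "computes d P S k t r \<longleftrightarrow>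
     (\<exists>s. exec ((length S + k) ^ d) S P (initial_state S k) t s \<and> reg s ''out'' = r)"

end

theory Submission
  imports Defs
begin

text \<open>
  A partial rollercoaster is classified by the direction of its last run and the length of that
  run, capped at \<open>k\<close>. For each of these \<open>2 * k\<close> states the algorithm keeps the Pareto front
  (``staircase'') of last element against length; a new element queries the predecessors of its
  value in all staircases and is then inserted into them.

  To locate predecessors without a logarithmic factor, the input is cut into phases that end as
  soon as both an increasing and a decreasing subsequence of length \<open>k\<close> has occurred since
  the phase began. Until then the elements split greedily into fewer than \<open>2 * k\<close> classes,
  each monotone in value, so that one finger per class and staircase moves in one direction only.

  At the end of a phase, an entry can be discarded if it is shorter by \<open>k\<close> than both the best
  rollercoaster with an increasing and the one with a decreasing last run: replacing its prefix by
  one of these improves every completion. The increasing and the decreasing subsequence found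
  during the phase extend the best rollercoasters known at its beginning, which bounds both
  from below; hence only \<open>O(k)\<close> entries per staircase are older than the phase, and the finger
  movements amortize to \<open>O(k\<^sup>2)\<close> per element.
\<close>

section \<open>Completing rollercoasters\<close>

text \<open>Pruning throws away entries that may be the longest of their state, so the usual
  invariant of a dynamic program, optimality of every table entry, fails. It is replaced by a global
  one: every rollercoaster that is optimal for the whole input stays traceable through the tables.
  Two monotone subsequences are awaited because the pruning threshold is the minimum of the two best
  lengths, whereas old entries are only bounded by their maximum plus \<open>k\<close>. The
  increasing subsequence goes on top of the best rollercoaster with a decreasing last run and vice
  versa; this crosswise extension lifts the new minimum to at least the old maximum, which leaves a
  window of \<open>2 * k\<close> lengths for old entries. The rate of \<open>k^2\<close> per element
  arises as follows. After a reset each of the \<open>4 * k^2\<close> fingers may cross its whole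
  staircase, which holds O(k) old entries besides those of the finished phase. As a phase cannot end
  before its \<open>k\<close>-th element, both kinds together are linear in the length of the phase,
  and every element can pay O(1) per finger in advance.\<close>

definition dlt :: "bool \<Rightarrow> 'a::linorder \<Rightarrow> 'a \<Rightarrow> bool" where
  "dlt d x y \<longleftrightarrow> (if d then x < y else y < x)"

text \<open>An automaton for the rest of the sequence: \<open>j\<close> is the length so far of a
  run of direction \<open>d\<close> that ends in \<open>y\<close>. Neighbouring runs share their
  turning element, so a turn restarts the counter at 2. Equal neighbours satisfy neither comparison
  and are rejected.\<close>

fun completes :: "nat \<Rightarrow> bool \<Rightarrow> nat \<Rightarrow> 'a::linorder \<Rightarrow> 'a list \<Rightarrow> bool" where
  "completes k d j y [] \<longleftrightarrow> k \<le> j"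
| "completes k d j y (x # xs) \<longleftrightarrow>
     (if dlt d y x then completes k d (Suc j) x xs
      else k \<le> j \<and> dlt (\<not> d) y x \<and> completes k (\<not> d) 2 x xs)"

definition mono_on_ix :: "bool \<Rightarrow> 'a::linorder list \<Rightarrow> nat \<Rightarrow> nat \<Rightarrow> bool" where
  "mono_on_ix d xs i j \<longleftrightarrow> (\<forall>a. i \<le> a \<and> Suc a < j \<longrightarrow> dlt d (xs ! a) (xs ! Suc a))"

lemma dlt_neg: "x \<noteq> y \<Longrightarrow> dlt (\<not> d) x y \<longleftrightarrow> \<not> dlt d x y"
  by (auto simp: dlt_def)

section \<open>Maximal runs and their step-by-step recognition\<close>

lemma monotone_slice_iff:
  assumes "j \<le> length xs"
  shows "monotone_list (slice xs i j) \<longleftrightarrow> (\<exists>d. mono_on_ix d xs i j)"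
proof -
  have len: "length (slice xs i j) = j - i"
    using assms by (simp add: slice_def)
  have nth: "slice xs i j ! a = xs ! (i + a)" if "a < j - i" for a
    using that assms by (simp add: slice_def)
  have 1: "(\<forall>a. Suc a < j - i \<longrightarrow> dlt d (xs ! (i + a)) (xs ! (i + Suc a))) \<longleftrightarrow> mono_on_ix d xs i j" for d
  proof
    assume L: "\<forall>a. Suc a < j - i \<longrightarrow> dlt d (xs ! (i + a)) (xs ! (i + Suc a))"
    show "mono_on_ix d xs i j"
      unfolding mono_on_ix_def
    proof (intro allI impI)
      fix a assume "i \<le> a \<and> Suc a < j"
      then show "dlt d (xs ! a) (xs ! Suc a)" using L[rule_format, of "a - i"]
        by (metis (no_types, lifting) add_Suc_right diff_less_mono le_SucI le_add_diff_inverse Suc_diff_le)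
    qed
  qed (auto simp: mono_on_ix_def)
  have "sorted_wrt (<) (slice xs i j) \<longleftrightarrow> mono_on_ix True xs i j"
    unfolding 1[symmetric] by (subst sorted_wrt_iff_nth_Suc_transp) (auto simp: len nth dlt_def)
  moreover have "sorted_wrt (>) (slice xs i j) \<longleftrightarrow> mono_on_ix False xs i j"
    unfolding 1[symmetric] by (subst sorted_wrt_iff_nth_Suc_transp) (auto simp: len nth dlt_def transp_def)
  ultimately show ?thesis
    unfolding monotone_list_def by (metis (full_types))
qed

lemma is_run_iff:
  "is_run xs i j \<longleftrightarrow>
     i < j \<and> j \<le> length xs \<and> (\<exists>d. mono_on_ix d xs i j) \<and>
     (\<forall>i' j'. i' \<le> i \<and> j \<le> j' \<and> j' \<le> length xs \<and> (\<exists>d. mono_on_ix d xs i' j')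
        \<longrightarrow> i' = i \<and> j' = j)"
  unfolding is_run_def using monotone_slice_iff[of _ xs] by metis

lemma mono_on_ix_mono: "mono_on_ix d xs i j \<Longrightarrow> i \<le> i' \<Longrightarrow> j' \<le> j \<Longrightarrow> mono_on_ix d xs i' j'"
  by (auto simp: mono_on_ix_def)

lemma mono_on_ix_dir:
  "mono_on_ix d xs i j \<Longrightarrow> i \<le> a \<Longrightarrow> Suc a < j \<Longrightarrow> dlt d' (xs ! a) (xs ! Suc a) \<Longrightarrow> d' = d"
  by (auto simp: mono_on_ix_def dlt_def split: if_splits)

text \<open>The scan has read the first \<open>m\<close> elements, and its current run began at
  \<open>i\<close>. By the fifth assumption this run cannot be extended to the left, so the runs
  with start at least \<open>i\<close> and end at least \<open>m\<close> are the current one and all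
  later ones, whose lengths are still undecided. A lone first element is monotone both ways; the
  last assumption then says that \<open>d\<close> is the right guess.\<close>

lemma completes_runs:
  assumes "distinct xs" "i < m" "m \<le> length xs" "mono_on_ix d xs i m"
    "i = 0 \<or> dlt (\<not> d) (xs ! (i - 1)) (xs ! i)"
    "2 \<le> m - i \<or> i = 0 \<and> (1 < length xs \<longrightarrow> dlt d (xs ! 0) (xs ! 1))"
  shows "completes k d (m - i) (xs ! (m - 1)) (drop m xs) \<longleftrightarrow>
    (\<forall>i' j'. is_run xs i' j' \<and> i \<le> i' \<and> m \<le> j' \<longrightarrow> k \<le> j' - i')"
  using assms
proof (induction "length xs - m" arbitrary: i m d)
  case 0
  then have m: "m = length xs" by simp
  have left: "i' = i" if "i' \<le> i" "mono_on_ix e xs i' m" for i' e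
  proof (rule ccontr)
    assume "i' \<noteq> i"
    with that have i: "i' < i" by simp
    then have d: "dlt (\<not> d) (xs ! (i - 1)) (xs ! Suc (i - 1))" using 0 by auto
    have "(\<not> d) = e"
      using mono_on_ix_dir[OF that(2), of "i - 1"] d i 0 by auto
    moreover have "d = e"
      using mono_on_ix_dir[OF that(2), of i d] 0 i by (auto simp: mono_on_ix_def)
    ultimately show False by simp
  qed
  have run: "is_run xs i m"
    unfolding is_run_iff using 0 left m by (metis le_antisym)
  have "i' = i \<and> j' = m" if "is_run xs i' j'" "i \<le> i'" "m \<le> j'" for i' j'
    using that 0 m unfolding is_run_iff by (metis le_antisym)
  with run show ?case using m by auto
next
  case (Suc l)
  then have m: "m < length xs" by simp
  then have drop: "drop m xs = xs ! m # drop (Suc m) xs" by (simp add: Cons_nth_drop_Suc)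
  have neq: "xs ! (m - 1) \<noteq> xs ! m"
    using Suc.prems m by (simp add: nth_eq_iff_index_eq)
  show ?case
  proof (cases "dlt d (xs ! (m - 1)) (xs ! m)")
    case True
    have mono: "mono_on_ix d xs i (Suc m)"
      unfolding mono_on_ix_def
    proof (intro allI impI)
      fix a assume "i \<le> a \<and> Suc a < Suc m"
      then show "dlt d (xs ! a) (xs ! Suc a)"
        using True Suc.prems by (cases "Suc a = m") (auto simp: mono_on_ix_def)
    qed
    have "\<not> is_run xs i' m" if "i \<le> i'" for i'
      unfolding is_run_iff using mono_on_ix_mono[OF mono that order_refl] m by (metis Suc_leI le_Suc_eq n_not_Suc_n order_refl)
    then have "(\<forall>i' j'. is_run xs i' j' \<and> i \<le> i' \<and> m \<le> j' \<longrightarrow> k \<le> j' - i') \<longleftrightarrow>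
      (\<forall>i' j'. is_run xs i' j' \<and> i \<le> i' \<and> Suc m \<le> j' \<longrightarrow> k \<le> j' - i')"
      by (metis Suc_leD Suc_leI le_neq_implies_less)
    moreover have "completes k d (Suc m - i) (xs ! (Suc m - 1)) (drop (Suc m) xs) \<longleftrightarrow>
      (\<forall>i' j'. is_run xs i' j' \<and> i \<le> i' \<and> Suc m \<le> j' \<longrightarrow> k \<le> j' - i')"
      by (rule Suc.hyps(1)) (use Suc.prems Suc.hyps(2) m mono in auto)
    ultimately show ?thesis
      using True Suc.prems by (simp add: drop Suc_diff_le)
  next
    case False
    then have turn: "dlt (\<not> d) (xs ! (m - 1)) (xs ! m)" using dlt_neg[OF neq] by simp
    have two: "2 \<le> m - i"
    proof (rule ccontr)
      assume "\<not> 2 \<le> m - i"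
      with Suc.prems m have "i = 0" "m = 1" "dlt d (xs ! 0) (xs ! 1)" by auto
      with False show False by simp
    qed
    have prev: "dlt d (xs ! (m - 2)) (xs ! (m - 1))"
    proof -
      have "i \<le> m - 2" "Suc (m - 2) < m" "Suc (m - 2) = m - 1" using two by auto
      then show ?thesis using Suc.prems(4) unfolding mono_on_ix_def by metis
    qed
    \<comment> \<open>The steps into \<open>m - 1\<close> and into \<open>m\<close> point in
      opposite directions, so no monotone slice contains both: the current run ends here, and the
      next one starts at the shared element \<open>m - 1\<close>.\<close>
    have nomono: "False" if "mono_on_ix e xs i' j'" "i' \<le> m - 2" "Suc m \<le> j'" for e i' j'
    proof -
      have "d = e"
        using mono_on_ix_dir[OF that(1), of "m - 2" d] that two prev by (simp add: Suc_diff_Suc numeral_2_eq_2)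
      moreover have "(\<not> d) = e"
        using mono_on_ix_dir[OF that(1), of "m - 1" "\<not> d"] that two turn by simp
      ultimately show False by simp
    qed
    have left: "i' = i" if "i' \<le> i" "mono_on_ix e xs i' j'" "m \<le> j'" for i' e j'
    proof (rule ccontr)
      assume "i' \<noteq> i"
      with that have i: "i' < i" by simp
      then have d: "dlt (\<not> d) (xs ! (i - 1)) (xs ! Suc (i - 1))" using Suc.prems by auto
      have "(\<not> d) = e"
        using mono_on_ix_dir[OF that(2), of "i - 1"] d i two that by auto
      moreover have "d = e"
        using mono_on_ix_dir[OF that(2), of i d] Suc.prems i two that by (auto simp: mono_on_ix_def)
      ultimately show False by simp
    qed
    have run: "is_run xs i m"
      unfolding is_run_iff
    proof (intro conjI allI impI)
      fix i' j' assume *: "i' \<le> i \<and> m \<le> j' \<and> j' \<le> length xs \<and> (\<exists>d. mono_on_ix d xs i' j')"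
      then show "i' = i" using left by blast
      show "j' = m"
      proof (rule ccontr)
        assume "j' \<noteq> m"
        then have "Suc m \<le> j'" using * by simp
        moreover have "i' \<le> m - 2" using conjunct1[OF *] two by arith
        ultimately show False using * nomono by blast
      qed
    qed (use Suc.prems in auto)
    have A: "i' = i" if "is_run xs i' m" "i \<le> i'" for i'
      using that Suc.prems unfolding is_run_iff by (metis order_refl)
    have B: "m - 1 \<le> i'" if "is_run xs i' j'" "Suc m \<le> j'" for i' j'
    proof (rule ccontr)
      assume "\<not> m - 1 \<le> i'"
      then have "i' \<le> m - 2" by simp
      then show False using that nomono unfolding is_run_iff by blast
    qed
    have "(\<forall>i' j'. is_run xs i' j' \<and> i \<le> i' \<and> m \<le> j' \<longrightarrow> k \<le> j' - i') \<longleftrightarrow>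
      k \<le> m - i \<and> (\<forall>i' j'. is_run xs i' j' \<and> m - 1 \<le> i' \<and> Suc m \<le> j' \<longrightarrow> k \<le> j' - i')"
    proof (intro iffI conjI allI impI; (elim conjE)?)
      fix i' j' assume H: "k \<le> m - i" "\<forall>i' j'. is_run xs i' j' \<and> m - 1 \<le> i' \<and> Suc m \<le> j' \<longrightarrow> k \<le> j' - i'"
        "is_run xs i' j'" "i \<le> i'" "m \<le> j'"
      then show "k \<le> j' - i'"
        using A B by (cases "j' = m") auto
    qed (use run two in auto)
    moreover have "completes k (\<not> d) (Suc m - (m - 1)) (xs ! (Suc m - 1)) (drop (Suc m) xs) \<longleftrightarrow>
      (\<forall>i' j'. is_run xs i' j' \<and> m - 1 \<le> i' \<and> Suc m \<le> j' \<longrightarrow> k \<le> j' - i')"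
    proof (rule Suc.hyps(1))
      show "mono_on_ix (\<not> d) xs (m - 1) (Suc m)"
        unfolding mono_on_ix_def
      proof (intro allI impI)
        fix a assume "m - 1 \<le> a \<and> Suc a < Suc m"
        then have "a = m - 1" using two by arith
        then show "dlt (\<not> d) (xs ! a) (xs ! Suc a)" using turn two by simp
      qed
      show "m - 1 = 0 \<or> dlt (\<not> \<not> d) (xs ! (m - 1 - 1)) (xs ! (m - 1))"
        using prev by (simp add: numeral_2_eq_2)
    qed (use Suc.prems Suc.hyps(2) m two in auto)
    moreover have "Suc m - (m - 1) = 2" using two by simp
    ultimately show ?thesis
      using False turn Suc.prems by (simp add: drop)
  qed
qed

definition coaster :: "nat \<Rightarrow> 'a::linorder list \<Rightarrow> bool" where
  "coaster k xs \<longleftrightarrow> (\<exists>d. completes k d 1 (hd xs) (tl xs))"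

text \<open>A wrong guess of the first direction is rejected at the second element, because a turn
  after one element would require \<open>k \<le> 1\<close>; so the existential in
  \<open>coaster\<close> picks the true first direction. The empty list stands apart since
  \<open>coaster\<close> inspects \<open>hd xs\<close>.\<close>

lemma rollercoaster_iff:
  assumes "distinct xs" "2 \<le> k"
  shows "rollercoaster k xs \<longleftrightarrow> xs = [] \<or> coaster k xs"
proof (cases xs)
  case Nil
  then show ?thesis by (simp add: rollercoaster_def is_run_def)
next
  case (Cons x ys)
  have all: "rollercoaster k xs \<longleftrightarrow>
      (\<forall>i' j'. is_run xs i' j' \<and> 0 \<le> i' \<and> 1 \<le> j' \<longrightarrow> k \<le> j' - i')"
    unfolding rollercoaster_def by (auto simp: is_run_def)
  have main: "completes k d 1 x ys \<longleftrightarrow> rollercoaster k xs"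
    if "1 < length xs \<longrightarrow> dlt d (xs ! 0) (xs ! 1)" for d
    using completes_runs[of xs 0 1 d k] assms that Cons unfolding all by (simp add: mono_on_ix_def)
  show ?thesis
  proof (cases ys)
    case Nil
    then show ?thesis using main[of True] assms Cons by (auto simp: coaster_def)
  next
    case (Cons y zs)
    have neq: "x \<noteq> y" using assms \<open>xs = x # ys\<close> Cons by simp
    have "completes k d 1 x ys \<Longrightarrow> dlt d x y" for d
      using assms Cons by (auto split: if_splits)
    moreover have "dlt True x y \<or> dlt False x y" using neq by (auto simp: dlt_def)
    ultimately have "(\<exists>d. completes k d 1 x ys) \<longleftrightarrow> rollercoaster k xs"
      using main \<open>xs = x # ys\<close> Cons by (metis nth_Cons_0 nth_Cons_Suc One_nat_def)
    then show ?thesis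
      using \<open>xs = x # ys\<close> by (simp add: coaster_def)
  qed
qed

section \<open>Capped run lengths and the exchange of prefixes\<close>

lemma completes_mono: "completes k d j y xs \<Longrightarrow> j \<le> j' \<Longrightarrow> completes k d j' y xs"
  by (induction k d j y xs arbitrary: j' rule: completes.induct) auto

text \<open>The counter is only ever compared with \<open>k\<close>, so all full runs behave alike;
  this is what makes \<open>2 * k\<close> states sufficient.\<close>

lemma completes_ge: "k \<le> j \<Longrightarrow> completes k d j y xs \<longleftrightarrow> completes k d k y xs"
proof
  assume j: "k \<le> j" and "completes k d j y xs"
  then show "completes k d k y xs"
  proof (induction k d j y xs rule: completes.induct)
    case (2 k d j y x xs)
    show ?case
    proof (cases "dlt d y x")
      case True
      then have "completes k d k x xs" using 2 by simp
      then show ?thesis using True completes_mono by fastforce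
    qed (use 2 in simp)
  qed simp
qed (use completes_mono in blast)

text \<open>The list \<open>zs @ [z]\<close> is what remains of the run through \<open>q\<close>,
  and \<open>R\<close> turns at \<open>z\<close> or is empty. The counter of this run is tested only
  once, at \<open>z\<close>; hence every counter that has reached \<open>k\<close> there is as good
  as \<open>j\<close>.\<close>

lemma completes_split:
  assumes "completes k d j q Q"
  shows "\<exists>zs z R. q # Q = zs @ z # R \<and> completes k d (j + length zs) z R \<and>
    (R = [] \<or> \<not> dlt d z (hd R)) \<and> (\<forall>j'. k \<le> j' + length zs \<longrightarrow> completes k d j' q Q)
    \<and> (zs = [] \<or> Q \<noteq> [] \<and> dlt d q (hd Q))"
  using assms
proof (induction Q arbitrary: q j)
  case Nil
  then show ?case by (intro exI[of _ "[]"] exI[of _ q]) simp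
next
  case (Cons x Q)
  show ?case
  proof (cases "dlt d q x")
    case True
    then have "completes k d (Suc j) x Q" using Cons.prems by simp
    from Cons.IH[OF this] obtain zs z R where
      H: "x # Q = zs @ z # R" "completes k d (Suc j + length zs) z R" "R = [] \<or> \<not> dlt d z (hd R)"
        "\<forall>j'. k \<le> j' + length zs \<longrightarrow> completes k d j' x Q" by blast
    show ?thesis
    proof (intro exI conjI)
      show "q # x # Q = (q # zs) @ z # R" using H by simp
      show "\<forall>j'. k \<le> j' + length (q # zs) \<longrightarrow> completes k d j' q (x # Q)" using H(4) True by simp
      show "q # zs = [] \<or> x # Q \<noteq> [] \<and> dlt d q (hd (x # Q))" using True by simp
    qed (use H in auto)
  next
    case False
    then show ?thesis using Cons.prems
      by (intro exI[of _ "[]"] exI[of _ q] exI[of _ "x # Q"]) simp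
  qed
qed

text \<open>The exchange argument: the two endpoints stand for complete rollercoasters whose last run is
  increasing, respectively decreasing. A long first run of \<open>Q\<close> is started afresh by turning at its
  first element; a short one is skipped up to its last element, where the next run of \<open>Q\<close>
  begins.\<close>

lemma exchange:
  assumes "completes k d j p Q" "3 \<le> k" "\<And>e. b e \<notin> set Q"
  shows "\<exists>e Q'. subseq Q' Q \<and> length Q < length Q' + k \<and> completes k e k (b e) Q'"
proof (cases Q)
  case Nil
  then show ?thesis using assms(2) by (intro exI[of _ d] exI[of _ "[]"]) simp
next
  case (Cons q Q2)
  obtain d' j' where start: "completes k d' j' q Q2"
    using assms(1) Cons by (auto split: if_splits)
  obtain zs z R where H: "Q = zs @ z # R" "completes k d' (j' + length zs) z R"
      "R = [] \<or> \<not> dlt d' z (hd R)" "\<forall>j'. k \<le> j' + length zs \<longrightarrow> completes k d' j' q Q2"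
      "zs = [] \<or> Q2 \<noteq> [] \<and> dlt d' q (hd Q2)"
    using completes_split[OF start] Cons by auto
  show ?thesis
  proof (cases "k \<le> Suc (length zs)")
    case True
    have two: "completes k d' 2 q Q2" using H(4) True by simp
    have zs: "Q2 \<noteq> []" "dlt d' q (hd Q2)" using H(5) True assms(2) by auto
    \<comment> \<open>The endpoint belongs to the rollercoaster whose last run goes against the long
      run. If \<open>q\<close> prolongs that run, the turn happens at \<open>q\<close> and the long
      run counts from \<open>q\<close>; otherwise the turn happens at the endpoint and the long run
      gains one element.\<close>
    have "completes k (\<not> d') k (b (\<not> d')) (q # Q2)"
    proof (cases "dlt (\<not> d') (b (\<not> d')) q")
      case t: True
      obtain y Q3 where Q2: "Q2 = y # Q3" using zs by (cases Q2) auto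
      have "dlt d' q y" using zs Q2 by simp
      then have "\<not> dlt (\<not> d') q y" by (auto simp: dlt_def)
      moreover have "completes k d' 2 y Q3"
        using H(4)[rule_format, of 1] True \<open>dlt d' q y\<close> Q2 by (simp add: numeral_2_eq_2)
      ultimately show ?thesis using t Q2 \<open>dlt d' q y\<close> by simp
    next
      case False
      have "b (\<not> d') \<noteq> q" using assms(3) Cons by (metis list.set_intros(1))
      then show ?thesis using False two dlt_neg[of _ q "\<not> d'"] by simp
    qed
    then show ?thesis using Cons assms(2) by (intro exI[of _ "\<not> d'"] exI[of _ Q]) simp
  next
    case False
    show ?thesis
    proof (cases R)
      case Nil
      then show ?thesis using H False
        by (intro exI[of _ d] exI[of _ "[]"]) simp
    next
      case R: (Cons y R2)
      have nd: "\<not> dlt d' z y" using H(3) R by simp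
      have c: "dlt (\<not> d') z y" "completes k (\<not> d') 2 y R2" using H(2) R nd by auto
      have "b d' \<noteq> z" using assms(3) H(1) by (metis in_set_conv_decomp)
      \<comment> \<open>Here the endpoint is the one whose last run goes along with the skipped run.
        Either \<open>z\<close> prolongs it and the turn stays at \<open>z\<close>, or the turn
        moves back to the endpoint and the following run grows by one, whence the counter 3.\<close>
      then have "completes k d' k (b d') (z # R)"
        using c nd dlt_neg[of "b d'" z d'] completes_mono[OF c(2), of 3] R
        by (simp add: numeral_2_eq_2 numeral_3_eq_3)
      moreover have "subseq (z # R) Q" using H(1) by (simp add: subseq_drop_many)
      moreover have "length Q < length (z # R) + k" using H(1) False by simp
      ultimately show ?thesis by blast
    qed
  qed
qed

text \<open>Partial rollercoasters are described by the continuations they admit rather than by their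
  runs; in particular, a full last run also counts as a run of length 1 in the other direction.\<close>

definition ends :: "nat \<Rightarrow> bool \<Rightarrow> nat \<Rightarrow> 'a::linorder list \<Rightarrow> bool" where
  "ends k d j xs \<longleftrightarrow> xs \<noteq> [] \<and> (\<forall>Q. completes k d j (last xs) Q \<longrightarrow> coaster k (xs @ Q))"

lemma ends_single: "ends k d 1 [x]"
  by (auto simp: ends_def coaster_def)

lemma ends_snoc: "ends k d j xs \<Longrightarrow> dlt d (last xs) x \<Longrightarrow> ends k d (Suc j) (xs @ [x])"
  unfolding ends_def
proof (intro conjI allI impI)
  fix Q
  assume "xs \<noteq> [] \<and> (\<forall>Q. completes k d j (last xs) Q \<longrightarrow> coaster k (xs @ Q))"
    "dlt d (last xs) x" "completes k d (Suc j) (last (xs @ [x])) Q"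
  then have "coaster k (xs @ x # Q)" by simp
  then show "coaster k ((xs @ [x]) @ Q)" by simp
qed simp

lemma ends_cap: "ends k d (Suc k) xs \<Longrightarrow> ends k d k xs"
  by (auto simp: ends_def completes_ge[of k "Suc k"])

text \<open>A continuation accepted from length 1 cannot turn at once, because
  \<open>2 \<le> k\<close>; its first step thus goes in direction \<open>\<not> d\<close>. From the
  full run in direction \<open>d\<close> the same step is a legal turn, and both readings continue
  with counter 2.\<close>

lemma ends_turn:
  assumes "ends k d k xs" "2 \<le> k"
  shows "ends k (\<not> d) 1 xs"
proof -
  have "completes k d k y Q" if "completes k (\<not> d) 1 y Q" for y Q
  proof (cases Q)
    case (Cons x Q')
    then show ?thesis using that assms(2)
      by (auto simp: dlt_def numeral_2_eq_2 split: if_splits)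
  qed simp
  then show ?thesis using assms(1) by (auto simp: ends_def)
qed

lemma ends_coaster: "ends k d k xs \<Longrightarrow> coaster k xs"
  by (auto simp: ends_def dest: spec[of _ "[]"])

section \<open>Staircases of partial rollercoasters\<close>

type_synonym stair = "(nat \<times> nat) list"

text \<open>The pair in front is a sentinel. Its length 0 means that there is no predecessor, which
  \<open>succ0\<close> preserves, and its element number 0 will be the head node of the linked
  list.\<close>

definition entry :: "stair \<Rightarrow> nat \<Rightarrow> nat \<times> nat" where
  "entry xs j = ((0, 0) # xs) ! j"

definition succ0 :: "nat \<Rightarrow> nat" where
  "succ0 v = (if v = 0 then 0 else Suc v)"

lemma entry_simps [simp]: "entry xs 0 = (0, 0)" "entry xs (Suc j) = xs ! j"
  by (simp_all add: entry_def)

lemma sorted_wrt_hd: "sorted_wrt R xs \<Longrightarrow> x \<in> set xs \<Longrightarrow> x = hd xs \<or> R (hd xs) x"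
  by (cases xs) auto

locale input =
  fixes S :: "real list" and k :: nat
  assumes dist: "distinct S" and k3: "3 \<le> k"
begin

abbreviation n :: nat where "n \<equiv> length S"

definition key :: "nat \<Rightarrow> real" where "key a = S ! (a - 1)"

text \<open>States below \<open>k\<close> have an increasing last run, the others a decreasing one.
  Reversing the order of values for the latter lets all staircases be treated as ascending.\<close>

definition lt :: "nat \<Rightarrow> nat \<Rightarrow> nat \<Rightarrow> bool" where
  "lt s a b \<longleftrightarrow> dlt (s < k) (key a) (key b)"

definition rk :: "nat \<Rightarrow> stair \<Rightarrow> nat \<Rightarrow> nat" where
  "rk s xs x = length (takeWhile (\<lambda>e. lt s (fst e) x) xs)"

definition ins :: "nat \<Rightarrow> stair \<Rightarrow> nat \<Rightarrow> nat \<Rightarrow> stair" where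
  "ins s xs x w = (let r = rk s xs x in
     if snd (entry xs r) < w then take r xs @ (x, w) # dropWhile (\<lambda>e. snd e \<le> w) (drop r xs) else xs)"

definition prune :: "nat \<Rightarrow> stair \<Rightarrow> stair" where
  "prune m xs = dropWhile (\<lambda>e. snd e + k \<le> m) xs"

text \<open>A Pareto front: along the list, values become harder to extend and lengths grow. The
  bound of a length by its element number later keeps all words small.\<close>

definition stair :: "nat \<Rightarrow> nat \<Rightarrow> stair \<Rightarrow> bool" where
  "stair s t xs \<longleftrightarrow> sorted_wrt (\<lambda>a b. lt s (fst a) (fst b) \<and> snd a < snd b) xs \<and>
     (\<forall>e\<in>set xs. 1 \<le> fst e \<and> fst e \<le> t \<and> 0 < snd e \<and> snd e \<le> fst e)"

text \<open>Domination survives insertions, membership does not: an entry that is deleted is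
  dominated by the one that displaces it.\<close>

definition covers :: "nat \<Rightarrow> stair \<Rightarrow> real \<Rightarrow> nat \<Rightarrow> bool" where
  "covers s xs v w \<longleftrightarrow> (\<exists>e\<in>set xs. w \<le> snd e \<and> \<not> dlt (s < k) v (key (fst e)))"

section \<open>Predecessor ranks, insertion and domination\<close>

lemma key_eq_iff: "1 \<le> a \<Longrightarrow> a \<le> n \<Longrightarrow> 1 \<le> b \<Longrightarrow> b \<le> n \<Longrightarrow> key a = key b \<longleftrightarrow> a = b"
  using nth_eq_iff_index_eq[OF dist, of "a - 1" "b - 1"] by (auto simp: key_def)

lemma lt_trans: "lt s a b \<Longrightarrow> lt s b c \<Longrightarrow> lt s a c"
  by (auto simp: lt_def dlt_def split: if_splits)

lemma lt_asym: "lt s a b \<Longrightarrow> \<not> lt s b a"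
  by (auto simp: lt_def dlt_def split: if_splits)

lemma lt_irrefl [simp]: "\<not> lt s a a"
  using lt_asym by blast

lemma lt_total: "1 \<le> a \<Longrightarrow> a \<le> n \<Longrightarrow> 1 \<le> b \<Longrightarrow> b \<le> n \<Longrightarrow> a \<noteq> b \<Longrightarrow> lt s a b \<or> lt s b a"
  using key_eq_iff[of a b] by (auto simp: lt_def dlt_def)

lemma stair_mono: "stair s t xs \<Longrightarrow> t \<le> t' \<Longrightarrow> stair s t' xs"
  by (auto simp: stair_def)

lemma rk_le: "rk s xs x \<le> length xs"
  by (simp add: rk_def length_takeWhile_le)

lemma lt_nth_rk:
  assumes "stair s t xs" "j < length xs"
  shows "lt s (fst (xs ! j)) x \<longleftrightarrow> j < rk s xs x"
proof
  assume "j < rk s xs x"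
  then show "lt s (fst (xs ! j)) x"
    unfolding rk_def by (metis nth_mem set_takeWhileD takeWhile_nth)
next
  assume L: "lt s (fst (xs ! j)) x"
  show "j < rk s xs x"
  proof (rule ccontr)
    assume "\<not> j < rk s xs x"
    then have r: "rk s xs x \<le> j" by simp
    have "\<not> lt s (fst (xs ! rk s xs x)) x"
      using nth_length_takeWhile[of "\<lambda>e. lt s (fst e) x" xs] r assms(2) unfolding rk_def by simp
    moreover have "lt s (fst (xs ! rk s xs x)) x"
    proof (cases "rk s xs x = j")
      case False
      then have "lt s (fst (xs ! rk s xs x)) (fst (xs ! j))"
        using assms r by (auto simp: stair_def sorted_wrt_iff_nth_less)
      then show ?thesis using L lt_trans by blast
    qed (use L in simp)
    ultimately show False by simp
  qed
qed

lemma rk_unique: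
  assumes "stair s t xs" "r \<le> length xs" "\<And>j. j < length xs \<Longrightarrow> lt s (fst (xs ! j)) x \<longleftrightarrow> j < r"
  shows "rk s xs x = r"
  using assms lt_nth_rk[OF assms(1)] rk_le[of s xs x]
  by (metis linorder_neqE_nat order_less_le_trans order_less_irrefl)

lemma entry_rk:
  assumes "stair s t xs"
  obtains "rk s xs x = 0" "entry xs (rk s xs x) = (0, 0)"
  | "entry xs (rk s xs x) \<in> set xs" "lt s (fst (entry xs (rk s xs x))) x" "0 < snd (entry xs (rk s xs x))"
proof (cases "rk s xs x")
  case 0
  then show ?thesis using that by simp
next
  case (Suc j)
  then have j: "j < length xs" using rk_le[of s xs x] by simp
  have e: "entry xs (rk s xs x) = xs ! j" using Suc by simp
  have "lt s (fst (xs ! j)) x" using lt_nth_rk[OF assms j] Suc by simp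
  moreover have "xs ! j \<in> set xs" using j by simp
  moreover have "0 < snd (xs ! j)" using assms j by (simp add: stair_def)
  ultimately show ?thesis using that(2) e by simp
qed

lemma entry_rk_ge:
  assumes "stair s t xs" "e \<in> set xs" "lt s (fst e) x"
  shows "snd e \<le> snd (entry xs (rk s xs x))"
proof -
  obtain j where j: "j < length xs" "e = xs ! j" using assms(2) by (metis in_set_conv_nth)
  then have "j < rk s xs x" using lt_nth_rk[OF assms(1)] assms(3) by blast
  then obtain r where r: "rk s xs x = Suc r" "j \<le> r" by (cases "rk s xs x") auto
  then have "r < length xs" using rk_le[of s xs x] by simp
  then show ?thesis
    using r j assms(1) by (cases "j = r") (auto simp: stair_def sorted_wrt_iff_nth_less less_imp_le)
qed

lemma set_dropWhile_keep: "e \<in> set xs \<Longrightarrow> \<not> p e \<Longrightarrow> e \<in> set (dropWhile p xs)"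
  by (induction xs) auto

lemma set_ins: "e \<in> set (ins s xs x w) \<Longrightarrow> e \<in> set xs \<or> e = (x, w)"
  by (auto simp: ins_def Let_def split: if_splits dest: in_set_takeD in_set_dropD set_dropWhileD)

lemma stair_drop_rk:
  assumes "stair s t xs" "t < x" "x \<le> n" "e \<in> set (drop (rk s xs x) xs)"
  shows "lt s x (fst e)"
proof -
  obtain j where j: "j < length xs - rk s xs x" "e = xs ! (rk s xs x + j)"
    using assms(4) by (metis in_set_conv_nth length_drop nth_drop rk_le)
  have "\<not> lt s (fst e) x"
    using lt_nth_rk[OF assms(1), of "rk s xs x + j" x] j by simp
  moreover have "e \<in> set xs" using assms(4) by (rule in_set_dropD)
  ultimately show ?thesis
    using assms lt_total[of x "fst e" s] by (force simp: stair_def)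
qed

lemma stair_ins:
  assumes "stair s t xs" "x = Suc t" "x \<le> n" "w \<le> x"
  shows "stair s x (ins s xs x w)"
proof (cases "snd (entry xs (rk s xs x)) < w")
  case False
  then show ?thesis using assms stair_mono[of s t xs x] by (simp add: ins_def)
next
  case True
  let ?r = "rk s xs x"
  let ?D = "dropWhile (\<lambda>e. snd e \<le> w) (drop ?r xs)"
  have insx: "ins s xs x w = take ?r xs @ (x, w) # ?D"
    using True by (simp add: ins_def Let_def)
  have R: "sorted_wrt (\<lambda>a b. lt s (fst a) (fst b) \<and> snd a < snd b) (take ?r xs @ drop ?r xs)"
    using assms(1) by (simp add: stair_def)
  have D: "sorted_wrt (\<lambda>a b. lt s (fst a) (fst b) \<and> snd a < snd b) ?D"
  proof -
    have "suffix ?D (drop ?r xs)" by (rule suffix_dropWhile)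
    then show ?thesis using R by (auto simp: sorted_wrt_append suffix_def)
  qed
  have sub: "set ?D \<subseteq> set (drop ?r xs)" by (auto dest: set_dropWhileD)
  have 1: "lt s (fst a) x \<and> snd a < w" if "a \<in> set (take ?r xs)" for a
  proof -
    have a: "a \<in> set xs" "lt s (fst a) x"
      using that by (auto dest: in_set_takeD simp: rk_def takeWhile_eq_take[symmetric] dest: set_takeWhileD)
    then show ?thesis using entry_rk_ge[OF assms(1) a] True by simp
  qed
  have 2: "lt s x (fst b) \<and> w < snd b" if "b \<in> set ?D" for b
  proof
    have "b \<in> set (drop ?r xs)" using sub that by (rule subsetD)
    then show "lt s x (fst b)" using stair_drop_rk[OF assms(1) _ assms(3)] assms(2) by simp
    have "?D \<noteq> []"
    proof
      assume "?D = []"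
      show False using that unfolding \<open>?D = []\<close> by (simp only: list.set(1) empty_iff)
    qed
    then have "\<not> snd (hd ?D) \<le> w" by (rule hd_dropWhile)
    then show "w < snd b" using sorted_wrt_hd[OF D that] by auto
  qed
  have 3: "lt s (fst a) (fst b) \<and> snd a < snd b" if "a \<in> set (take ?r xs)" "b \<in> set ?D" for a b
    using R that sub unfolding sorted_wrt_append by blast
  have "sorted_wrt (\<lambda>a b. lt s (fst a) (fst b) \<and> snd a < snd b) (take ?r xs @ (x, w) # ?D)"
    using R D 1 2 3 unfolding sorted_wrt_append sorted_wrt.simps(2) by auto
  moreover have "\<forall>e\<in>set (take ?r xs @ (x, w) # ?D). 1 \<le> fst e \<and> fst e \<le> x \<and> 0 < snd e \<and> snd e \<le> fst e"
  proof
    fix e assume "e \<in> set (take ?r xs @ (x, w) # ?D)"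
    then have "e \<in> set xs \<or> e = (x, w)"
      using set_ins[of e s xs x w] unfolding insx by blast
    then show "1 \<le> fst e \<and> fst e \<le> x \<and> 0 < snd e \<and> snd e \<le> fst e"
      using assms True by (auto simp: stair_def)
  qed
  ultimately show ?thesis unfolding insx stair_def by blast
qed

lemma stair_appendD: "stair s t (zs @ xs) \<Longrightarrow> stair s t xs"
  by (auto simp: stair_def sorted_wrt_append)

lemma stair_prune: "stair s t xs \<Longrightarrow> stair s t (prune m xs)"
  using stair_appendD[of s t "takeWhile (\<lambda>e. snd e + k \<le> m) xs" "prune m xs"] by (simp add: prune_def)

lemma ins_removed:
  assumes "stair s t xs" "t < x" "x \<le> n" "e \<in> set xs"
  shows "e \<in> set (ins s xs x w) \<or> (x, w) \<in> set (ins s xs x w) \<and> snd e \<le> w \<and> lt s x (fst e)"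
proof -
  let ?r = "rk s xs x"
  have "e \<in> set (take ?r xs) \<or> e \<in> set (drop ?r xs)"
    using assms(4) by (metis Un_iff append_take_drop_id set_append)
  then show ?thesis
    using assms(4) stair_drop_rk[OF assms(1-3), of e] set_dropWhile_keep[of e "drop ?r xs" "\<lambda>e. snd e \<le> w"]
    by (auto simp: ins_def Let_def)
qed

lemma covers_ins:
  assumes "stair s t xs" "t < x" "x \<le> n" "covers s xs v w'"
  shows "covers s (ins s xs x w) v w'"
proof -
  obtain e where e: "e \<in> set xs" "w' \<le> snd e" "\<not> dlt (s < k) v (key (fst e))"
    using assms(4) by (auto simp: covers_def)
  from ins_removed[OF assms(1-3) e(1), of w] show ?thesis
  proof
    assume "e \<in> set (ins s xs x w)"
    then show ?thesis using e by (auto simp: covers_def)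
  next
    assume "(x, w) \<in> set (ins s xs x w) \<and> snd e \<le> w \<and> lt s x (fst e)"
    then show ?thesis using e unfolding covers_def
      by (intro bexI[of _ "(x, w)"]) (auto simp: lt_def dlt_def split: if_splits)
  qed
qed

lemma covers_ins_self:
  assumes "stair s t xs" "0 < w"
  shows "covers s (ins s xs x w) (key x) w"
proof (cases "snd (entry xs (rk s xs x)) < w")
  case True
  then show ?thesis by (auto simp: covers_def ins_def Let_def dlt_def)
next
  case False
  let ?e = "entry xs (rk s xs x)"
  have "?e \<in> set xs \<and> lt s (fst ?e) x"
  proof (rule entry_rk[OF assms(1), of x])
    assume "?e = (0, 0)"
    then show ?thesis using False assms(2) by simp
  qed blast
  moreover have "ins s xs x w = xs" using False by (simp add: ins_def)
  moreover have "w \<le> snd ?e" using False by simp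
  moreover have "lt s (fst ?e) x \<Longrightarrow> \<not> dlt (s < k) (key x) (key (fst ?e))"
    by (auto simp: lt_def dlt_def split: if_splits)
  ultimately show ?thesis unfolding covers_def by auto
qed

lemma set_prune: "e \<in> set xs \<Longrightarrow> m < snd e + k \<Longrightarrow> e \<in> set (prune m xs)"
  unfolding prune_def by (rule set_dropWhile_keep) simp_all

lemma prune_subset: "set (prune m xs) \<subseteq> set xs"
  by (auto simp: prune_def dest: set_dropWhileD)

lemma covers_prune:
  assumes "covers s xs v w" "m < w + k"
  shows "covers s (prune m xs) v w"
proof -
  obtain e where e: "e \<in> set xs" "w \<le> snd e" "\<not> dlt (s < k) v (key (fst e))"
    using assms(1) by (auto simp: covers_def)
  then have "e \<in> set (prune m xs)" using set_prune assms(2) by simp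
  then show ?thesis using e unfolding covers_def by blast
qed

lemma covers_entry_rk:
  assumes "stair s t xs" "covers s xs v w" "dlt (s < k) v (key x)"
  shows "w \<le> snd (entry xs (rk s xs x))"
proof -
  obtain e where e: "e \<in> set xs" "w \<le> snd e" "\<not> dlt (s < k) v (key (fst e))"
    using assms(2) by (auto simp: covers_def)
  then have "lt s (fst e) x" using assms(3) by (auto simp: lt_def dlt_def split: if_splits)
  then show ?thesis using entry_rk_ge[OF assms(1) e(1)] e(2) by (metis le_trans)
qed

lemma covers_mono: "covers s xs v w \<Longrightarrow> w' \<le> w \<Longrightarrow> v = v' \<or> dlt (s < k) v v' \<Longrightarrow> covers s xs v' w'"
  unfolding covers_def dlt_def by (force split: if_splits)

section \<open>Transitions between states and their witnesses\<close>

definition pred_len :: "(nat \<Rightarrow> stair) \<Rightarrow> nat \<Rightarrow> nat \<Rightarrow> nat" where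
  "pred_len X s x = snd (entry (X s) (rk s (X s) x))"

text \<open>A run becomes or stays full in two ways: from length \<open>k - 1\<close>, or from the
  state of length \<open>k\<close>, which stands for all greater lengths. The offset
  \<open>a\<close> of the direction is 0 or \<open>k\<close>.\<close>

definition full_len :: "(nat \<Rightarrow> stair) \<Rightarrow> nat \<Rightarrow> nat \<Rightarrow> nat" where
  "full_len X a x = max (succ0 (pred_len X (a + k - 2) x)) (succ0 (pred_len X (a + k - 1) x))"

text \<open>The states 0 and \<open>k\<close> have last runs of length 1. They are entered by a
  fresh start or by crediting a full run of the opposite direction; the latter already ends in
  \<open>x\<close>, which is the shared turning element, so nothing is added to its length.\<close>

definition new_len :: "(nat \<Rightarrow> stair) \<Rightarrow> nat \<Rightarrow> nat \<Rightarrow> nat" where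
  "new_len X s x =
    (if s = 0 then max 1 (full_len X k x) else if s = k then max 1 (full_len X 0 x)
     else if s = k - 1 then full_len X 0 x else if s = 2 * k - 1 then full_len X k x
     else succ0 (pred_len X (s - 1) x))"

definition insert_all :: "(nat \<Rightarrow> stair) \<Rightarrow> nat \<Rightarrow> (nat \<Rightarrow> stair)" where
  "insert_all X x = (\<lambda>s. ins s (X s) x (new_len X s x))"

definition run_len :: "nat \<Rightarrow> nat" where
  "run_len s = (if s < k then s + 1 else s - k + 1)"

definition index :: "bool \<Rightarrow> nat \<Rightarrow> nat" where
  "index d j = (if d then 0 else k) + (j - 1)"

definition witness :: "bool \<Rightarrow> nat \<Rightarrow> nat \<Rightarrow> nat \<Rightarrow> bool" where
  "witness d j y v \<longleftrightarrow>
     (\<exists>ys. subseq ys (take y S) \<and> ends k d j ys \<and> last ys = key y \<and> length ys = v)"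

lemma take_key: "1 \<le> x \<Longrightarrow> x \<le> n \<Longrightarrow> take x S = take (x - 1) S @ [key x]"
  using take_Suc_conv_app_nth[of "x - 1" S] by (simp add: key_def)

lemma subseq_take_mono: "subseq ys (take a S) \<Longrightarrow> a \<le> b \<Longrightarrow> subseq ys (take b S)"
proof -
  assume A: "subseq ys (take a S)" "a \<le> b"
  have "take b S = take a S @ take (b - a) (drop a S)"
    using A(2) by (metis le_add_diff_inverse take_add)
  then show ?thesis
    using list_emb_append_mono[OF A(1) list_emb_Nil, of "take (b - a) (drop a S)"] by simp
qed

lemma witness_single: "1 \<le> x \<Longrightarrow> x \<le> n \<Longrightarrow> witness d 1 x 1"
  unfolding witness_def by (intro exI[of _ "[key x]"]) (auto simp: ends_single[simplified] take_key)

lemma witness_step: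
  assumes "witness d j y v" "y < x" "x \<le> n" "dlt d (key y) (key x)"
  shows "witness d (Suc j) x (Suc v)"
proof -
  obtain ys where ys: "subseq ys (take y S)" "ends k d j ys" "last ys = key y" "length ys = v"
    using assms(1) by (auto simp: witness_def)
  have "subseq ys (take (x - 1) S)" using subseq_take_mono[OF ys(1), of "x - 1"] assms(2) by simp
  then have "subseq (ys @ [key x]) (take x S)"
    using assms take_key[of x] by (simp add: list_emb_append_mono)
  then show ?thesis
    unfolding witness_def using ends_snoc[OF ys(2)] ys assms(4) by (intro exI[of _ "ys @ [key x]"]) auto
qed

lemma witness_cap: "witness d (Suc k) y v \<Longrightarrow> witness d k y v"
  unfolding witness_def using ends_cap by blast

lemma witness_turn: "witness d k y v \<Longrightarrow> witness (\<not> d) 1 y v"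
  unfolding witness_def using ends_turn k3 by (metis Suc_leD numeral_2_eq_2 numeral_3_eq_3)

definition sound :: "nat \<Rightarrow> (nat \<Rightarrow> stair) \<Rightarrow> bool" where
  "sound t X \<longleftrightarrow> (\<forall>s<2 * k. stair s t (X s) \<and> (\<forall>e\<in>set (X s). witness (s < k) (run_len s) (fst e) (snd e)))"

lemma pred_len_witness:
  assumes "sound t X" "t < x" "x \<le> n" "s < 2 * k"
  shows "succ0 (pred_len X s x) \<le> x"
    "0 < succ0 (pred_len X s x) \<Longrightarrow> witness (s < k) (Suc (run_len s)) x (succ0 (pred_len X s x))"
proof -
  have st: "stair s t (X s)" using assms by (simp add: sound_def)
  have "succ0 (pred_len X s x) \<le> x \<and>
    (0 < succ0 (pred_len X s x) \<longrightarrow> witness (s < k) (Suc (run_len s)) x (succ0 (pred_len X s x)))"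
  proof (rule entry_rk[OF st, of x])
    assume "entry (X s) (rk s (X s) x) = (0, 0)"
    then show ?thesis by (simp add: pred_len_def succ0_def)
  next
    let ?e = "entry (X s) (rk s (X s) x)"
    assume e: "?e \<in> set (X s)" "lt s (fst ?e) x" "0 < snd ?e"
    then have "witness (s < k) (run_len s) (fst ?e) (snd ?e)" "fst ?e \<le> t" "snd ?e \<le> fst ?e"
      using assms(1,4) st by (auto simp: sound_def stair_def)
    then show ?thesis
      using witness_step[of "s < k" "run_len s" "fst ?e" "snd ?e" x] e assms
      by (auto simp: pred_len_def succ0_def lt_def)
  qed
  then show "succ0 (pred_len X s x) \<le> x"
    "0 < succ0 (pred_len X s x) \<Longrightarrow> witness (s < k) (Suc (run_len s)) x (succ0 (pred_len X s x))" by auto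
qed

lemma full_len_witness:
  assumes "sound t X" "t < x" "x \<le> n" "a = (if d then 0 else k)"
  shows "full_len X a x \<le> x" "0 < full_len X a x \<Longrightarrow> witness d k x (full_len X a x)"
proof -
  have s: "a + k - 2 < 2 * k" "a + k - 1 < 2 * k" using assms(4) k3 by auto
  have d: "(a + k - 2 < k) = d" "(a + k - 1 < k) = d"
    "Suc (run_len (a + k - 2)) = k" "Suc (run_len (a + k - 1)) = Suc k"
    using assms(4) k3 by (auto simp: run_len_def)
  show "full_len X a x \<le> x"
    using pred_len_witness(1)[OF assms(1-3)] s by (simp add: full_len_def)
  show "witness d k x (full_len X a x)" if "0 < full_len X a x"
    using that pred_len_witness(2)[OF assms(1-3) s(1)] pred_len_witness(2)[OF assms(1-3) s(2)] witness_cap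
    unfolding d full_len_def max_def by (auto split: if_splits)
qed

lemma new_len_witness:
  assumes "sound t X" "x = Suc t" "x \<le> n" "s < 2 * k"
  shows "new_len X s x \<le> x" "0 < new_len X s x \<Longrightarrow> witness (s < k) (run_len s) x (new_len X s x)"
proof -
  have tx: "t < x" "1 \<le> x" using assms by auto
  note U = full_len_witness[OF assms(1) tx(1) assms(3), of 0 True, simplified]
  note D = full_len_witness[OF assms(1) tx(1) assms(3), of k False, simplified]
  note P = pred_len_witness[OF assms(1) tx(1) assms(3)]
  have B: "max 1 (full_len X k x) \<le> x \<and> witness True 1 x (max 1 (full_len X k x))"
    using D witness_single[OF tx(2) assms(3)] witness_turn[of False] tx by (auto simp: max_def)
  have C: "max 1 (full_len X 0 x) \<le> x \<and> witness False 1 x (max 1 (full_len X 0 x))"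
    using U witness_single[OF tx(2) assms(3)] witness_turn[of True] tx by (auto simp: max_def)
  have E: "run_len s = Suc (run_len (s - 1)) \<and> (s < k) = (s - 1 < k)" if "s \<noteq> 0" "s \<noteq> k"
    using that by (auto simp: run_len_def)
  have F: "run_len 0 = 1" "run_len k = 1" "run_len (k - 1) = k" "run_len (2 * k - 1) = k"
    using k3 by (auto simp: run_len_def)
  consider "s = 0" | "s = k" | "s = k - 1" "s \<noteq> 0" "s \<noteq> k" | "s = 2 * k - 1" "s \<noteq> 0" "s \<noteq> k" "s \<noteq> k - 1"
    | "s \<noteq> 0" "s \<noteq> k" "s \<noteq> k - 1" "s \<noteq> 2 * k - 1" by blast
  then have "new_len X s x \<le> x \<and> (0 < new_len X s x \<longrightarrow> witness (s < k) (run_len s) x (new_len X s x))"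
  proof cases
    case 1 then show ?thesis using B F k3 by (simp add: new_len_def)
  next
    case 2 then show ?thesis using C F k3 by (simp add: new_len_def)
  next
    case 3 then show ?thesis using U F k3 by (simp add: new_len_def)
  next
    case 4
    then have "\<not> s < k" using k3 by simp
    with 4 show ?thesis using D F k3 by (simp add: new_len_def)
  next
    case 5 then show ?thesis using E P[of "s - 1"] assms(4) by (simp add: new_len_def)
  qed
  then show "new_len X s x \<le> x" "0 < new_len X s x \<Longrightarrow> witness (s < k) (run_len s) x (new_len X s x)" by auto
qed

lemma sound_insert_all:
  assumes "sound t X" "x = Suc t" "x \<le> n"
  shows "sound x (insert_all X x)"
  unfolding sound_def
proof (intro allI impI conjI ballI)
  fix s assume s: "s < 2 * k"
  have st: "stair s t (X s)" using assms s by (simp add: sound_def)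
  show st': "stair s x (insert_all X x s)"
    unfolding insert_all_def by (rule stair_ins[OF st assms(2,3)]) (use new_len_witness assms s in blast)
  fix e assume e: "e \<in> set (insert_all X x s)"
  then have "e \<in> set (X s) \<or> e = (x, new_len X s x)" unfolding insert_all_def by (rule set_ins)
  moreover have "0 < snd e" using st' e by (auto simp: stair_def)
  ultimately show "witness (s < k) (run_len s) (fst e) (snd e)"
    using new_len_witness(2)[OF assms s] assms(1) s by (auto simp: sound_def)
qed

lemma sound_prune: "sound t X \<Longrightarrow> sound t (\<lambda>s. prune m (X s))"
  unfolding sound_def using stair_prune prune_subset by (meson subsetD)

section \<open>Optimality of the pruned tables\<close>

lemma index_less: "1 \<le> j \<Longrightarrow> j \<le> k \<Longrightarrow> index d j < 2 * k"
  by (auto simp: index_def)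

lemma index_dir: "1 \<le> j \<Longrightarrow> j \<le> k \<Longrightarrow> (index d j < k) = d"
  by (auto simp: index_def)

lemma new_len_index:
  assumes "1 \<le> j" "j \<le> k"
  shows "new_len X (index d j) x =
    (if j = 1 then max 1 (full_len X (index (\<not> d) 1) x)
     else if j = k then full_len X (index d 1) x
     else succ0 (pred_len X (index d (j - 1)) x))"
  using assms k3 by (cases d) (auto simp: new_len_def index_def)

lemma full_len_index:
  "full_len X (index d 1) x = max (succ0 (pred_len X (index d (k - 1)) x)) (succ0 (pred_len X (index d k) x))"
  using k3 by (cases d) (auto simp: full_len_def index_def numeral_2_eq_2)

text \<open>The value \<open>v\<close> itself need not occur in the table. Whatever dominates it
  also precedes \<open>x\<close>, and the predecessor of \<open>x\<close> is the longest entry on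
  that side.\<close>

lemma covers_step:
  assumes "sound t X" "1 \<le> j" "covers (index d (min j k)) (X (index d (min j k))) v m" "0 < m"
    "dlt d v (key x)"
  shows "Suc m \<le> new_len X (index d (min (Suc j) k)) x"
    "k \<le> Suc j \<Longrightarrow> Suc m \<le> full_len X (index d 1) x"
proof -
  let ?i = "index d (min j k)"
  have i: "1 \<le> min j k" "min j k \<le> k" using assms(2) k3 by auto
  have "stair ?i t (X ?i)" using assms(1) index_less[OF i] by (auto simp: sound_def)
  then have "m \<le> pred_len X ?i x"
    unfolding pred_len_def by (rule covers_entry_rk[OF _ assms(3)]) (use assms(5) index_dir[OF i] in simp)
  then have p: "Suc m \<le> succ0 (pred_len X ?i x)" using assms(4) by (simp add: succ0_def)
  show 1: "Suc m \<le> full_len X (index d 1) x" if "k \<le> Suc j"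
  proof -
    have "min j k = k - 1 \<or> min j k = k" using that by auto
    then show ?thesis using p unfolding full_len_index by fastforce
  qed
  show "Suc m \<le> new_len X (index d (min (Suc j) k)) x"
  proof (cases "k \<le> Suc j")
    case True
    then have "min (Suc j) k = k" by simp
    then show ?thesis using 1[OF True] new_len_index[of k X d x] k3 by simp
  next
    case False
    then show ?thesis using p assms(2) new_len_index[of "Suc j" X d x] by (simp add: min_def)
  qed
qed

lemma covers_insert_all:
  assumes "sound t X" "x = Suc t" "x \<le> n" "s < 2 * k" "covers s (X s) v m"
  shows "covers s (insert_all X x s) v m"
  unfolding insert_all_def by (rule covers_ins) (use assms in \<open>auto simp: sound_def\<close>)

lemma covers_insert_all_self:
  assumes "sound t X" "s < 2 * k" "0 < m" "m \<le> new_len X s x"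
  shows "covers s (insert_all X x s) (key x) m"
  unfolding insert_all_def
  by (rule covers_mono[OF covers_ins_self[of s t]]) (use assms in \<open>auto simp: sound_def\<close>)

section \<open>Following an optimal rollercoaster through the tables\<close>

text \<open>The true run length \<open>j\<close> is kept, and only the table index is capped. A full
  run must also be covered in the opposite state of length 1, since the next turn is taken from
  there, and it must be reflected in the best lengths, since \<open>R\<close> may end with
  it.\<close>

definition traced :: "nat \<Rightarrow> (nat \<Rightarrow> stair) \<Rightarrow> (bool \<Rightarrow> nat) \<Rightarrow> real list \<Rightarrow> bool" where
  "traced t X L R \<longleftrightarrow> (\<exists>P Q. R = P @ Q \<and> subseq P (take t S) \<and> subseq Q (drop t S) \<and>
     (P = [] \<or> (\<exists>d j. 1 \<le> j \<and> completes k d j (last P) Q \<and>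
        covers (index d (min j k)) (X (index d (min j k))) (last P) (length P) \<and>
        (k \<le> j \<longrightarrow> covers (index (\<not> d) 1) (X (index (\<not> d) 1)) (last P) (length P) \<and>
          length P \<le> L d))))"

definition new_best :: "(nat \<Rightarrow> stair) \<Rightarrow> nat \<Rightarrow> (bool \<Rightarrow> nat) \<Rightarrow> bool \<Rightarrow> nat" where
  "new_best X x L d = max (L d) (full_len X (index d 1) x)"

lemma covers_full:
  assumes "sound t X" "0 < m" "m \<le> full_len X (index d 1) x"
  shows "covers (index (\<not> d) 1) (insert_all X x (index (\<not> d) 1)) (key x) m"
    "covers (index d k) (insert_all X x (index d k)) (key x) m" "m \<le> new_best X x L d"
proof -
  show "covers (index (\<not> d) 1) (insert_all X x (index (\<not> d) 1)) (key x) m"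
    by (rule covers_insert_all_self[OF assms(1)])
      (use assms k3 index_less[of 1] new_len_index[of 1] in auto)
  show "covers (index d k) (insert_all X x (index d k)) (key x) m"
    by (rule covers_insert_all_self[OF assms(1)])
      (use assms k3 index_less[of k] new_len_index[of k] in auto)
  show "m \<le> new_best X x L d" using assms by (simp add: new_best_def)
qed

lemma traced_insert_all:
  assumes "sound t X" "x = Suc t" "x \<le> n" "coaster k R" "R \<noteq> []" "traced t X L R"
  shows "traced x (insert_all X x) (new_best X x L) R"
proof -
  let ?X = "insert_all X x"
  obtain P Q where PQ: "R = P @ Q" "subseq P (take t S)" "subseq Q (drop t S)"
    and tr: "P = [] \<or> (\<exists>d j. 1 \<le> j \<and> completes k d j (last P) Q \<and>
        covers (index d (min j k)) (X (index d (min j k))) (last P) (length P) \<and>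
        (k \<le> j \<longrightarrow> covers (index (\<not> d) 1) (X (index (\<not> d) 1)) (last P) (length P) \<and> length P \<le> L d))"
    using assms(6) unfolding traced_def by blast
  have drop: "drop t S = key x # drop x S"
    using assms(2,3) by (simp add: key_def Cons_nth_drop_Suc)
  have take: "take x S = take t S @ [key x]"
    using take_key[of x] assms(2,3) by simp
  have ix: "index d (min j k) < 2 * k" if "1 \<le> j" for d j
    using index_less[of "min j k" d] that k3 by simp
  have ix1: "index d 1 < 2 * k" for d using index_less[of 1 d] k3 by simp
  consider (skip) "subseq Q (drop x S)" | (use) Q' where "Q = key x # Q'" "subseq Q' (drop x S)"
    using PQ(3) unfolding drop by (cases Q) (auto split: if_splits)
  then show ?thesis
  proof cases
    case skip
    have P: "subseq P (take x S)" using PQ(2) subseq_take_mono assms(2) by simp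
    have "P = [] \<or> (\<exists>d j. 1 \<le> j \<and> completes k d j (last P) Q \<and>
        covers (index d (min j k)) (?X (index d (min j k))) (last P) (length P) \<and>
        (k \<le> j \<longrightarrow> covers (index (\<not> d) 1) (?X (index (\<not> d) 1)) (last P) (length P)
          \<and> length P \<le> new_best X x L d))"
    proof (cases "P = []")
      case False
      then obtain d j where dj: "1 \<le> j" "completes k d j (last P) Q"
        "covers (index d (min j k)) (X (index d (min j k))) (last P) (length P)"
        "k \<le> j \<Longrightarrow> covers (index (\<not> d) 1) (X (index (\<not> d) 1)) (last P) (length P) \<and> length P \<le> L d"
        using tr by blast
      have "covers (index d (min j k)) (?X (index d (min j k))) (last P) (length P)"
        using covers_insert_all[OF assms(1-3) ix[OF dj(1)] dj(3)] .
      moreover have "covers (index (\<not> d) 1) (?X (index (\<not> d) 1)) (last P) (length P) \<and> length P \<le> new_best X x L d"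
        if "k \<le> j"
        using covers_insert_all[OF assms(1-3) ix1] dj(4)[OF that] by (auto simp: new_best_def)
      ultimately show ?thesis using dj(1,2) by blast
    qed simp
    then show ?thesis unfolding traced_def using PQ(1) P skip by blast
  next
    case use
    let ?P = "P @ [key x]"
    have R: "R = ?P @ Q'" "subseq ?P (take x S)"
      using PQ use take by (simp_all add: list_emb_append_mono)
    have "\<exists>d j. 1 \<le> j \<and> completes k d j (last ?P) Q' \<and>
        covers (index d (min j k)) (?X (index d (min j k))) (last ?P) (length ?P) \<and>
        (k \<le> j \<longrightarrow> covers (index (\<not> d) 1) (?X (index (\<not> d) 1)) (last ?P) (length ?P)
          \<and> length ?P \<le> new_best X x L d)"
    proof (cases "P = []")
      case True
      then obtain d where d: "completes k d 1 (key x) Q'"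
        using assms(4) PQ use by (auto simp: coaster_def)
      have "covers (index d 1) (?X (index d 1)) (key x) 1"
        by (rule covers_insert_all_self[OF assms(1) ix1]) (use new_len_index[of 1] k3 in auto)
      then show ?thesis using d True k3 by (intro exI[of _ d] exI[of _ 1]) (simp add: min_def)
    next
      case False
      then have m: "0 < length P" by simp
      obtain d j where dj: "1 \<le> j" "completes k d j (last P) (key x # Q')"
        "covers (index d (min j k)) (X (index d (min j k))) (last P) (length P)"
        "k \<le> j \<Longrightarrow> covers (index (\<not> d) 1) (X (index (\<not> d) 1)) (last P) (length P) \<and> length P \<le> L d"
        using tr False use(1) by blast
      show ?thesis
      proof (cases "dlt d (last P) (key x)")
        case True
        note st = covers_step[OF assms(1) dj(1,3) m True]
        have "covers (index d (min (Suc j) k)) (?X (index d (min (Suc j) k))) (key x) (Suc (length P))"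
          by (rule covers_insert_all_self[OF assms(1) ix _ st(1)]) simp_all
        then show ?thesis using dj(2) True covers_full[OF assms(1) _ st(2)]
          by (intro exI[of _ d] exI[of _ "Suc j"]) auto
      next
        case F: False
        then have t: "k \<le> j" "dlt (\<not> d) (last P) (key x)" "completes k (\<not> d) 2 (key x) Q'"
          using dj(2) by auto
        \<comment> \<open>The turn starts from the opposite state of length 1, to which the full run
          had been credited as well; the new element then ends a run of length 2.\<close>
        have c: "covers (index (\<not> d) (min 1 k)) (X (index (\<not> d) (min 1 k))) (last P) (length P)"
          using dj(4) t(1) k3 by (simp add: min_def)
        note st = covers_step[OF assms(1) order_refl c m t(2)]
        have "covers (index (\<not> d) (min (Suc 1) k)) (?X (index (\<not> d) (min (Suc 1) k))) (key x) (Suc (length P))"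
          by (rule covers_insert_all_self[OF assms(1) ix _ st(1)]) simp_all
        then show ?thesis using t(3) k3
          by (intro exI[of _ "\<not> d"] exI[of _ 2]) (auto simp: numeral_2_eq_2)
      qed
    qed
    then show ?thesis unfolding traced_def using R use(2) by blast
  qed
qed

lemma subseq_set_subset: "subseq xs ys \<Longrightarrow> set xs \<subseteq> set ys"
  by (induction rule: list_emb.induct) auto

lemma subseq_distinct: "subseq xs ys \<Longrightarrow> distinct ys \<Longrightarrow> distinct xs"
  by (induction rule: list_emb.induct) (auto dest: subseq_set_subset)

definition best_sound :: "nat \<Rightarrow> (bool \<Rightarrow> nat) \<Rightarrow> bool" where
  "best_sound t L \<longleftrightarrow>
     (\<forall>d. L d = 0 \<or> (\<exists>ys. subseq ys (take t S) \<and> ends k d k ys \<and> length ys = L d))"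

lemma best_sound_insert_all:
  assumes "sound t X" "x = Suc t" "x \<le> n" "best_sound t L"
  shows "best_sound x (new_best X x L)"
  unfolding best_sound_def
proof
  fix d
  show "new_best X x L d = 0 \<or>
    (\<exists>ys. subseq ys (take x S) \<and> ends k d k ys \<and> length ys = new_best X x L d)"
  proof (cases "L d < full_len X (index d 1) x")
    case True
    have "witness d k x (full_len X (index d 1) x)"
      by (rule full_len_witness(2)[OF assms(1) _ assms(3)]) (use assms(2) True in \<open>auto simp: index_def\<close>)
    then show ?thesis using True by (auto simp: new_best_def witness_def max_def)
  next
    case False
    then have "new_best X x L d = L d" by (simp add: new_best_def)
    then show ?thesis using assms(2,4) subseq_take_mono[of _ t x] unfolding best_sound_def
      by (metis le_SucI order_refl)
  qed
qed

definition optimal :: "real list \<Rightarrow> bool" where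
  "optimal R \<longleftrightarrow> subseq R S \<and> coaster k R \<and> R \<noteq> [] \<and>
     (\<forall>R'. subseq R' S \<and> coaster k R' \<longrightarrow> length R' \<le> length R)"

text \<open>If \<open>P\<close> were not above the threshold, both best rollercoasters would be at
  least \<open>k\<close> longer than \<open>P\<close>. The exchange loses fewer than
  \<open>k\<close> elements of \<open>Q\<close>, so the result would be strictly longer than the
  optimal \<open>R\<close>.\<close>

lemma traced_prune:
  assumes "best_sound t L" "optimal R" "traced t X L R"
  shows "traced t (\<lambda>s. prune (min (L True) (L False)) (X s)) L R"
proof -
  let ?m = "min (L True) (L False)"
  let ?X = "\<lambda>s. prune ?m (X s)"
  obtain P Q where PQ: "R = P @ Q" "subseq P (take t S)" "subseq Q (drop t S)"
    and tr: "P = [] \<or> (\<exists>d j. 1 \<le> j \<and> completes k d j (last P) Q \<and>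
        covers (index d (min j k)) (X (index d (min j k))) (last P) (length P) \<and>
        (k \<le> j \<longrightarrow> covers (index (\<not> d) 1) (X (index (\<not> d) 1)) (last P) (length P) \<and> length P \<le> L d))"
    using assms(3) unfolding traced_def by blast
  have "P = [] \<or> (\<exists>d j. 1 \<le> j \<and> completes k d j (last P) Q \<and>
        covers (index d (min j k)) (?X (index d (min j k))) (last P) (length P) \<and>
        (k \<le> j \<longrightarrow> covers (index (\<not> d) 1) (?X (index (\<not> d) 1)) (last P) (length P) \<and> length P \<le> L d))"
  proof (cases "P = []")
    case False
    then obtain d j where dj: "1 \<le> j" "completes k d j (last P) Q"
      "covers (index d (min j k)) (X (index d (min j k))) (last P) (length P)"
      "k \<le> j \<Longrightarrow> covers (index (\<not> d) 1) (X (index (\<not> d) 1)) (last P) (length P) \<and> length P \<le> L d"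
      using tr by blast
    have "?m < length P + k"
    proof (rule ccontr)
      assume "\<not> ?m < length P + k"
      then have big: "length P + k \<le> L e" for e by (cases e) auto
      have "\<exists>ys. subseq ys (take t S) \<and> ends k e k ys \<and> length ys = L e" for e
        using assms(1) big[of e] k3 unfolding best_sound_def by (metis add_is_0 le_zero_eq not_numeral_le_zero)
      then obtain B where B: "\<And>e. subseq (B e) (take t S)" "\<And>e. ends k e k (B e)" "\<And>e. length (B e) = L e"
        by metis
      \<comment> \<open>The exchange needs a strict comparison between the endpoints and
        \<open>Q\<close>. They lie in the two parts of the input, which are disjoint by
        distinctness.\<close>
      have "last (B e) \<notin> set Q" for e
      proof -
        have "last (B e) \<in> set (take t S)"
          using subseq_set_subset[OF B(1)[of e]] B(2)[of e] by (auto simp: ends_def)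
        moreover have "set Q \<subseteq> set (drop t S)"
          using subseq_set_subset[OF PQ(3)] .
        moreover have "set (take t S) \<inter> set (drop t S) = {}"
          using dist by (simp add: set_take_disj_set_drop_if_distinct)
        ultimately show ?thesis by blast
      qed
      then obtain e Q' where
        Q': "subseq Q' Q" "length Q < length Q' + k" "completes k e k (last (B e)) Q'"
        using exchange[OF dj(2) k3, of "\<lambda>e. last (B e)"] by auto
      have "coaster k (B e @ Q')" using B(2)[of e] Q'(3) by (simp add: ends_def)
      moreover have "subseq (B e @ Q') S"
      proof -
        have "subseq (B e @ Q') (take t S @ drop t S)"
          by (rule list_emb_append_mono[OF B(1) subseq_order.order_trans[OF Q'(1) PQ(3)]])
        then show ?thesis by simp
      qed
      ultimately have "length (B e @ Q') \<le> length R" using assms(2) unfolding optimal_def by blast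
      then show False using B(3)[of e] big[of e] Q'(2) PQ(1) by simp
    qed
    then have "covers (index d (min j k)) (?X (index d (min j k))) (last P) (length P)"
      "k \<le> j \<Longrightarrow> covers (index (\<not> d) 1) (?X (index (\<not> d) 1)) (last P) (length P) \<and> length P \<le> L d"
      using covers_prune dj(3,4) by blast+
    then show ?thesis using dj(1,2) by blast
  qed simp
  then show ?thesis unfolding traced_def using PQ by blast
qed

lemma traced_0: "subseq R S \<Longrightarrow> traced 0 X L R"
  unfolding traced_def by (intro exI[of _ "[]"] exI[of _ R]) simp

text \<open>When the input is exhausted, \<open>Q\<close> is empty. Then acceptance forces a full
  last run, for which \<open>traced\<close> bounds the length by the recorded best one.\<close>

lemma best_optimal:
  assumes "best_sound n L" "\<And>R. optimal R \<Longrightarrow> traced n X L R"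
  shows "max (L True) (L False) = longest_rollercoaster k S"
proof -
  let ?T = "{ys. subseq ys S \<and> rollercoaster k ys}"
  note fin = longest_rollercoaster_Max[of S k]
  have k2: "2 \<le> k" using k3 by simp
  have dist': "distinct ys" if "subseq ys S" for ys
    using subseq_distinct[OF that dist] .
  have roll: "rollercoaster k ys \<longleftrightarrow> ys = [] \<or> coaster k ys" if "subseq ys S" for ys
    using rollercoaster_iff[OF dist'[OF that] k2] .
  have le: "L d \<le> longest_rollercoaster k S" for d
  proof (cases "L d = 0")
    case False
    then obtain ys where ys: "subseq ys S" "ends k d k ys" "length ys = L d"
      using assms(1)[unfolded best_sound_def, rule_format, of d] by auto
    then have "ys \<in> ?T" using roll ends_coaster by blast
    then show ?thesis using ys(3) fin(1) unfolding longest_rollercoaster_def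
      by (metis Max_ge image_eqI)
  qed simp
  obtain R where R: "R \<in> ?T" "length R = longest_rollercoaster k S"
    using Max_in[OF fin] unfolding longest_rollercoaster_def by auto
  have "longest_rollercoaster k S \<le> max (L True) (L False)"
  proof (cases "R = []")
    case False
    have "length R' \<le> length R" if "subseq R' S" "coaster k R'" for R'
      using that roll R(2) fin(1) unfolding longest_rollercoaster_def
      by (metis (mono_tags, lifting) Max_ge image_eqI mem_Collect_eq)
    then have "optimal R" using R(1) roll False unfolding optimal_def by blast
    from assms(2)[OF this] obtain P Q where PQ: "R = P @ Q" "subseq Q (drop n S)"
        "P = [] \<or> (\<exists>d j. completes k d j (last P) Q \<and> (k \<le> j \<longrightarrow> length P \<le> L d))"
      unfolding traced_def by blast
    then have "Q = []" by simp
    with PQ(1,3) False obtain d where "length R \<le> L d" by auto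
    then show ?thesis using R(2) by (cases d) auto
  qed (use R in auto)
  then show ?thesis using le by (simp add: order.antisym)
qed

end

section \<open>Phases, classes and fingers\<close>

text \<open>Elements are numbered from 1, so that \<open>lastx A g = 0\<close> means that class \<open>g\<close> is empty.\<close>

record config =
  stairs :: "nat \<Rightarrow> (nat \<times> nat) list"
  best :: "bool \<Rightarrow> nat"
  tails :: "bool \<Rightarrow> nat list"
  lastx :: "nat \<Rightarrow> nat"

definition gap :: "nat \<Rightarrow> nat \<Rightarrow> nat" where
  "gap a b = (a - b) + (b - a)"

context input
begin

text \<open>The pile of \<open>x\<close> in patience sorting, with all piles from
  \<open>k - 1\<close> on merged into one. An element landing on an occupied pile below
  \<open>k - 1\<close> does not extend its top in direction \<open>d\<close>, so the values of such
  a pile move against \<open>d\<close>.\<close>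

definition label :: "bool \<Rightarrow> nat list \<Rightarrow> nat \<Rightarrow> nat" where
  "label d T x = length (takeWhile (\<lambda>y. dlt d (key y) (key x)) (take (k - 1) T))"

definition put :: "nat \<Rightarrow> nat \<Rightarrow> nat list \<Rightarrow> nat list" where
  "put u x T = (if u < length T then T[u := x] else T @ [x])"

text \<open>The first \<open>k - 1\<close> increasing piles are classes of falling values. The
  merged pile is split by decreasing piles, which gives classes of rising values. Class
  \<open>2 * k - 2\<close> is reached only if both labels are \<open>k - 1\<close>, and then the
  phase ends.\<close>

definition cls :: "config \<Rightarrow> nat \<Rightarrow> nat" where
  "cls A x = (let u = label True (tails A True) x in
     if Suc u < k then u else k - 1 + label False (tails A False) x)"

definition advance :: "nat \<Rightarrow> config \<Rightarrow> config" where
  "advance x A = \<lparr>stairs = insert_all (stairs A) x, best = new_best (stairs A) x (best A),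
     tails = (\<lambda>d. put (label d (tails A d) x) x (tails A d)), lastx = (lastx A)(cls A x := x)\<rparr>"

definition full :: "config \<Rightarrow> bool" where
  "full A \<longleftrightarrow> k \<le> length (tails A True) \<and> k \<le> length (tails A False)"

definition reset :: "config \<Rightarrow> config" where
  "reset A = \<lparr>stairs = (\<lambda>s. prune (min (best A True) (best A False)) (stairs A s)), best = best A,
     tails = (\<lambda>_. []), lastx = (\<lambda>_. 0)\<rparr>"

definition step :: "nat \<Rightarrow> config \<Rightarrow> config" where
  "step x A = (let B = advance x A in if full B then reset B else B)"

definition valid :: "nat \<Rightarrow> config \<Rightarrow> bool" where
  "valid t A \<longleftrightarrow> sound t (stairs A) \<and> best_sound t (best A) \<and>
     (\<forall>R. optimal R \<longrightarrow> traced t (stairs A) (best A) R)"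

lemma valid_advance: "valid t A \<Longrightarrow> x = Suc t \<Longrightarrow> x \<le> n \<Longrightarrow> valid x (advance x A)"
  unfolding valid_def advance_def
  using sound_insert_all best_sound_insert_all traced_insert_all by (auto simp: optimal_def)

lemma valid_reset: "valid t A \<Longrightarrow> valid t (reset A)"
  unfolding valid_def reset_def using sound_prune traced_prune by auto

text \<open>The potential of a finger is the distance it can still travel in its direction; the finger
  of a class that is still empty may first cross the whole list.\<close>

definition phi :: "nat \<Rightarrow> nat \<Rightarrow> stair \<Rightarrow> nat \<Rightarrow> nat" where
  "phi s g xs h = (if h = 0 then 2 * length xs
     else if (Suc g < k) = (s < k) then rk s xs h else length xs - rk s xs h)"

definition fpos :: "config \<Rightarrow> nat \<Rightarrow> nat \<Rightarrow> nat" where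
  "fpos A s g = (if lastx A g = 0 then 0 else rk s (stairs A s) (lastx A g))"

definition moves :: "nat \<Rightarrow> config \<Rightarrow> nat \<Rightarrow> nat" where
  "moves x A s = gap (fpos A s (cls A x)) (rk s (stairs A s) x)"

definition dels :: "nat \<Rightarrow> config \<Rightarrow> nat \<Rightarrow> nat" where
  "dels x A s = Suc (length (stairs A s)) - length (stairs (advance x A) s)"

definition cuts :: "config \<Rightarrow> nat \<Rightarrow> nat" where
  "cuts A s = length (stairs A s) - length (stairs (reset A) s)"

definition work :: "nat \<Rightarrow> config \<Rightarrow> nat" where
  "work x A = (\<Sum>s<2 * k. moves x A s) + (\<Sum>s<2 * k. dels x A s)
     + (if full (advance x A) then (\<Sum>s<2 * k. cuts (advance x A) s) else 0)"

text \<open>The last summand, for a phase with \<open>e\<close> elements so far, is the reserve that pays for the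
  fingers after the next reset.\<close>

definition pot :: "nat \<Rightarrow> config \<Rightarrow> nat" where
  "pot e A = (\<Sum>s<2 * k. \<Sum>g<2 * k. phi s g (stairs A s) (lastx A g)) +
     (\<Sum>s<2 * k. length (stairs A s)) + 24 * k\<^sup>2 * e"

text \<open>Start \<open>t0\<close> of the phase and best lengths \<open>L0\<close> at that time are
  ghost data. The tail at position \<open>j\<close> in direction \<open>d\<close> witnesses a run of
  length \<open>j + 1\<close> on top of the old best rollercoaster with opposite last run;
  \<open>max 1\<close> stands for a fresh start if there was none.\<close>

definition phase :: "nat \<Rightarrow> nat \<Rightarrow> (bool \<Rightarrow> nat) \<Rightarrow> config \<Rightarrow> bool" where
  "phase t t0 L0 A \<longleftrightarrow> t0 \<le> t \<and> (\<forall>d. L0 d \<le> best A d) \<and>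
     (\<forall>s<2 * k. \<forall>e\<in>set (stairs A s). fst e \<le> t0 \<longrightarrow> snd e \<le> max (L0 True) (L0 False) + k) \<and>
     (\<forall>d j. j < length (tails A d) \<longrightarrow> 1 \<le> tails A d ! j \<and> tails A d ! j \<le> t \<and>
        covers (index d (Suc j)) (stairs A (index d (Suc j))) (key (tails A d ! j)) (max 1 (L0 (\<not> d)) + j)) \<and>
     (\<forall>d. length (tails A d) \<le> t - t0 \<and> length (tails A d) \<le> k)"

text \<open>Without its unfinished last run, a partial rollercoaster is a complete one up to the
  turning element, or just a single element; hence it exceeds the best lengths by at most the
  current run. In the second part, one anchor \<open>v\<close> exhibits the best length both as a
  full run and as the start of the next one.\<close>

definition bounded :: "config \<Rightarrow> bool" where
  "bounded A \<longleftrightarrow>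
     (\<forall>d j. 1 \<le> j \<and> j \<le> k \<longrightarrow> (\<forall>e\<in>set (stairs A (index d j)).
        snd e \<le> (if j = k then best A d else max 1 (max (best A True) (best A False)) + (j - 1)))) \<and>
     (\<forall>d. best A d = 0 \<or> (\<exists>v. covers (index d k) (stairs A (index d k)) v (best A d) \<and>
        covers (index (\<not> d) 1) (stairs A (index (\<not> d) 1)) v (best A d)))"

text \<open>For rising classes only an inequality is recorded: the tails of decreasing piles are
  also replaced by elements of other classes, which moves them up, away from
  \<open>lastx\<close>.\<close>

definition classes :: "nat \<Rightarrow> config \<Rightarrow> bool" where
  "classes t A \<longleftrightarrow>
     (\<forall>g. lastx A g \<le> t) \<and>
     (\<forall>g. Suc g < k \<longrightarrow> lastx A g = (if g < length (tails A True) then tails A True ! g else 0)) \<and>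
     (\<forall>g. lastx A (k - 1 + g) \<noteq> 0 \<longrightarrow> g < length (tails A False) \<and> Suc g \<le> k \<and>
        \<not> dlt True (key (tails A False ! g)) (key (lastx A (k - 1 + g)))) \<and>
     (lastx A (2 * k - 2) \<noteq> 0 \<longrightarrow> full A)"

section \<open>Finger potentials under insertion and movement\<close>

lemma index_cases:
  assumes "s < 2 * k"
  obtains d j where "1 \<le> j" "j \<le> k" "s = index d j"
proof (cases "s < k")
  case True
  then show ?thesis by (intro that[of "Suc s" True]) (auto simp: index_def)
next
  case False
  then show ?thesis using assms by (intro that[of "Suc (s - k)" False]) (auto simp: index_def)
qed

text \<open>Written as a count, a rank and its complement change under insertion by the same
  argument about \<open>filter\<close>, which serves fingers travelling either way.\<close>

lemma rk_filter:
  assumes "stair s t xs"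
  shows "rk s xs x = length (filter (\<lambda>e. lt s (fst e) x) xs)"
proof -
  let ?p = "\<lambda>e. lt s (fst e) x"
  have "\<not> ?p e" if e: "e \<in> set (drop (rk s xs x) xs)" for e
  proof -
    obtain j where "j < length xs - rk s xs x" "e = xs ! (rk s xs x + j)"
      using e rk_le[of s xs x] by (auto simp: in_set_conv_nth)
    then show ?thesis using lt_nth_rk[OF assms, of "rk s xs x + j" x] by simp
  qed
  then have "filter ?p (drop (rk s xs x) xs) = []" by (simp add: filter_empty_conv)
  moreover have "filter ?p (take (rk s xs x) xs) = take (rk s xs x) xs"
    unfolding rk_def takeWhile_eq_take[symmetric] by (auto simp: filter_id_conv dest: set_takeWhileD)
  ultimately have "filter ?p xs = take (rk s xs x) xs"
    by (metis append_Nil2 append_take_drop_id filter_append)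
  then show ?thesis using rk_le[of s xs x] by simp
qed

lemma length_filter_dropWhile: "length (filter p (dropWhile q xs)) \<le> length (filter p xs)"
  by (induction xs) auto

lemma length_filter_ins: "length (filter p (ins s xs x w)) \<le> Suc (length (filter p xs))"
proof -
  have "length (filter p xs) =
      length (filter p (take (rk s xs x) xs)) + length (filter p (drop (rk s xs x) xs))"
    by (metis append_take_drop_id filter_append length_append)
  then show ?thesis
    using length_filter_dropWhile[of p "\<lambda>e. snd e \<le> w" "drop (rk s xs x) xs"]
    by (auto simp: ins_def Let_def)
qed

lemma length_ins: "length (ins s xs x w) \<le> Suc (length xs)"
  using length_filter_ins[of "\<lambda>_. True" s xs x w] by simp

text \<open>An insertion adds at most one entry ahead of a finger. The 2 is due to classes that are
  still empty, whose potential is twice the length.\<close>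

lemma phi_ins:
  assumes "stair s t xs" "stair s x (ins s xs x w)"
  shows "phi s g (ins s xs x w) h \<le> phi s g xs h + 2"
proof -
  have c: "length ys - length (filter p ys) = length (filter (\<lambda>e. \<not> p e) ys)" for p and ys :: stair
    using sum_length_filter_compl[of p ys] by simp
  show ?thesis
    using length_ins[of s xs x w] length_filter_ins[of "\<lambda>e. lt s (fst e) h" s xs x w]
      length_filter_ins[of "\<lambda>e. \<not> lt s (fst e) h" s xs x w]
    by (auto simp: phi_def rk_filter[OF assms(1)] rk_filter[OF assms(2)] c)
qed

lemma rk_mono:
  assumes "lt s x h"
  shows "rk s xs x \<le> rk s xs h"
  unfolding rk_def by (induction xs) (use assms lt_trans in auto)

lemma phi_move:
  assumes "h \<noteq> 0 \<Longrightarrow> if (Suc g < k) = (s < k) then lt s x h else lt s h x" "x \<noteq> 0"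
  shows "gap (if h = 0 then 0 else rk s xs h) (rk s xs x) + phi s g xs x \<le> phi s g xs h"
proof (cases "h = 0")
  case True
  then show ?thesis using assms(2) rk_le[of s xs x] by (auto simp: gap_def phi_def)
next
  case False
  then show ?thesis
    using assms rk_le[of s xs x] rk_le[of s xs h] rk_mono[of s x h xs] rk_mono[of s h x xs]
    by (auto simp: gap_def phi_def split: if_splits)
qed

section \<open>Patience labels and monotone classes\<close>

lemma takeWhile_label: "label d T x \<le> length T" "label d T x < k"
  using k3 length_takeWhile_le[of "\<lambda>y. dlt d (key y) (key x)" "take (k - 1) T"]
  by (auto simp: label_def)

lemma label_stop:
  assumes "label d T x < length T" "Suc (label d T x) < k"
  shows "\<not> dlt d (key (T ! label d T x)) (key x)"
  using nth_length_takeWhile[of "\<lambda>y. dlt d (key y) (key x)" "take (k - 1) T"] assms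
  by (auto simp: label_def)

lemma label_prev:
  assumes "label d T x = Suc u"
  shows "u < length T" "dlt d (key (T ! u)) (key x)"
proof -
  show "u < length T" using takeWhile_label(1)[of d T x] assms by simp
  have "u < length (takeWhile (\<lambda>y. dlt d (key y) (key x)) (take (k - 1) T))"
    using assms by (simp add: label_def)
  then have "dlt d (key (take (k - 1) T ! u)) (key x)" "u < k - 1"
    using length_takeWhile_le[of "\<lambda>y. dlt d (key y) (key x)" "take (k - 1) T"]
    by (metis nth_mem set_takeWhileD takeWhile_nth) (use assms takeWhile_label(2)[of d T x] in simp)
  then show "dlt d (key (T ! u)) (key x)" by simp
qed

lemma nth_put:
  assumes "u \<le> length T" "j < length (put u x T)"
  shows "put u x T ! j = (if j = u then x else T ! j) \<and> (j \<noteq> u \<longrightarrow> j < length T)"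
  using assms by (auto simp: put_def nth_append split: if_splits)

lemma length_put: "u \<le> length T \<Longrightarrow> length (put u x T) = max (length T) (Suc u)"
  by (auto simp: put_def)

lemma cls_less: "cls A x < 2 * k"
  using takeWhile_label(2)[of True "tails A True" x] takeWhile_label(2)[of False "tails A False" x]
  by (auto simp: cls_def Let_def)

text \<open>Patience sorting puts \<open>x\<close> on the first tail that it does not extend, so
  \<open>x\<close> lies on a known side of the tail and of the last element of its class. The merged
  last pile gives no such guarantee, but a nonempty class \<open>2 * k - 2\<close> contradicts
  \<open>\<not> full A\<close>.\<close>

lemma classes_monotone:
  assumes "classes t A" "\<not> full A" "x = Suc t" "x \<le> n" "s < 2 * k" "lastx A (cls A x) \<noteq> 0"
    "\<forall>d. length (tails A d) \<le> k"
  shows "if (Suc (cls A x) < k) = (s < k) then lt s x (lastx A (cls A x)) else lt s (lastx A (cls A x)) x"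
proof -
  let ?u = "label True (tails A True) x" and ?v = "label False (tails A False) x"
  let ?h = "lastx A (cls A x)"
  have h: "1 \<le> ?h" "?h \<le> t" using assms(1,6) by (auto simp: classes_def)
  have neq: "key ?h \<noteq> key x" using key_eq_iff[of ?h x] h assms(3,4) by auto
  show ?thesis
  proof (cases "Suc ?u < k")
    case True
    then have c: "cls A x = ?u" by (simp add: cls_def)
    with assms(1,6) True have "?u < length (tails A True)" "?h = tails A True ! ?u"
      by (auto simp: classes_def split: if_splits)
    then have "key x < key ?h" using label_stop[of True "tails A True" x] True neq by (auto simp: dlt_def)
    then show ?thesis using c True by (auto simp: lt_def dlt_def)
  next
    case False
    then have c: "cls A x = k - 1 + ?v" by (simp add: cls_def)
    with assms(1,6) have H: "?v < length (tails A False)"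
      "\<not> dlt True (key (tails A False ! ?v)) (key ?h)"
      by (auto simp: classes_def)
    have "Suc ?v < k"
    proof (rule ccontr)
      assume "\<not> Suc ?v < k"
      then have "?v = k - 1" using takeWhile_label(2)[of False "tails A False" x] by simp
      then have "cls A x = 2 * k - 2" using c by simp
      then show False using assms(1,2,6) by (simp add: classes_def)
    qed
    then have "key ?h < key x" using label_stop[of False "tails A False" x] H neq by (auto simp: dlt_def)
    moreover have "\<not> Suc (cls A x) < k" using c by simp
    ultimately show ?thesis by (auto simp: lt_def dlt_def)
  qed
qed

lemma classes_advance:
  assumes "classes t A" "x = Suc t" "\<forall>d. length (tails A d) \<le> k"
    "\<not> full A" "\<forall>d j. j < length (tails A d) \<longrightarrow> 1 \<le> tails A d ! j \<and> tails A d ! j \<le> t" "x \<le> n"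
  shows "classes x (advance x A)"
proof -
  let ?u = "label True (tails A True) x" and ?v = "label False (tails A False) x"
  let ?U = "tails A True" and ?V = "tails A False"
  have u: "?u \<le> length ?U" "?u < k" and v: "?v \<le> length ?V" "?v < k"
    using takeWhile_label by auto
  show ?thesis
    unfolding classes_def
  proof (intro conjI allI impI)
    fix g
    show "lastx (advance x A) g \<le> x"
      using assms(1,2) by (auto simp: advance_def classes_def le_SucI)
  next
    fix g assume g: "Suc g < k"
    show "lastx (advance x A) g = (if g < length (tails (advance x A) True) then tails (advance x A) True ! g else 0)"
      using g assms(1) nth_put[OF u(1), of g x] length_put[OF u(1), of x] u(1)
      by (auto simp: advance_def classes_def cls_def Let_def)
  next
    fix g assume g: "lastx (advance x A) (k - 1 + g) \<noteq> 0"
    let ?T = "put ?v x ?V"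
    have "g < length ?T \<and> Suc g \<le> k \<and> \<not> dlt True (key (?T ! g)) (key (lastx (advance x A) (k - 1 + g)))"
    proof (cases "k - 1 + g = cls A x")
      case True
      then have "g = ?v" using k3 by (auto simp: cls_def Let_def split: if_splits)
      then show ?thesis using True v nth_put[OF v(1), of g x] length_put[OF v(1), of x]
        by (auto simp: advance_def dlt_def)
    next
      case False
      then have l: "lastx (advance x A) (k - 1 + g) = lastx A (k - 1 + g)" by (simp add: advance_def)
      let ?h = "lastx A (k - 1 + g)"
      have H: "g < length ?V" "Suc g \<le> k" "\<not> dlt True (key (?V ! g)) (key ?h)" "?h \<noteq> 0" "?h \<le> t"
        using g l assms(1) by (auto simp: classes_def)
      have "g < length ?T" using H(1) length_put[OF v(1), of x] by simp
      \<comment> \<open>Even if \<open>x\<close> joins another class, it may replace the tail of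
        decreasing pile \<open>g\<close>. The tail can only move up, so it stays on the same side of
        \<open>?h\<close>.\<close>
      moreover have "\<not> dlt True (key (?T ! g)) (key ?h)"
      proof (cases "g = ?v")
        case True
        have "Suc g < k"
        proof (rule ccontr)
          assume "\<not> Suc g < k"
          then have "k - 1 + g = 2 * k - 2" using H(2) by simp
          then show False using H(4) assms(1,4) by (simp add: classes_def)
        qed
        then have "\<not> dlt False (key (?V ! g)) (key x)"
          using label_stop[of False ?V x] True H(1) by simp
        then show ?thesis using H(3) True nth_put[OF v(1), of g x] \<open>g < length ?T\<close> by (auto simp: dlt_def)
      next
        case False
        then show ?thesis using H nth_put[OF v(1), of g x] \<open>g < length ?T\<close> by simp
      qed
      ultimately show ?thesis using H l by simp
    qed
    then show "g < length (tails (advance x A) False)" "Suc g \<le> k"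
      "\<not> dlt True (key (tails (advance x A) False ! g)) (key (lastx (advance x A) (k - 1 + g)))"
      by (auto simp: advance_def)
  next
    assume L: "lastx (advance x A) (2 * k - 2) \<noteq> 0"
    have "2 * k - 2 = cls A x"
      using L assms(1,4) by (auto simp: advance_def classes_def split: if_splits)
    then have "\<not> Suc ?u < k" "?v = k - 1" using u v k3 by (auto simp: cls_def Let_def split: if_splits)
    then show "full (advance x A)"
      using length_put[OF u(1), of x] length_put[OF v(1), of x] by (auto simp: full_def advance_def)
  qed
qed

section \<open>Amortized work\<close>

lemma advance_simps [simp]:
  "stairs (advance x A) = insert_all (stairs A) x" "best (advance x A) = new_best (stairs A) x (best A)"
  "tails (advance x A) d = put (label d (tails A d) x) x (tails A d)"
  "lastx (advance x A) = (lastx A)(cls A x := x)"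
  by (simp_all add: advance_def)

lemma reset_simps [simp]:
  "stairs (reset A) s = prune (min (best A True) (best A False)) (stairs A s)" "best (reset A) = best A"
  "tails (reset A) d = []" "lastx (reset A) g = 0"
  by (simp_all add: reset_def)

lemma best_le_new_best: "L d \<le> new_best X x L d"
  by (simp add: new_best_def)

lemma bounded_len:
  assumes "bounded A" "1 \<le> j" "j \<le> k" "e \<in> set (stairs A (index d j))"
  shows "snd e \<le> (if j = k then best A d else max 1 (max (best A True) (best A False)) + (j - 1))"
  using assms(1)[unfolded bounded_def, THEN conjunct1, rule_format, of j e d] assms(2-4) by simp

lemma bounded_anchor:
  assumes "bounded A" "best A d \<noteq> 0"
  obtains v where "covers (index d k) (stairs A (index d k)) v (best A d)"
    "covers (index (\<not> d) 1) (stairs A (index (\<not> d) 1)) v (best A d)"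
  using assms(1)[unfolded bounded_def, THEN conjunct2, rule_format, of d] assms(2) by metis

lemma phaseD:
  assumes "phase t t0 L0 A"
  shows "t0 \<le> t" "L0 d \<le> best A d"
    "s < 2 * k \<Longrightarrow> e \<in> set (stairs A s) \<Longrightarrow> fst e \<le> t0 \<Longrightarrow> snd e \<le> max (L0 True) (L0 False) + k"
    "j < length (tails A d) \<Longrightarrow> 1 \<le> tails A d ! j"
    "j < length (tails A d) \<Longrightarrow> tails A d ! j \<le> t"
    "j < length (tails A d) \<Longrightarrow>
      covers (index d (Suc j)) (stairs A (index d (Suc j))) (key (tails A d ! j)) (max 1 (L0 (\<not> d)) + j)"
    "length (tails A d) \<le> t - t0" "length (tails A d) \<le> k"
  using assms unfolding phase_def by simp_all

text \<open>A run of length \<open>j\<close> strictly between 1 and \<open>k\<close> comes from the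
  state of length \<open>j - 1\<close>, whose bound is one smaller, while the best lengths never
  decrease; the other states are bounded by a full length, which enters the best lengths at
  once.\<close>

lemma new_len_bound:
  assumes "sound t (stairs A)" "bounded A" "1 \<le> j" "j \<le> k"
  shows "new_len (stairs A) (index d j) x \<le>
    (if j = k then best (advance x A) d
     else max 1 (max (best (advance x A) True) (best (advance x A) False)) + (j - 1))"
proof -
  let ?X = "stairs A"
  have F: "full_len ?X (index e 1) x \<le> best (advance x A) e" for e
    by (simp add: new_best_def)
  have G: "best (advance x A) e \<le> max (best (advance x A) True) (best (advance x A) False)" for e
    by (cases e) auto
  consider "j = 1" | "j = k" "j \<noteq> 1" | "j \<noteq> 1" "j \<noteq> k" by blast
  then show ?thesis
  proof cases
    case 1
    then show ?thesis using new_len_index[OF assms(3,4)] F[of "\<not> d"] G[of "\<not> d"] k3 by auto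
  next
    case 2
    then show ?thesis using new_len_index[OF assms(3,4)] F[of d] by simp
  next
    case 3
    then have j: "1 \<le> j - 1" "j - 1 \<le> k" "j - 1 \<noteq> k" using assms by auto
    let ?s = "index d (j - 1)"
    have st: "stair ?s t (?X ?s)" using assms(1) index_less[OF j(1,2)] by (simp add: sound_def)
    have "pred_len ?X ?s x \<le> max 1 (max (best A True) (best A False)) + (j - 1 - 1)"
    proof (rule entry_rk[OF st, of x])
      assume "entry (?X ?s) (rk ?s (?X ?s) x) \<in> set (?X ?s)"
      then show ?thesis using bounded_len[OF assms(2) j(1,2)] j(3) unfolding pred_len_def by fastforce
    qed (simp add: pred_len_def)
    then have "succ0 (pred_len ?X ?s x) \<le> max 1 (max (best A True) (best A False)) + (j - 1)"
      using j(1) unfolding succ0_def by (cases "j - 1") auto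
    also have "\<dots> \<le> max 1 (max (best (advance x A) True) (best (advance x A) False)) + (j - 1)"
      using best_le_new_best[of "best A" True ?X x] best_le_new_best[of "best A" False ?X x] by auto
    finally show ?thesis using new_len_index[OF assms(3,4)] 3 by simp
  qed
qed

lemma bounded_advance:
  assumes "sound t (stairs A)" "bounded A" "x = Suc t" "x \<le> n"
  shows "bounded (advance x A)"
  unfolding bounded_def
proof (intro conjI allI impI ballI)
  fix d j e assume j: "1 \<le> j \<and> j \<le> k" and e: "e \<in> set (stairs (advance x A) (index d j))"
  from e have "e \<in> set (stairs A (index d j)) \<or> e = (x, new_len (stairs A) (index d j) x)"
    by (auto simp: insert_all_def dest: set_ins)
  then show "snd e \<le> (if j = k then best (advance x A) d
     else max 1 (max (best (advance x A) True) (best (advance x A) False)) + (j - 1))"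
  proof
    assume "e \<in> set (stairs A (index d j))"
    then have "snd e \<le> (if j = k then best A d else max 1 (max (best A True) (best A False)) + (j - 1))"
      using bounded_len[OF assms(2)] j by blast
    then show ?thesis
      using best_le_new_best[of "best A" True "stairs A" x] best_le_new_best[of "best A" False "stairs A" x]
        best_le_new_best[of "best A" d "stairs A" x]
      by (auto split: if_splits)
  qed (use new_len_bound[OF assms(1,2)] j in auto)
next
  fix d
  let ?X = "stairs A" and ?B = "advance x A"
  have ix: "index d k < 2 * k" "index (\<not> d) 1 < 2 * k" using index_less k3 by auto
  show "best ?B d = 0 \<or> (\<exists>v. covers (index d k) (stairs ?B (index d k)) v (best ?B d) \<and>
        covers (index (\<not> d) 1) (stairs ?B (index (\<not> d) 1)) v (best ?B d))"
  proof (cases "best A d < full_len ?X (index d 1) x")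
    case True
    then have "best ?B d = full_len ?X (index d 1) x" by (simp add: new_best_def)
    then show ?thesis using covers_full(1,2)[OF assms(1), of "best ?B d" d x] True by auto
  next
    case False
    then have b: "best ?B d = best A d" by (simp add: new_best_def)
    show ?thesis
    proof (cases "best A d = 0")
      case False
      then obtain v where "covers (index d k) (?X (index d k)) v (best A d)"
        "covers (index (\<not> d) 1) (?X (index (\<not> d) 1)) v (best A d)"
        by (rule bounded_anchor[OF assms(2)])
      then show ?thesis unfolding b unfolding advance_simps(1) using covers_insert_all[OF assms(1,3,4)] ix by blast
    qed (use b in simp)
  qed
qed

lemma bounded_reset:
  assumes "bounded A"
  shows "bounded (reset A)"
  unfolding bounded_def
proof (intro conjI allI impI ballI)
  fix d j e
  assume "1 \<le> j \<and> j \<le> k" "e \<in> set (stairs (reset A) (index d j))"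
  moreover from this(2) have "e \<in> set (stairs A (index d j))" using prune_subset by auto
  ultimately show "snd e \<le> (if j = k then best (reset A) d
    else max 1 (max (best (reset A) True) (best (reset A) False)) + (j - 1))"
    using bounded_len[OF assms, of j e d] unfolding reset_simps by blast
next
  fix d
  have m: "min (best A True) (best A False) < best A d + k" using k3 by (cases d) auto
  show "best (reset A) d = 0 \<or> (\<exists>v. covers (index d k) (stairs (reset A) (index d k)) v (best (reset A) d) \<and>
        covers (index (\<not> d) 1) (stairs (reset A) (index (\<not> d) 1)) v (best (reset A) d))"
  proof (cases "best A d = 0")
    case False
    then obtain v where "covers (index d k) (stairs A (index d k)) v (best A d)"
      "covers (index (\<not> d) 1) (stairs A (index (\<not> d) 1)) v (best A d)"
      by (rule bounded_anchor[OF assms])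
    then show ?thesis unfolding reset_simps using covers_prune[OF _ m] by blast
  qed simp
qed

lemma phase_advance:
  assumes "phase t t0 L0 A" "sound t (stairs A)" "bounded A" "x = Suc t" "x \<le> n"
  shows "phase x t0 L0 (advance x A)"
proof -
  let ?X = "stairs A"
  let ?T = "tails A" and ?u = "\<lambda>d. label d (tails A d) x"
  have u: "?u d \<le> length (?T d)" "?u d < k" for d using takeWhile_label by auto
  have tl: "1 \<le> ?T d ! j \<and> ?T d ! j \<le> t" "covers (index d (Suc j)) (?X (index d (Suc j))) (key (?T d ! j)) (max 1 (L0 (\<not> d)) + j)"
    "Suc j \<le> k" if "j < length (?T d)" for d j
    using phaseD(4,5,6)[OF assms(1) that] less_le_trans[OF that phaseD(8)[OF assms(1)]] by auto
  have new: "covers (index d (Suc (?u d))) (insert_all ?X x (index d (Suc (?u d)))) (key x) (max 1 (L0 (\<not> d)) + ?u d)" for d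
  proof (cases "?u d")
    case 0
    have ix: "index d 1 < 2 * k" "(index d 1 < k) = d" using index_less index_dir k3 by auto
    have one: "covers (index d 1) (insert_all ?X x (index d 1)) (key x) 1"
      by (rule covers_insert_all_self[OF assms(2) ix(1)]) (use new_len_index[of 1] k3 in auto)
    have "covers (index d 1) (insert_all ?X x (index d 1)) (key x) (max 1 (L0 (\<not> d)))"
    proof (cases "L0 (\<not> d) = 0")
      case False
      let ?M = "best A (\<not> d)"
      have M: "L0 (\<not> d) \<le> ?M" by (rule phaseD(2)[OF assms(1)])
      with False have "?M \<noteq> 0" by simp
      then obtain v where v: "covers (index (\<not> d) k) (?X (index (\<not> d) k)) v ?M"
        "covers (index d 1) (?X (index d 1)) v ?M"
        using bounded_anchor[OF assms(3), of "\<not> d"] by auto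
      \<comment> \<open>If \<open>x\<close> prolongs the last run at the anchor \<open>v\<close>,
        the longer full run is credited to the length-1 state at \<open>x\<close>; otherwise
        \<open>v\<close> lies on the proper side of \<open>x\<close> or equals it, and its own
        credit carries over.\<close>
      have "covers (index d 1) (insert_all ?X x (index d 1)) (key x) ?M"
      proof (cases "dlt (\<not> d) v (key x)")
        case True
        have "Suc ?M \<le> full_len ?X (index (\<not> d) 1) x"
          using covers_step(2)[OF assms(2), of k "\<not> d" v ?M x] v(1) True M False k3 by simp
        then have "covers (index d 1) (insert_all ?X x (index d 1)) (key x) (Suc ?M)"
          using covers_full(1)[OF assms(2), of "Suc ?M" "\<not> d" x] by simp
        then show ?thesis by (rule covers_mono) auto
      next
        case F: False
        have "covers (index d 1) (insert_all ?X x (index d 1)) v ?M"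
          by (rule covers_insert_all[OF assms(2,4,5) ix(1) v(2)])
        moreover have "v = key x \<or> dlt (index d 1 < k) v (key x)"
          unfolding ix(2) using F by (auto simp: dlt_def split: if_splits)
        ultimately show ?thesis by (rule covers_mono[OF _ order_refl])
      qed
      then show ?thesis by (rule covers_mono) (use M False in auto)
    qed (use one in simp)
    then show ?thesis using 0 by simp
  next
    case (Suc u')
    note p = label_prev[OF Suc]
    have m: "min (Suc u') k = Suc u'" "min (Suc (Suc u')) k = Suc (Suc u')" using u(2)[of d] Suc by auto
    have "Suc (max 1 (L0 (\<not> d)) + u') \<le> new_len ?X (index d (min (Suc (Suc u')) k)) x"
      by (rule covers_step(1)[OF assms(2)]) (use tl(2)[OF p(1)] p(2) m in auto)
    then show ?thesis
      unfolding Suc m using u(2)[of d] Suc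
      by (intro covers_insert_all_self[OF assms(2)] index_less) auto
  qed
  show ?thesis
    unfolding phase_def
  proof (intro conjI allI impI ballI)
    show "t0 \<le> x" using assms(1,4) by (simp add: phase_def)
    fix d
    show "L0 d \<le> best (advance x A) d"
      using le_trans[OF phaseD(2)[OF assms(1)] best_le_new_best] by simp
    have "length (?T d) \<le> t - t0" "length (?T d) \<le> k" "t0 \<le> t" using phaseD[OF assms(1)] by auto
    then show "length (tails (advance x A) d) \<le> x - t0" "length (tails (advance x A) d) \<le> k"
      using u[of d] assms(4) by (auto simp: length_put)
  next
    fix s e assume "s < 2 * k" "e \<in> set (stairs (advance x A) s)" "fst e \<le> t0"
    moreover have "t0 < x" using assms(1,4) by (simp add: phase_def)
    ultimately show "snd e \<le> max (L0 True) (L0 False) + k"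
      using phaseD(3)[OF assms(1)] set_ins[of e s "?X s" x] by (force simp: insert_all_def)
  next
    fix d j assume j: "j < length (tails (advance x A) d)"
    then have j': "j < length (put (?u d) x (?T d))" by simp
    note np = nth_put[OF u(1) j']
    show "1 \<le> tails (advance x A) d ! j" "tails (advance x A) d ! j \<le> x"
      using np tl(1)[of j d] assms(4) by (auto simp: le_SucI)
    show "covers (index d (Suc j)) (stairs (advance x A) (index d (Suc j))) (key (tails (advance x A) d ! j))
      (max 1 (L0 (\<not> d)) + j)"
    proof (cases "j = ?u d")
      case True
      then show ?thesis using new[of d] np by simp
    next
      case False
      then have jl: "j < length (?T d)" and e: "tails (advance x A) d ! j = ?T d ! j" using np by auto
      have "index d (Suc j) < 2 * k" by (rule index_less) (use tl(3)[OF jl] in auto)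
      then show ?thesis unfolding e unfolding advance_simps(1)
        by (rule covers_insert_all[OF assms(2,4,5) _ tl(2)[OF jl]])
    qed
  qed
qed

text \<open>All surviving entries become old at this moment, and \<open>bounded\<close> supplies
  their common upper bound.\<close>

lemma phase_reset: "bounded A \<Longrightarrow> phase t t (best A) (reset A)"
  unfolding phase_def
proof (intro conjI allI impI ballI)
  fix s e assume b: "bounded A" and s: "s < 2 * k" and "e \<in> set (stairs (reset A) s)"
  then have e: "e \<in> set (stairs A s)" using prune_subset by fastforce
  obtain d j where j: "1 \<le> j" "j \<le> k" "s = index d j" using index_cases[OF s] .
  have "snd e \<le> (if j = k then best A d else max 1 (max (best A True) (best A False)) + (j - 1))"
    using bounded_len[OF b j(1,2)] e j(3) by blast
  then show "snd e \<le> max (best A True) (best A False) + k"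
    using j k3 by (cases d) (auto split: if_splits)
qed auto

lemma classes_reset: "classes t (reset A)"
  by (simp add: classes_def)

text \<open>Two counts: entries of the phase have distinct element numbers among
  \<open>x - t0\<close> many, and older entries have distinct lengths in a window of
  \<open>2 * k\<close> many.\<close>

lemma length_pruned:
  assumes "phase x t0 L0 B" "bounded B" "sound x (stairs B)" "full B" "s < 2 * k"
  shows "length (stairs (reset B) s) \<le> 2 * k + (x - t0)" "k \<le> x - t0"
proof -
  let ?m = "min (best B True) (best B False)" and ?M = "max (L0 True) (L0 False)"
  have len: "length (tails B d) = k" for d
    using assms(4) phaseD(8)[OF assms(1), of d] by (cases d) (auto simp: full_def)
  then show kx: "k \<le> x - t0" using phaseD(7)[OF assms(1), of True] by simp
  \<comment> \<open>The last of \<open>k\<close> tails in direction \<open>d\<close> certifies a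
    full run of length at least \<open>L0 (\<not> d) + k - 1\<close> if \<open>L0 (\<not> d)\<close>
    is positive. With the monotonicity of \<open>best\<close>, each new best length then exceeds or
    equals both old ones.\<close>
  have "L0 (\<not> d) \<le> best B d" for d
  proof -
    have "k - 1 < length (tails B d)" using len k3 by simp
    then have "covers (index d (Suc (k - 1))) (stairs B (index d (Suc (k - 1)))) (key (tails B d ! (k - 1)))
        (max 1 (L0 (\<not> d)) + (k - 1))"
      by (rule phaseD(6)[OF assms(1)])
    moreover have "Suc (k - 1) = k" using k3 by simp
    ultimately obtain e where "e \<in> set (stairs B (index d k))" "max 1 (L0 (\<not> d)) + (k - 1) \<le> snd e"
      by (auto simp: covers_def)
    moreover from this(1) have "snd e \<le> best B d" using bounded_len[OF assms(2), of k e d] k3 by simp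
    ultimately show ?thesis by simp
  qed
  from this[of True] this[of False] have Mm: "?M \<le> ?m"
    using phaseD(2)[OF assms(1), of True] phaseD(2)[OF assms(1), of False] by simp
  define ys where "ys = stairs (reset B) s"
  have st: "stair s x ys" unfolding ys_def using assms(3,5) stair_prune by (simp add: sound_def)
  then have srt: "sorted_wrt (\<lambda>a b. lt s (fst a) (fst b) \<and> snd a < snd b) ys" by (simp add: stair_def)
  have low: "?m < snd e + k" if "e \<in> set ys" for e
  proof -
    have "ys \<noteq> []" using that by auto
    then have "\<not> snd (hd ys) + k \<le> ?m"
      unfolding ys_def reset_simps prune_def by (rule hd_dropWhile)
    then show ?thesis using sorted_wrt_hd[OF srt that] by auto
  qed
  let ?p = "\<lambda>e. fst e \<le> t0"
  have d1: "distinct (map snd ys)" and d2: "distinct (map fst ys)"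
  proof -
    have neq: "snd (ys ! i) \<noteq> snd (ys ! j) \<and> fst (ys ! i) \<noteq> fst (ys ! j)" if "i < j" "j < length ys" for i j
    proof -
      have "lt s (fst (ys ! i)) (fst (ys ! j)) \<and> snd (ys ! i) < snd (ys ! j)"
        using sorted_wrt_nth_less[OF srt that] .
      then show ?thesis by auto
    qed
    show "distinct (map snd ys)" "distinct (map fst ys)"
      unfolding distinct_conv_nth using neq by (metis length_map linorder_neqE_nat nth_map)+
  qed
  have "length (filter ?p ys) = card (snd ` set (filter ?p ys))"
    using distinct_card[of "map snd (filter ?p ys)"] d1 by (simp add: distinct_map_filter)
  also have "\<dots> \<le> card {Suc ?M - k..?M + k}"
  proof (rule card_mono)
    show "snd ` set (filter ?p ys) \<subseteq> {Suc ?M - k..?M + k}"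
    proof (rule image_subsetI)
      fix e assume e: "e \<in> set (filter ?p ys)"
      then have "e \<in> set (stairs B s)" using prune_subset by (fastforce simp: ys_def)
      then have "snd e \<le> ?M + k" using phaseD(3)[OF assms(1,5)] e by simp
      moreover have "?m < snd e + k" using low[of e] e by simp
      ultimately show "snd e \<in> {Suc ?M - k..?M + k}" using Mm by auto
    qed
  qed simp
  also have "\<dots> \<le> 2 * k" unfolding card_atLeastAtMost by linarith
  finally have 1: "length (filter ?p ys) \<le> 2 * k" .
  have "length (filter (\<lambda>e. \<not> ?p e) ys) = card (fst ` set (filter (\<lambda>e. \<not> ?p e) ys))"
    using distinct_card[of "map fst (filter (\<lambda>e. \<not> ?p e) ys)"] d2 by (simp add: distinct_map_filter)
  also have "\<dots> \<le> card {Suc t0..x}"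
    by (rule card_mono) (use st in \<open>auto simp: stair_def\<close>)
  finally have "length (filter (\<lambda>e. \<not> ?p e) ys) \<le> x - t0" by simp
  then show "length (stairs (reset B) s) \<le> 2 * k + (x - t0)"
    using 1 sum_length_filter_compl[of ?p ys] unfolding ys_def by simp
qed

section \<open>The amortized bound per element\<close>

definition inv :: "nat \<Rightarrow> nat \<Rightarrow> (bool \<Rightarrow> nat) \<Rightarrow> config \<Rightarrow> bool" where
  "inv t t0 L0 A \<longleftrightarrow> valid t A \<and> bounded A \<and> phase t t0 L0 A \<and> classes t A \<and> \<not> full A"

text \<open>The increase per element consists of \<open>24 * k\<^sup>2\<close> for the reserve,
  \<open>8 * k\<^sup>2\<close> because each of \<open>4 * k\<^sup>2\<close> finger potentials may
  grow by 2, and \<open>2 * k\<close> for new entries; 40 is a round upper bound.\<close>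

lemma pot_advance:
  assumes "inv t t0 L0 A" "x = Suc t" "x \<le> n"
  shows "(\<Sum>s<2 * k. moves x A s) + (\<Sum>s<2 * k. dels x A s) + pot (Suc e) (advance x A)
    \<le> pot e A + 40 * k\<^sup>2"
proof -
  let ?B = "advance x A" and ?c = "cls A x"
  have snd: "sound t (stairs A)" "sound x (stairs ?B)"
    using assms valid_advance[of t A x] by (auto simp: inv_def valid_def)
  have mv: "moves x A s + (\<Sum>g<2 * k. phi s g (stairs ?B s) (lastx ?B g))
      \<le> (\<Sum>g<2 * k. phi s g (stairs A s) (lastx A g)) + 4 * k" if s: "s < 2 * k" for s
  proof -
    have st: "stair s t (stairs A s)" "stair s x (ins s (stairs A s) x (new_len (stairs A) s x))"
      using snd s by (auto simp: sound_def insert_all_def)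
    have "(if g = ?c then moves x A s else 0) + phi s g (stairs ?B s) (lastx ?B g)
        \<le> phi s g (stairs A s) (lastx A g) + 2" for g
    proof (cases "g = ?c")
      case True
      have "moves x A s + phi s ?c (stairs A s) x \<le> phi s ?c (stairs A s) (lastx A ?c)"
        unfolding moves_def fpos_def
        by (rule phi_move) (use classes_monotone[of t A x s] assms s in \<open>auto simp: inv_def phase_def\<close>)
      then show ?thesis using phi_ins[OF st, of ?c x] True by (simp add: insert_all_def)
    next
      case False
      then show ?thesis using phi_ins[OF st, of g "lastx A g"] by (simp add: insert_all_def)
    qed
    then have "(\<Sum>g<2 * k. (if g = ?c then moves x A s else 0) + phi s g (stairs ?B s) (lastx ?B g))
        \<le> (\<Sum>g<2 * k. phi s g (stairs A s) (lastx A g) + 2)"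
      by (intro sum_mono)
    moreover have "(\<Sum>g<2 * k. if g = ?c then moves x A s else 0) = moves x A s"
      using cls_less[of A x] by simp
    ultimately show ?thesis by (simp only: sum.distrib) simp
  qed
  have "(\<Sum>s<2 * k. moves x A s + (\<Sum>g<2 * k. phi s g (stairs ?B s) (lastx ?B g)))
      \<le> (\<Sum>s<2 * k. (\<Sum>g<2 * k. phi s g (stairs A s) (lastx A g)) + 4 * k)"
    by (intro sum_mono mv) simp
  then have 1: "(\<Sum>s<2 * k. moves x A s) + (\<Sum>s<2 * k. \<Sum>g<2 * k. phi s g (stairs ?B s) (lastx ?B g))
      \<le> (\<Sum>s<2 * k. \<Sum>g<2 * k. phi s g (stairs A s) (lastx A g)) + 8 * k\<^sup>2"
    by (simp add: sum.distrib power2_eq_square)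
  have "(\<Sum>s<2 * k. dels x A s + length (stairs ?B s)) \<le> (\<Sum>s<2 * k. length (stairs A s) + 1)"
    by (intro sum_mono) (simp add: dels_def insert_all_def length_ins)
  then have 2: "(\<Sum>s<2 * k. dels x A s) + (\<Sum>s<2 * k. length (stairs ?B s))
      \<le> (\<Sum>s<2 * k. length (stairs A s)) + 2 * k"
    by (simp only: sum.distrib) simp
  have "2 * k \<le> k\<^sup>2" using k3 by (simp add: power2_eq_square)
  then show ?thesis using 1 2 by (simp add: pot_def)
qed

text \<open>Since \<open>k \<le> x - t0\<close>, a pruned staircase has length at most
  \<open>3 * (x - t0)\<close>. All classes are empty now, so each of the
  \<open>4 * k\<^sup>2\<close> fingers has twice that as potential: this is the origin of the factor
  24 in the reserve, which drops to 0 here.\<close>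

lemma pot_reset:
  assumes "phase x t0 L0 B" "bounded B" "sound x (stairs B)" "full B"
  shows "(\<Sum>s<2 * k. cuts B s) + pot 0 (reset B) \<le> pot (x - t0) B"
proof -
  note lp = length_pruned[OF assms]
  have "0 < 2 * k" using k3 by simp
  then have le: "length (stairs (reset B) s) \<le> 3 * (x - t0)" if "s < 2 * k" for s
    using lp[OF that] by simp
  have "(\<Sum>s<2 * k. \<Sum>g<2 * k. phi s g (stairs (reset B) s) (lastx (reset B) g))
      \<le> (\<Sum>s<2 * k. \<Sum>g<2 * k. 6 * (x - t0))"
    by (intro sum_mono) (use le in \<open>simp add: phi_def\<close>)
  then have 1: "(\<Sum>s<2 * k. \<Sum>g<2 * k. phi s g (stairs (reset B) s) (lastx (reset B) g)) \<le> 24 * k\<^sup>2 * (x - t0)"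
    by (simp add: power2_eq_square)
  have "length (prune m xs) \<le> length xs" for m xs by (simp add: prune_def length_dropWhile_le)
  then have "(\<Sum>s<2 * k. cuts B s + length (stairs (reset B) s)) = (\<Sum>s<2 * k. length (stairs B s))"
    by (intro sum.cong) (auto simp: cuts_def)
  then have 2: "(\<Sum>s<2 * k. cuts B s) + (\<Sum>s<2 * k. length (stairs (reset B) s)) = (\<Sum>s<2 * k. length (stairs B s))"
    by (simp add: sum.distrib)
  show ?thesis using 1 2 unfolding pot_def by linarith
qed

lemma inv_step:
  assumes "inv t t0 L0 A" "x = Suc t" "x \<le> n"
  obtains t0' L0' where "inv x t0' L0' (step x A)"
    "work x A + pot (x - t0') (step x A) \<le> pot (t - t0) A + 40 * k\<^sup>2"
proof -
  let ?B = "advance x A"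
  have snd: "sound t (stairs A)" and ph: "phase t t0 L0 A" and bd: "bounded A"
    using assms(1) by (auto simp: inv_def valid_def)
  have B: "valid x ?B" "bounded ?B" "phase x t0 L0 ?B" "classes x ?B"
    using valid_advance bounded_advance[OF snd bd assms(2,3)] phase_advance[OF ph snd bd assms(2,3)]
      classes_advance[of t A x] assms by (auto simp: inv_def phase_def)
  have e: "x - t0 = Suc (t - t0)" using phaseD(1)[OF ph] assms(2) by simp
  note pa = pot_advance[OF assms, of "t - t0", folded e]
  show ?thesis
  proof (cases "full ?B")
    case True
    have S: "step x A = reset ?B" using True by (simp add: step_def Let_def)
    have "(\<Sum>s<2 * k. cuts ?B s) + pot 0 (reset ?B) \<le> pot (x - t0) ?B"
      using pot_reset B True by (auto simp: valid_def)
    then have "work x A + pot (x - x) (step x A) \<le> pot (t - t0) A + 40 * k\<^sup>2"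
      using pa True unfolding work_def S by simp
    moreover have "inv x x (best ?B) (step x A)"
      unfolding S inv_def
      using valid_reset[OF B(1)] bounded_reset[OF B(2)] phase_reset[OF B(2)] classes_reset k3
      by (auto simp: full_def)
    ultimately show ?thesis using that by blast
  next
    case False
    have S: "step x A = ?B" using False by (simp add: step_def Let_def)
    show ?thesis
      by (rule that[of t0 L0]) (use pa B False in \<open>auto simp: S inv_def work_def\<close>)
  qed
qed

definition start :: config where
  "start = \<lparr>stairs = (\<lambda>_. []), best = (\<lambda>_. 0), tails = (\<lambda>_. []), lastx = (\<lambda>_. 0)\<rparr>"

lemma inv_start: "inv 0 0 (\<lambda>_. 0) start"
  using k3
  by (auto simp: inv_def start_def valid_def sound_def stair_def best_sound_def traced_0 optimal_def
      bounded_def phase_def classes_def full_def)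

lemma pot_start: "pot 0 start = 0"
  by (simp add: pot_def start_def phi_def)

end

section \<open>The program\<close>

text \<open>The postcondition also receives the running time. Execution is deterministic, so the
  existential is a total-correctness precondition, and a stuck or diverging run makes it
  false.\<close>

definition wp :: "nat \<Rightarrow> real list \<Rightarrow> com \<Rightarrow> state \<Rightarrow> (nat \<Rightarrow> state \<Rightarrow> bool) \<Rightarrow> bool" where
  "wp W S c \<sigma> Q \<longleftrightarrow> (\<exists>t \<sigma>'. exec W S c \<sigma> t \<sigma>' \<and> Q t \<sigma>')"

lemma wp_mono: "wp W S c \<sigma> P \<Longrightarrow> (\<And>t \<sigma>'. P t \<sigma>' \<Longrightarrow> Q t \<sigma>') \<Longrightarrow> wp W S c \<sigma> Q"
  unfolding wp_def by blast

lemma wp_Skip: "wp W S Skip \<sigma> Q \<longleftrightarrow> Q 1 \<sigma>"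
proof
  show "wp W S Skip \<sigma> Q \<Longrightarrow> Q 1 \<sigma>" unfolding wp_def by (auto elim: exec.cases)
qed (unfold wp_def, blast intro: exec.Skip)

lemma wp_Assign: "wp W S (Assign x e) \<sigma> Q \<longleftrightarrow>
    afits W e \<sigma> \<and> Q (1 + acost e) (\<sigma>\<lparr>reg := (reg \<sigma>)(x := aval e \<sigma>)\<rparr>)" (is "?L \<longleftrightarrow> ?R")
proof
  show "?L \<Longrightarrow> ?R" unfolding wp_def by (auto elim: exec.cases)
qed (unfold wp_def, blast intro: exec.Assign)

lemma wp_Store: "wp W S (Store a e f) \<sigma> Q \<longleftrightarrow> afits W e \<sigma> \<and> afits W f \<sigma> \<and>
    Q (1 + acost e + acost f) (\<sigma>\<lparr>arr := (arr \<sigma>)(a := (arr \<sigma> a)(aval e \<sigma> := aval f \<sigma>))\<rparr>)"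
  (is "?L \<longleftrightarrow> ?R")
proof
  show "?L \<Longrightarrow> ?R" unfolding wp_def by (auto elim: exec.cases)
qed (unfold wp_def, blast intro: exec.Store)

lemma wp_Seq: "wp W S (Seq c c') \<sigma> Q \<longleftrightarrow>
    wp W S c \<sigma> (\<lambda>t \<sigma>'. wp W S c' \<sigma>' (\<lambda>t' \<sigma>''. Q (1 + t + t') \<sigma>''))" (is "?L \<longleftrightarrow> ?R")
proof
  assume ?L
  then obtain t \<sigma>' where "exec W S (Seq c c') \<sigma> t \<sigma>'" "Q t \<sigma>'" unfolding wp_def by blast
  then show ?R by (cases rule: exec.cases) (unfold wp_def, blast)
next
  assume ?R
  then show ?L unfolding wp_def by (blast intro: exec.Seq)
qed

lemma wp_If: "wp W S (If b c c') \<sigma> Q \<longleftrightarrow> bfits W S b \<sigma> \<and>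
    (if bval S b \<sigma> then wp W S c \<sigma> (\<lambda>t. Q (1 + bcost b + t)) else wp W S c' \<sigma> (\<lambda>t. Q (1 + bcost b + t)))"
  (is "?L \<longleftrightarrow> ?R")
proof
  assume ?L
  then obtain t \<sigma>' where "exec W S (If b c c') \<sigma> t \<sigma>'" "Q t \<sigma>'" unfolding wp_def by blast
  then show ?R by (cases rule: exec.cases) (auto simp: wp_def)
next
  assume R: ?R
  show ?L
  proof (cases "bval S b \<sigma>")
    case True
    then show ?thesis using R unfolding wp_def by simp (blast intro: exec.IfTrue[unfolded One_nat_def plus_nat.add_Suc plus_nat.add_0])
  next
    case False
    then show ?thesis using R unfolding wp_def by simp (blast intro: exec.IfFalse[unfolded One_nat_def plus_nat.add_Suc plus_nat.add_0])
  qed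
qed

lemma afits_aval: "afits W e \<sigma> \<Longrightarrow> aval e \<sigma> < W"
  by (induction e) (auto intro: le_less_trans[OF diff_le_self] le_less_trans[OF div_le_dividend])

lemmas wp_simps = wp_Skip wp_Assign wp_Store wp_Seq wp_If

lemma wp_While:
  assumes "I j \<sigma>" "\<And>j \<sigma>. I j \<sigma> \<Longrightarrow> bfits W S b \<sigma>"
    "\<And>j \<sigma>. I j \<sigma> \<Longrightarrow> bval S b \<sigma> \<Longrightarrow>
      wp W S c \<sigma> (\<lambda>t \<sigma>'. \<exists>j'. I j' \<sigma>' \<and> t + 1 + bcost b + f j' \<le> f j)"
  shows "wp W S (While b c) \<sigma>
    (\<lambda>t \<sigma>'. \<exists>j'. I j' \<sigma>' \<and> \<not> bval S b \<sigma>' \<and> t + f j' \<le> f j + 1 + bcost b)"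
  using assms(1)
proof (induction "f j" arbitrary: j \<sigma> rule: less_induct)
  case less
  show ?case
  proof (cases "bval S b \<sigma>")
    case True
    obtain t \<sigma>1 j1 where 1: "exec W S c \<sigma> t \<sigma>1" "I j1 \<sigma>1" "t + 1 + bcost b + f j1 \<le> f j"
      using assms(3)[OF less.prems True] unfolding wp_def by blast
    have "f j1 < f j" using 1(3) by simp
    from less.hyps[OF this 1(2)] obtain t' \<sigma>' j' where
      2: "exec W S (While b c) \<sigma>1 t' \<sigma>'" "I j' \<sigma>'" "\<not> bval S b \<sigma>'" "t' + f j' \<le> f j1 + 1 + bcost b"
      unfolding wp_def by blast
    have "exec W S (While b c) \<sigma> (1 + bcost b + t + t') \<sigma>'"
      by (rule exec.WhileTrue[OF assms(2)[OF less.prems] True 1(1) 2(1)])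
    moreover have "1 + bcost b + t + t' + f j' \<le> f j + 1 + bcost b" using 1(3) 2(4) by simp
    ultimately show ?thesis unfolding wp_def using 2(2,3) by blast
  next
    case False
    then show ?thesis unfolding wp_def
      using exec.WhileFalse[OF assms(2)[OF less.prems] False] less.prems by fastforce
  qed
qed

section \<open>The text of the program\<close>

abbreviation (input) plus1 :: "aexp \<Rightarrow> aexp" where "plus1 e \<equiv> Plus e (Const 1)"
abbreviation (input) minus1 :: "aexp \<Rightarrow> aexp" where "minus1 e \<equiv> Minus e (Const 1)"
abbreviation (input) row_at :: "aexp \<Rightarrow> aexp" where "row_at e \<equiv> Plus (Times (Reg ''s'') (Reg ''M'')) e"
abbreviation (input) finger_at :: "aexp \<Rightarrow> aexp" where "finger_at e \<equiv> Plus (Times (Reg ''s'') (Reg ''K'')) e"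

definition incr :: "vname \<Rightarrow> com" where "incr x = Assign x (plus1 (Reg x))"

text \<open>A disjunction written by De Morgan: the direction of staircase \<open>s\<close> selects
  the orientation of the input comparison. The decrements turn element numbers into input
  positions.\<close>

definition before_b :: "aexp \<Rightarrow> aexp \<Rightarrow> bexp" where
  "before_b e f = Neg (Conj
     (Neg (Conj (Less (Reg ''s'') (Reg ''k'')) (InLess (minus1 e) (minus1 f))))
     (Neg (Conj (Neg (Less (Reg ''s'') (Reg ''k''))) (InLess (minus1 f) (minus1 e)))))"

text \<open>Registers: \<open>M = n + 1\<close>, \<open>K = 2 * k\<close>, \<open>i\<close> is the current element, \<open>s\<close> a staircase, \<open>c\<close> and \<open>g\<close>
  classes, \<open>x\<close> and \<open>y\<close> the best lengths, \<open>U\<close> and \<open>V\<close> the numbers of tails. Arrays: \<open>n\<close>, \<open>p\<close> and \<open>l\<close>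
  (successor, predecessor and length of the nodes; node 0 closes each list to a cycle), \<open>f\<close>
  (fingers), \<open>w\<close> (new lengths), \<open>t\<close> and \<open>d\<close> (tails), \<open>x\<close> (last element of a class).\<close>

definition for_loop :: "vname \<Rightarrow> com \<Rightarrow> com" where
  "for_loop r c = Seq (Assign r (Const 0)) (While (Less (Reg r) (Reg ''K'')) (Seq c (incr r)))"

text \<open>Truncated subtraction gives maxima and minima without branching.\<close>

definition max_prog :: "vname \<Rightarrow> aexp \<Rightarrow> com" where
  "max_prog a e = Assign a (Plus e (Minus (Reg a) e))"

definition store_pos :: "aexp \<Rightarrow> vname \<Rightarrow> com" where
  "store_pos e a = Store ''w'' e (Plus (Const 1) (Minus (Reg a) (Const 1)))"

definition label_loop :: "bool \<Rightarrow> vname \<Rightarrow> vname \<Rightarrow> vname \<Rightarrow> com" where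
  "label_loop d T U u =
     While (Conj (Less (Reg u) (Reg U)) (Conj (Less (plus1 (Reg u)) (Reg ''k''))
        (if d then InLess (minus1 (Arr T (Reg u))) (minus1 (Reg ''i''))
         else InLess (minus1 (Reg ''i'')) (minus1 (Arr T (Reg u))))))
       (incr u)"

definition label_prog :: "bool \<Rightarrow> vname \<Rightarrow> vname \<Rightarrow> vname \<Rightarrow> com" where
  "label_prog d T U u = Seq (Assign u (Const 0)) (Seq (label_loop d T U u)
     (Seq (Store T (Reg u) (Reg ''i'')) (If (Less (Reg u) (Reg U)) Skip (incr U))))"

definition left_loop :: com where
  "left_loop = While (Conj (Less (Const 0) (Reg ''p'')) (Neg (before_b (Reg ''p'') (Reg ''i''))))
     (Assign ''p'' (Arr ''p'' (row_at (Reg ''p''))))"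

definition right_loop :: com where
  "right_loop = While (Conj (Less (Const 0) (Reg ''q'')) (before_b (Reg ''q'') (Reg ''i'')))
     (Seq (Assign ''p'' (Reg ''q'')) (Assign ''q'' (Arr ''n'' (row_at (Reg ''p'')))))"

text \<open>The result is stored one place after its state, because extending a run leads to the
  next state. Thus \<open>w\<close> already holds the new lengths except at the four boundary
  states, which \<open>lengths_prog\<close> repairs.\<close>

definition search_prog :: com where
  "search_prog = Seq (Assign ''p'' (Arr ''f'' (finger_at (Reg ''c'')))) (Seq left_loop (Seq
     (Assign ''q'' (Arr ''n'' (row_at (Reg ''p'')))) (Seq right_loop (Seq
     (Store ''f'' (finger_at (Reg ''c'')) (Reg ''p'')) (Seq
     (Assign ''q'' (Arr ''l'' (row_at (Reg ''p''))))
     (If (Less (Const 0) (Reg ''q'')) (Store ''w'' (plus1 (Reg ''s'')) (plus1 (Reg ''q'')))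
       (Store ''w'' (plus1 (Reg ''s'')) (Const 0))))))))"

definition lengths_prog :: com where
  "lengths_prog =
     Seq (Assign ''a'' (Arr ''w'' (minus1 (Reg ''k'')))) (Seq
     (max_prog ''a'' (Arr ''w'' (Reg ''k''))) (Seq
     (Assign ''b'' (Arr ''w'' (minus1 (Reg ''K'')))) (Seq
     (max_prog ''b'' (Arr ''w'' (Reg ''K''))) (Seq
     (Store ''w'' (minus1 (Reg ''k'')) (Reg ''a'')) (Seq
     (Store ''w'' (minus1 (Reg ''K'')) (Reg ''b'')) (Seq
     (store_pos (Const 0) ''b'') (Seq
     (store_pos (Reg ''k'') ''a'') (Seq
     (max_prog ''x'' (Reg ''a''))
     (max_prog ''y'' (Reg ''b''))))))))))"

text \<open>A finger is a node, so an insertion matters only to fingers that must now point to the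
  new node: those of class elements behind \<open>x\<close> whose old node is the predecessor of
  \<open>x\<close> or has just been unlinked. In both cases, and in no other, the old length is at
  most \<open>w\<close>; the length of an unlinked node is still readable.\<close>

definition finger_step :: com where
  "finger_step = If (Conj (Less (Const 0) (Arr ''x'' (Reg ''g'')))
       (Conj (before_b (Reg ''i'') (Arr ''x'' (Reg ''g'')))
         (Neg (Less (Reg ''w'') (Arr ''l'' (row_at (Arr ''f'' (finger_at (Reg ''g'')))))))))
     (Store ''f'' (finger_at (Reg ''g'')) (Reg ''i'')) Skip"

definition drop_loop :: com where
  "drop_loop = While (Conj (Less (Const 0) (Reg ''q''))
       (Neg (Less (Reg ''w'') (Arr ''l'' (row_at (Reg ''q''))))))
     (Assign ''q'' (Arr ''n'' (row_at (Reg ''q''))))"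

definition link_prog :: com where
  "link_prog = Seq (Store ''n'' (row_at (Reg ''p'')) (Reg ''i'')) (Seq
     (Store ''p'' (row_at (Reg ''i'')) (Reg ''p'')) (Seq
     (Store ''n'' (row_at (Reg ''i'')) (Reg ''q'')) (Seq
     (Store ''p'' (row_at (Reg ''q'')) (Reg ''i''))
     (Store ''l'' (row_at (Reg ''i'')) (Reg ''w'')))))"

definition insert_prog :: com where
  "insert_prog = Seq (Assign ''p'' (Arr ''f'' (finger_at (Reg ''c'')))) (Seq
     (Assign ''w'' (Arr ''w'' (Reg ''s'')))
     (If (Less (Arr ''l'' (row_at (Reg ''p''))) (Reg ''w''))
       (Seq (Assign ''q'' (Arr ''n'' (row_at (Reg ''p'')))) (Seq drop_loop
         (Seq link_prog (for_loop ''g'' finger_step))))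
       Skip))"

definition prune_loop :: com where
  "prune_loop = While (Conj (Less (Const 0) (Reg ''p''))
       (Neg (Less (Reg ''l'') (Plus (Arr ''l'' (row_at (Reg ''p''))) (Reg ''k'')))))
     (Assign ''p'' (Arr ''n'' (row_at (Reg ''p''))))"

definition prune_prog :: com where
  "prune_prog = Seq (Assign ''p'' (Arr ''n'' (row_at (Const 0)))) (Seq prune_loop (Seq
     (Store ''n'' (row_at (Const 0)) (Reg ''p'')) (Seq
     (Store ''p'' (row_at (Reg ''p'')) (Const 0))
     (for_loop ''g'' (Store ''f'' (finger_at (Reg ''g'')) (Const 0))))))"

text \<open>All searches precede all insertions, since the new length in a state depends on the old
  contents of other staircases. Recording \<open>x\<close> as last of its class before the
  insertions lets the finger repair treat that class like the others: as \<open>x\<close> is not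
  before itself, its finger stays at the predecessor.\<close>

definition advance_prog :: com where
  "advance_prog = Seq (label_prog True ''t'' ''U'' ''u'') (Seq (label_prog False ''d'' ''V'' ''v'') (Seq
     (If (Less (plus1 (Reg ''u'')) (Reg ''k'')) (Assign ''c'' (Reg ''u''))
        (Assign ''c'' (Plus (minus1 (Reg ''k'')) (Reg ''v'')))) (Seq
     (for_loop ''s'' search_prog) (Seq
     (Store ''x'' (Reg ''c'') (Reg ''i'')) (Seq
     lengths_prog
     (for_loop ''s'' insert_prog))))))"

definition reset_prog :: com where
  "reset_prog = Seq (Assign ''l'' (Minus (Reg ''x'') (Minus (Reg ''x'') (Reg ''y'')))) (Seq
     (for_loop ''s'' prune_prog) (Seq
     (for_loop ''g'' (Store ''x'' (Reg ''g'') (Const 0))) (Seq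
     (Assign ''U'' (Const 0)) (Assign ''V'' (Const 0)))))"

definition step_prog :: com where
  "step_prog = Seq advance_prog
     (If (Conj (Neg (Less (Reg ''U'') (Reg ''k''))) (Neg (Less (Reg ''V'') (Reg ''k'')))) reset_prog Skip)"

definition rollercoaster_prog :: com where
  "rollercoaster_prog = Seq (Assign ''M'' (plus1 (Reg ''n''))) (Seq
     (Assign ''K'' (Times (Const 2) (Reg ''k''))) (Seq
     (Assign ''i'' (Const 1)) (Seq
     (While (Less (Reg ''i'') (Reg ''M'')) (Seq step_prog (incr ''i'')))
     (If (Less (Reg ''x'') (Reg ''y'')) (Assign ''out'' (Reg ''y'')) (Assign ''out'' (Reg ''x''))))))"

section \<open>Staircases as linked lists\<close>

definition node :: "stair \<Rightarrow> nat \<Rightarrow> nat" where "node xs j = fst (entry xs j)"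

definition succ_node :: "stair \<Rightarrow> nat \<Rightarrow> nat" where
  "succ_node xs j = (if j < length xs then fst (xs ! j) else 0)"

text \<open>Only nodes of the current staircase and the head are constrained, so unlinked nodes may
  keep stale contents.\<close>

definition linked :: "stair \<Rightarrow> (nat \<Rightarrow> nat) \<Rightarrow> (nat \<Rightarrow> nat) \<Rightarrow> (nat \<Rightarrow> nat) \<Rightarrow> bool" where
  "linked xs nx pv vl \<longleftrightarrow> (\<forall>j\<le>length xs. nx (node xs j) = succ_node xs j \<and>
     pv (succ_node xs j) = node xs j \<and> vl (node xs j) = snd (entry xs j))"

lemma succ_node_Suc: "j < length xs \<Longrightarrow> succ_node xs j = node xs (Suc j)"
  by (simp add: succ_node_def node_def)

lemma node_0 [simp]: "node xs 0 = 0"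
  by (simp add: node_def)

context input
begin

lemma stair_nth:
  assumes "stair s t xs" "j < length xs"
  shows "1 \<le> fst (xs ! j)" "fst (xs ! j) \<le> t" "0 < snd (xs ! j)" "snd (xs ! j) \<le> fst (xs ! j)"
  using assms nth_mem[of j xs] by (auto simp: stair_def)

lemma node_le: "stair s t xs \<Longrightarrow> j \<le> length xs \<Longrightarrow> node xs j \<le> t"
  using stair_nth[of s t xs "j - 1"] by (cases j) (auto simp: node_def)

lemma snd_entry_le: "stair s t xs \<Longrightarrow> j \<le> length xs \<Longrightarrow> snd (entry xs j) \<le> t"
  using stair_nth[of s t xs "j - 1"] by (cases j) auto

lemma succ_node_le: "stair s t xs \<Longrightarrow> succ_node xs j \<le> t"
  using stair_nth[of s t xs j] by (auto simp: succ_node_def)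

lemma succ_node_pos: "stair s t xs \<Longrightarrow> 0 < succ_node xs j \<longleftrightarrow> j < length xs"
  using stair_nth[of s t xs j] by (auto simp: succ_node_def)

lemma node_pos: "stair s t xs \<Longrightarrow> j \<le> length xs \<Longrightarrow> 0 < node xs j \<longleftrightarrow> 0 < j"
  using stair_nth[of s t xs "j - 1"] by (cases j) (auto simp: node_def)

lemma stair_inj:
  assumes "stair s t xs" "i < length xs" "j < length xs" "fst (xs ! i) = fst (xs ! j)"
  shows "i = j"
proof (rule ccontr)
  assume "i \<noteq> j"
  then have "lt s (fst (xs ! i)) (fst (xs ! j)) \<or> lt s (fst (xs ! j)) (fst (xs ! i))"
    using assms(1-3) unfolding stair_def sorted_wrt_iff_nth_less by (meson linorder_neqE_nat)
  then show False using assms(4) by simp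
qed

lemma node_inj:
  assumes "stair s t xs" "i \<le> length xs" "j \<le> length xs" "node xs i = node xs j"
  shows "i = j"
  using assms stair_inj[OF assms(1), of "i - 1" "j - 1"] node_pos[OF assms(1), of i] node_pos[OF assms(1), of j]
  by (cases i; cases j) (auto simp: node_def)

lemma succ_node_inj:
  assumes "stair s t xs" "i \<le> length xs" "j \<le> length xs" "succ_node xs i = succ_node xs j"
  shows "i = j"
  using assms stair_inj[OF assms(1), of i j] succ_node_pos[OF assms(1), of i] succ_node_pos[OF assms(1), of j]
  by (auto simp: succ_node_def split: if_splits)

lemma linked_cong:
  assumes "linked xs nx pv vl" "stair s t xs" "t \<le> n"
    "\<And>q. q \<le> n \<Longrightarrow> nx' q = nx q" "\<And>q. q \<le> n \<Longrightarrow> pv' q = pv q" "\<And>q. q \<le> n \<Longrightarrow> vl' q = vl q"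
  shows "linked xs nx' pv' vl'"
  unfolding linked_def
proof (intro allI impI)
  fix j assume j: "j \<le> length xs"
  have "node xs j \<le> n" "succ_node xs j \<le> n"
    using node_le[OF assms(2) j] succ_node_le[OF assms(2), of j] assms(3) by auto
  then show "nx' (node xs j) = succ_node xs j \<and> pv' (succ_node xs j) = node xs j \<and> vl' (node xs j) = snd (entry xs j)"
    using assms(1,4-6) j by (simp add: linked_def)
qed

text \<open>The positions from \<open>r\<close> to \<open>e - 1\<close> are bypassed in the same
  update. Agreement of the arrays is demanded only up to \<open>x\<close>, because a row is a window
  of a shared array, and larger offsets may belong to other rows.\<close>

lemma linked_insert:
  assumes "stair s t xs" "linked xs nx pv vl" "r \<le> e" "e \<le> length xs" "t < x"
    "\<And>q. q \<le> x \<Longrightarrow> nx' q = (nx(node xs r := x, x := succ_node xs e)) q"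
    "\<And>q. q \<le> x \<Longrightarrow> pv' q = (pv(x := node xs r, succ_node xs e := x)) q"
    "\<And>q. q \<le> x \<Longrightarrow> vl' q = (vl(x := w)) q"
  shows "linked (take r xs @ (x, w) # drop e xs) nx' pv' vl'"
proof -
  let ?zs = "take r xs @ (x, w) # drop e xs"
  have r: "r \<le> length xs" using assms by simp
  have ent: "entry ?zs j = (if j \<le> r then entry xs j else if j = Suc r then (x, w) else entry xs (e + (j - Suc r)))"
    if "j \<le> length ?zs" for j
    using r assms(4) that by (cases j) (auto simp: entry_def nth_append nth_Cons')
  have suc: "succ_node ?zs j = (if j < r then succ_node xs j else if j = r then x else succ_node xs (e + (j - Suc r)))" for j
    using r assms(4) by (auto simp: succ_node_def nth_append nth_Cons')
  have x: "node xs j \<noteq> x" "node xs j \<le> x" if "j \<le> length xs" for j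
    using node_le[OF assms(1) that] assms(5) by auto
  have x': "succ_node xs j \<noteq> x" "succ_node xs j \<le> x" for j
    using succ_node_le[OF assms(1), of j] assms(5) by auto
  have L: "nx (node xs j) = succ_node xs j" "pv (succ_node xs j) = node xs j" "vl (node xs j) = snd (entry xs j)"
    if "j \<le> length xs" for j using assms(2) that by (auto simp: linked_def)
  show ?thesis
    unfolding linked_def
  proof (intro allI impI)
    fix j assume j: "j \<le> length ?zs"
    consider "j < r" | "j = r" | "j = Suc r" | "Suc r < j" by linarith
    then show "nx' (node ?zs j) = succ_node ?zs j \<and> pv' (succ_node ?zs j) = node ?zs j \<and> vl' (node ?zs j) = snd (entry ?zs j)"
    proof cases
      case 1
      then have "node xs j \<noteq> node xs r" "succ_node xs j \<noteq> succ_node xs e" "j \<le> length xs"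
        using node_inj[OF assms(1), of j r] succ_node_inj[OF assms(1), of j e] r assms(3,4) by auto
      moreover have "node ?zs j = node xs j" using 1 ent[OF j] by (simp add: node_def)
      ultimately show ?thesis using 1 x[of j] x'[of j] L[of j] ent[OF j] suc[of j] by (simp add: assms(6-8))
    next
      case 2
      have "node ?zs j = node xs r" using 2 ent[OF j] by (simp add: node_def)
      then show ?thesis using 2 x[of r] x'[of e] L[of r] ent[OF j] suc[of j] r by (simp add: assms(6-8))
    next
      case 3
      have "node ?zs j = x" using 3 ent[OF j] by (simp add: node_def)
      then show ?thesis using 3 x[of r] x'[of e] r ent[OF j] suc[of j] by (simp add: assms(6-8))
    next
      case 4
      let ?j = "e + (j - Suc r)"
      have jl: "?j \<le> length xs" "e < ?j" using 4 j r assms(4) by auto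
      then have "node xs ?j \<noteq> node xs r" "succ_node xs ?j \<noteq> succ_node xs e"
        using node_inj[OF assms(1), of ?j r] succ_node_inj[OF assms(1), of ?j e] r assms(3,4) by auto
      moreover have "node ?zs j = node xs ?j" using 4 ent[OF j] by (simp add: node_def)
      ultimately show ?thesis using 4 x[of ?j] x'[of ?j] L[of ?j] ent[OF j] suc[of j] jl by (simp add: assms(6-8))
    qed
  qed
qed

lemma linked_drop:
  assumes "stair s t xs" "linked xs nx pv vl" "e \<le> length xs"
    "\<And>q. q \<le> t \<Longrightarrow> nx' q = (nx(0 := succ_node xs e)) q"
    "\<And>q. q \<le> t \<Longrightarrow> pv' q = (pv(succ_node xs e := 0)) q"
    "\<And>q. q \<le> t \<Longrightarrow> vl' q = vl q"
  shows "linked (drop e xs) nx' pv' vl'"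
proof -
  let ?zs = "drop e xs"
  have ent: "entry ?zs j = (if j = 0 then (0, 0) else entry xs (e + j))" for j
    using assms(3) by (cases j) auto
  have suc: "succ_node ?zs j = succ_node xs (e + j)" for j
    using assms(3) by (auto simp: succ_node_def)
  have L: "nx (node xs j) = succ_node xs j" "pv (succ_node xs j) = node xs j" "vl (node xs j) = snd (entry xs j)"
    if "j \<le> length xs" for j using assms(2) that by (auto simp: linked_def)
  show ?thesis
    unfolding linked_def
  proof (intro allI impI)
    fix j assume j: "j \<le> length ?zs"
    then have jl: "e + j \<le> length xs" using assms(3) by simp
    note le = node_le[OF assms(1) jl] succ_node_le[OF assms(1), of "e + j"] succ_node_le[OF assms(1), of e]
    show "nx' (node ?zs j) = succ_node ?zs j \<and> pv' (succ_node ?zs j) = node ?zs j \<and> vl' (node ?zs j) = snd (entry ?zs j)"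
    proof (cases "j = 0")
      case True
      then show ?thesis using suc[of 0] ent[of 0] le L(3)[of 0] by (simp add: assms(4-6) node_def)
    next
      case False
      then have "node xs (e + j) \<noteq> 0" "succ_node xs (e + j) \<noteq> succ_node xs e"
        using node_pos[OF assms(1) jl] succ_node_inj[OF assms(1) jl assms(3)] by auto
      moreover have "node ?zs j = node xs (e + j)" using False ent[of j] by (simp add: node_def)
      ultimately show ?thesis using suc[of j] ent[of j] le L[OF jl] False by (simp add: assms(4-6))
    qed
  qed
qed

definition kept_from :: "stair \<Rightarrow> nat \<Rightarrow> nat \<Rightarrow> nat" where
  "kept_from xs r w = r + length (takeWhile (\<lambda>e. snd e \<le> w) (drop r xs))"

lemma kept_from:
  assumes "stair s t xs" "r \<le> length xs"
  shows "r \<le> kept_from xs r w" "kept_from xs r w \<le> length xs"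
    "\<And>j. r \<le> j \<Longrightarrow> j < length xs \<Longrightarrow> snd (xs ! j) \<le> w \<longleftrightarrow> j < kept_from xs r w"
    "dropWhile (\<lambda>e. snd e \<le> w) (drop r xs) = drop (kept_from xs r w) xs"
proof -
  let ?P = "\<lambda>e. snd e \<le> w"
  let ?l = "length (takeWhile ?P (drop r xs))"
  show "r \<le> kept_from xs r w" by (simp add: kept_from_def)
  show le: "kept_from xs r w \<le> length xs"
    using length_takeWhile_le[of ?P "drop r xs"] assms(2) by (simp add: kept_from_def)
  show "dropWhile ?P (drop r xs) = drop (kept_from xs r w) xs"
    by (simp add: dropWhile_eq_drop kept_from_def add.commute)
  fix j assume j: "r \<le> j" "j < length xs"
  show "snd (xs ! j) \<le> w \<longleftrightarrow> j < kept_from xs r w"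
  proof
    assume "j < kept_from xs r w"
    then have "j - r < ?l" using j by (simp add: kept_from_def)
    then have "?P (drop r xs ! (j - r))" by (metis nth_mem set_takeWhileD takeWhile_nth)
    then show "snd (xs ! j) \<le> w" using j by simp
  next
    assume P: "snd (xs ! j) \<le> w"
    show "j < kept_from xs r w"
    proof (rule ccontr)
      assume "\<not> j < kept_from xs r w"
      then have e: "r + ?l \<le> j" by (simp add: kept_from_def)
      then have "\<not> ?P (drop r xs ! ?l)" using nth_length_takeWhile[of ?P "drop r xs"] j by simp
      then have "w < snd (xs ! (r + ?l))" using e j by simp
      moreover have "snd (xs ! (r + ?l)) \<le> snd (xs ! j)"
        using assms(1) e j by (cases "r + ?l = j") (auto simp: stair_def sorted_wrt_iff_nth_less less_imp_le)
      ultimately show False using P by simp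
    qed
  qed
qed

text \<open>If \<open>h\<close> is not behind \<open>x\<close>, its predecessor is unaffected.
  Behind \<open>x\<close>, the new predecessor is \<open>x\<close> as long as only deleted entries
  lie between, and otherwise the old one survives. Lengths grow along the staircase, so comparing
  the old predecessor's length with \<open>w\<close> separates these cases: a finger is repaired by
  one comparison, without search.\<close>

lemma node_rk_ins:
  assumes "stair s t xs" "x = Suc t" "x \<le> n" "w \<le> x" "snd (entry xs (rk s xs x)) < w" "1 \<le> h" "h \<le> x"
  shows "node (ins s xs x w) (rk s (ins s xs x w) h) =
    (if lt s x h \<and> snd (entry xs (rk s xs h)) \<le> w then x else node xs (rk s xs h))"
proof -
  let ?r = "rk s xs x" and ?R = "rk s xs h"
  let ?e = "kept_from xs ?r w"
  let ?zs = "take ?r xs @ (x, w) # drop ?e xs"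
  have r: "?r \<le> length xs" "?R \<le> length xs" by (rule rk_le)+
  note K = kept_from[OF assms(1) r(1), where w = w]
  have zs: "ins s xs x w = ?zs" using assms(5) K(4) by (simp add: ins_def Let_def)
  have st: "stair s x ?zs" using stair_ins[OF assms(1-4)] zs by simp
  have nth: "?zs ! j = (if j < ?r then xs ! j else if j = ?r then (x, w) else xs ! (?e + (j - Suc ?r)))"
    if "j < length ?zs" for j
    using that r K(2) by (auto simp: nth_append nth_Cons')
  note rkx = lt_nth_rk[OF assms(1), of _ x] and rkh = lt_nth_rk[OF assms(1), of _ h]
  show ?thesis
  proof (cases "lt s x h")
    case False
    have Rr: "?R \<le> ?r"
    proof (rule ccontr)
      assume "\<not> ?R \<le> ?r"
      then have "?r < length xs" "?r < ?R" using r by auto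
      then have "lt s (fst (xs ! ?r)) h" "\<not> lt s (fst (xs ! ?r)) x" using rkh[of ?r] rkx[of ?r] by auto
      moreover have "lt s h x \<or> h = x" using lt_total[of h x s] False assms by auto
      ultimately show False using lt_trans by blast
    qed
    have "rk s ?zs h = ?R"
    proof (rule rk_unique[OF st])
      fix j assume j: "j < length ?zs"
      show "lt s (fst (?zs ! j)) h \<longleftrightarrow> j < ?R"
      proof (cases "j < ?r")
        case True
        then show ?thesis using nth[OF j] rkh[of j] r by simp
      next
        case F: False
        show ?thesis
        proof (cases "j = ?r")
          case True
          then show ?thesis using nth[OF j] False Rr by simp
        next
          case G: False
          have "?e + (j - Suc ?r) < length xs" using j F G r K(2) by auto
          then show ?thesis using nth[OF j] F G rkh[of "?e + (j - Suc ?r)"] Rr K(1) by auto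
        qed
      qed
    qed (use r Rr in simp)
    moreover have "entry ?zs ?R = entry xs ?R" using Rr r by (cases ?R) (auto simp: nth_append)
    ultimately show ?thesis using False by (simp add: zs node_def)
  next
    case True
    have Rr: "?r \<le> ?R" by (rule rk_mono[OF True])
    show ?thesis
    proof (cases "?R \<le> ?e")
      case Re: True
      have "rk s ?zs h = Suc ?r"
      proof (rule rk_unique[OF st])
        fix j assume j: "j < length ?zs"
        show "lt s (fst (?zs ! j)) h \<longleftrightarrow> j < Suc ?r"
        proof (cases "j < ?r")
          case l: True
          then show ?thesis using nth[OF j] rkh[of j] r Rr by simp
        next
          case F: False
          show ?thesis
          proof (cases "j = ?r")
            case l: True
            then show ?thesis using nth[OF j] True by simp
          next
            case G: False
            have "?e + (j - Suc ?r) < length xs" using j F G r K(2) by auto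
            then show ?thesis using nth[OF j] F G rkh[of "?e + (j - Suc ?r)"] Re by auto
          qed
        qed
      qed (use r in simp)
      moreover have "entry ?zs (Suc ?r) = (x, w)" using r by (simp add: nth_append)
      moreover have "snd (entry xs ?R) \<le> w"
      proof (cases "?R = ?r")
        case False
        then obtain j where "?R = Suc j" "?r \<le> j" using Rr by (cases ?R) auto
        then show ?thesis using K(3)[of j] Re r by simp
      qed (use assms(5) in simp)
      ultimately show ?thesis using True by (simp add: zs node_def)
    next
      case Re: False
      let ?q = "Suc ?r + (?R - ?e)"
      have "rk s ?zs h = ?q"
      proof (rule rk_unique[OF st])
        fix j assume j: "j < length ?zs"
        show "lt s (fst (?zs ! j)) h \<longleftrightarrow> j < ?q"
        proof (cases "j < ?r")
          case l: True
          then show ?thesis using nth[OF j] rkh[of j] r Rr by simp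
        next
          case F: False
          show ?thesis
          proof (cases "j = ?r")
            case l: True
            then show ?thesis using nth[OF j] True by simp
          next
            case G: False
            have "?e + (j - Suc ?r) < length xs" using j F G r K(2) by auto
            then show ?thesis using nth[OF j] F G rkh[of "?e + (j - Suc ?r)"] Re by auto
          qed
        qed
      qed (use r Re in simp)
      moreover have "entry ?zs ?q = entry xs ?R"
      proof -
        obtain j where j: "?R = Suc j" "?e \<le> j" using Re by (cases ?R) auto
        let ?i = "?r + (?R - ?e)"
        have il: "?i < length ?zs" using r Re by simp
        have ir: "\<not> ?i < ?r" "?i \<noteq> ?r" using j by arith+
        have "?zs ! ?i = xs ! (?e + (?i - Suc ?r))"
          unfolding nth[OF il] using ir by (simp only: if_False)
        moreover have "?e + (?i - Suc ?r) = j" using j by arith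
        ultimately have "?zs ! ?i = xs ! j" by simp
        then show ?thesis by (simp only: j(1) entry_simps add_Suc)
      qed
      moreover have "\<not> snd (entry xs ?R) \<le> w"
      proof -
        obtain j where "?R = Suc j" "?e \<le> j" using Re by (cases ?R) auto
        then show ?thesis using K(1) K(3)[of j] r by simp
      qed
      ultimately show ?thesis using True by (simp add: zs node_def)
    qed
  qed
qed

end

section \<open>Execution of the program\<close>

text \<open>As a congruence rule, this makes the simplifier execute programs symbolically, forwards.\<close>

lemma wp_cong: "c = c' \<Longrightarrow> \<sigma> = \<sigma>' \<Longrightarrow> wp W S c \<sigma> Q = wp W S c' \<sigma>' Q"
  by simp

text \<open>The two products dominate the addresses of list nodes and of fingers, both laid out row
  by row; the remaining summands leave room for counters and sums with \<open>k\<close>.\<close>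

locale machine = input +
  fixes W :: nat
  assumes W: "(2 * k + 1) * (n + 1) + (2 * k + 1) * (2 * k) + n + k + 2 < W"
begin

abbreviation (input) run :: "com \<Rightarrow> state \<Rightarrow> (nat \<Rightarrow> state \<Rightarrow> bool) \<Rightarrow> bool" where
  "run \<equiv> wp W S"

definition mm :: nat where "mm = Suc n"
definition kk :: nat where "kk = 2 * k"

abbreviation row :: "state \<Rightarrow> vname \<Rightarrow> nat \<Rightarrow> nat \<Rightarrow> nat" where
  "row \<sigma> a s \<equiv> (\<lambda>q. arr \<sigma> a (s * mm + q))"

definition params :: "state \<Rightarrow> bool" where
  "params \<sigma> \<longleftrightarrow> reg \<sigma> ''n'' = n \<and> reg \<sigma> ''k'' = k \<and> reg \<sigma> ''M'' = mm \<and> reg \<sigma> ''K'' = kk"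

lemma params_simps:
  assumes "params \<sigma>"
  shows "reg \<sigma> ''n'' = n" "reg \<sigma> ''k'' = k" "reg \<sigma> ''M'' = mm" "reg \<sigma> ''K'' = kk"
  using assms by (auto simp: params_def)

section \<open>Word bounds, disjoint rows and elementary blocks\<close>

lemma row_less: assumes "s < kk" "q \<le> n" shows "s * mm + q < W" "s * mm < W"
proof -
  have "Suc s * mm \<le> kk * mm" using assms(1) by (intro mult_le_mono1) simp
  then have "s * mm + mm \<le> kk * mm" by simp
  then show "s * mm + q < W" "s * mm < W" using W assms(2) by (auto simp: mm_def kk_def)
qed

lemma finger_less: assumes "s < kk" "g < kk" shows "s * kk + g < W" "s * kk < W"
proof -
  have "Suc s * kk \<le> kk * kk" using assms(1) by (intro mult_le_mono1) simp
  then have "s * kk + kk \<le> kk * kk" by simp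
  moreover have "kk * kk \<le> (2 * k + 1) * (2 * k)" by (simp add: kk_def)
  ultimately show "s * kk + g < W" "s * kk < W" using W assms(2) by auto
qed

lemma bounds: "q \<le> Suc n \<Longrightarrow> q < W" "q \<le> kk \<Longrightarrow> Suc q < W" "q \<le> n \<Longrightarrow> q + k < W"
  "q \<le> k \<Longrightarrow> q < W" "mm < W" "kk < W" "k < W" "2 < W" "1 < W" "Suc 0 < W" "0 < W"
  using W k3 by (auto simp: kk_def mm_def)

lemma row_inj: "q \<le> n \<Longrightarrow> q' \<le> n \<Longrightarrow> s * mm + q = s' * mm + q' \<longleftrightarrow> s = s' \<and> q = q'"
proof
  assume q: "q \<le> n" "q' \<le> n" and eq: "s * mm + q = s' * mm + q'"
  have "q < mm" "q' < mm" using q by (auto simp: mm_def)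
  then have "(s * mm + q) div mm = s" "(s' * mm + q') div mm = s'" by auto
  then show "s = s' \<and> q = q'" using eq by simp
qed simp

lemma finger_inj: "g < kk \<Longrightarrow> g' < kk \<Longrightarrow> s * kk + g = s' * kk + g' \<longleftrightarrow> s = s' \<and> g = g'"
proof
  assume q: "g < kk" "g' < kk" and e: "s * kk + g = s' * kk + g'"
  have "(s * kk + g) div kk = s" "(s' * kk + g') div kk = s'" using q by auto
  then show "s = s' \<and> g = g'" using e by simp
qed simp

lemma before_b:
  assumes "params \<sigma>" "1 \<le> aval e \<sigma>" "aval e \<sigma> \<le> n" "1 \<le> aval f \<sigma>" "aval f \<sigma> \<le> n"
  shows "bval S (before_b e f) \<sigma> \<longleftrightarrow> lt (reg \<sigma> ''s'') (aval e \<sigma>) (aval f \<sigma>)"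
    "afits W e \<sigma> \<Longrightarrow> afits W f \<sigma> \<Longrightarrow> reg \<sigma> ''s'' < kk \<Longrightarrow> bfits W S (before_b e f) \<sigma>"
proof -
  show "bval S (before_b e f) \<sigma> \<longleftrightarrow> lt (reg \<sigma> ''s'') (aval e \<sigma>) (aval f \<sigma>)"
    using assms(1) by (auto simp: before_b_def lt_def dlt_def key_def params_simps)
  assume A: "afits W e \<sigma>" "afits W f \<sigma>" "reg \<sigma> ''s'' < kk"
  have "aval e \<sigma> - 1 < n" "aval f \<sigma> - 1 < n" using assms(2-5) by linarith+
  moreover have "reg \<sigma> ''s'' < W" using A(3) bounds(2)[of "reg \<sigma> ''s''"] by linarith
  ultimately show "bfits W S (before_b e f) \<sigma>"
    using A(1,2) bounds(7,9) params_simps[OF assms(1)] by (auto simp: before_b_def)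
qed

lemma bcost_before: "bcost (before_b e f) = 23 + 2 * (acost e + acost f)"
  by (simp add: before_b_def)

lemma wp_max_prog: "run (max_prog a e) \<sigma> Q \<longleftrightarrow> reg \<sigma> a < W \<and> afits W e \<sigma> \<and>
    Q (4 + 2 * acost e) (\<sigma>\<lparr>reg := (reg \<sigma>)(a := max (reg \<sigma> a) (aval e \<sigma>))\<rparr>)"
proof -
  have t: "1 + acost (Plus e (Minus (Reg a) e)) = 4 + 2 * acost e" by simp
  have m: "aval (Plus e (Minus (Reg a) e)) \<sigma> = max (reg \<sigma> a) (aval e \<sigma>)" by auto
  have f: "afits W (Plus e (Minus (Reg a) e)) \<sigma> \<longleftrightarrow> reg \<sigma> a < W \<and> afits W e \<sigma>"
    using m afits_aval[of W e \<sigma>] by auto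
  show ?thesis unfolding max_prog_def wp_Assign t m f by blast
qed

lemma wp_store_pos: "run (store_pos e a) \<sigma> Q \<longleftrightarrow> reg \<sigma> a < W \<and> afits W e \<sigma> \<and>
    Q (6 + acost e) (\<sigma>\<lparr>arr := (arr \<sigma>)(''w'' := (arr \<sigma> ''w'')(aval e \<sigma> := max 1 (reg \<sigma> a)))\<rparr>)"
proof -
  let ?f = "Plus (Const 1) (Minus (Reg a) (Const 1))"
  have t: "1 + acost e + acost ?f = 6 + acost e" by simp
  have m: "aval ?f \<sigma> = max 1 (reg \<sigma> a)" by auto
  have f: "afits W ?f \<sigma> \<longleftrightarrow> reg \<sigma> a < W" using m bounds(9) by auto
  show ?thesis unfolding store_pos_def wp_Store t m f by blast
qed

text \<open>The 10 units per round pay for test, sequencing and increment; the last 10 pay for the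
  initial assignment and the failing test.\<close>

lemma run_for_loop:
  assumes "I 0 (\<sigma>\<lparr>reg := (reg \<sigma>)(r := 0)\<rparr>)"
    "\<And>j \<tau>. I j \<tau> \<Longrightarrow> reg \<tau> r = j \<and> j \<le> kk \<and> reg \<tau> ''K'' = kk"
    "\<And>j \<tau>. I j \<tau> \<Longrightarrow> j < kk \<Longrightarrow>
      run c \<tau> (\<lambda>t \<tau>'. t \<le> T j \<and> reg \<tau>' r = j \<and> I (Suc j) (\<tau>'\<lparr>reg := (reg \<tau>')(r := Suc j)\<rparr>))"
  shows "run (for_loop r c) \<sigma> (\<lambda>t \<tau>. I kk \<tau> \<and> t \<le> (\<Sum>j<kk. T j + 10) + 10)"
proof -
  let ?f = "\<lambda>j. \<Sum>i\<in>{j..<kk}. T i + 10"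
  let ?W = "While (Less (Reg r) (Reg ''K'')) (Seq c (incr r))"
  let ?s = "\<sigma>\<lparr>reg := (reg \<sigma>)(r := 0)\<rparr>"
  have "run ?W ?s (\<lambda>t \<sigma>'. \<exists>j'. I j' \<sigma>' \<and> \<not> bval S (Less (Reg r) (Reg ''K'')) \<sigma>' \<and>
    t + ?f j' \<le> ?f 0 + 1 + bcost (Less (Reg r) (Reg ''K'')))"
  proof (rule wp_While[where I = I])
    show "I 0 ?s" by (rule assms(1))
    show "bfits W S (Less (Reg r) (Reg ''K'')) \<tau>" if "I j \<tau>" for j \<tau>
      using assms(2)[OF that] bounds(2)[of j] bounds by simp
    fix j \<tau> assume I: "I j \<tau>" and b: "bval S (Less (Reg r) (Reg ''K'')) \<tau>"
    have j: "reg \<tau> r = j" "j < kk" "reg \<tau> ''K'' = kk" using assms(2)[OF I] b by auto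
    have f: "?f j = T j + 10 + ?f (Suc j)" using j(2) by (simp add: sum.atLeast_Suc_lessThan)
    show "run (Seq c (incr r)) \<tau> (\<lambda>t \<sigma>'. \<exists>j'. I j' \<sigma>' \<and>
        t + 1 + bcost (Less (Reg r) (Reg ''K'')) + ?f j' \<le> ?f j)"
      unfolding wp_Seq
    proof (rule wp_mono[OF assms(3)[OF I j(2)]])
      fix t \<tau>' assume *: "t \<le> T j \<and> reg \<tau>' r = j \<and> I (Suc j) (\<tau>'\<lparr>reg := (reg \<tau>')(r := Suc j)\<rparr>)"
      then show "run (incr r) \<tau>' (\<lambda>t' \<sigma>''. \<exists>j'. I j' \<sigma>'' \<and>
          1 + t + t' + 1 + bcost (Less (Reg r) (Reg ''K'')) + ?f j' \<le> ?f j)"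
        using j bounds(2)[of j] bounds f
        by (auto simp: incr_def wp_simps intro!: exI[of _ "Suc j"])
    qed
  qed
  then show ?thesis
    unfolding for_loop_def wp_simps
  proof (intro conjI, goal_cases)
    case 1
    show ?case using bounds by simp
  next
    case 2
    show ?case
    proof (rule wp_mono)
      show "run ?W (\<sigma>\<lparr>reg := (reg \<sigma>)(r := aval (Const 0) \<sigma>)\<rparr>) (\<lambda>t \<sigma>'. \<exists>j'. I j' \<sigma>' \<and>
        \<not> bval S (Less (Reg r) (Reg ''K'')) \<sigma>' \<and> t + ?f j' \<le> ?f 0 + 1 + bcost (Less (Reg r) (Reg ''K'')))"
        using 2 by simp
      fix t \<tau> assume "\<exists>j'. I j' \<tau> \<and> \<not> bval S (Less (Reg r) (Reg ''K'')) \<tau> \<and>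
        t + ?f j' \<le> ?f 0 + 1 + bcost (Less (Reg r) (Reg ''K''))"
      then obtain j where j: "I j \<tau>" "\<not> reg \<tau> r < reg \<tau> ''K''" "t + ?f j \<le> ?f 0 + 4" by auto
      then have "j = kk" using assms(2)[OF j(1)] by simp
      then show "I kk \<tau> \<and> 1 + (1 + acost (Const 0)) + t \<le> (\<Sum>j<kk. T j + 10) + 10"
        using j by (simp add: lessThan_atLeast0)
    qed
  qed
qed

lemma run_label_loop:
  assumes "params \<sigma>" "reg \<sigma> ''i'' = x" "1 \<le> x" "x \<le> n" "reg \<sigma> U = length T"
    "\<And>j. j < length T \<Longrightarrow> arr \<sigma> a j = T ! j" "\<And>j. j < length T \<Longrightarrow> 1 \<le> T ! j \<and> T ! j \<le> n"
    "length T \<le> k" "u \<notin> {U, ''i'', ''k''}"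
  shows "run (label_loop d a U u) (\<sigma>\<lparr>reg := (reg \<sigma>)(u := 0)\<rparr>)
    (\<lambda>t \<sigma>'. \<sigma>' = \<sigma>\<lparr>reg := (reg \<sigma>)(u := label d T x)\<rparr> \<and> t \<le> 50 * k + 50)"
proof -
  let ?b = "Conj (Less (Reg u) (Reg U)) (Conj (Less (plus1 (Reg u)) (Reg ''k''))
        (if d then InLess (minus1 (Arr a (Reg u))) (minus1 (Reg ''i''))
         else InLess (minus1 (Reg ''i'')) (minus1 (Arr a (Reg u)))))"
  let ?l = "label d T x"
  define I where "I = (\<lambda>j \<tau>. \<tau> = \<sigma>\<lparr>reg := (reg \<sigma>)(u := j)\<rparr> \<and> j \<le> ?l)"
  have test: "j < length T \<and> Suc j < k \<and> dlt d (key (T ! j)) (key x) \<longleftrightarrow> j < ?l" if j: "j \<le> ?l" for j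
  proof
    assume "j < ?l"
    then have *: "j < length (takeWhile (\<lambda>y. dlt d (key y) (key x)) (take (k - 1) T))" by (simp add: label_def)
    then have l: "j < length (take (k - 1) T)" using length_takeWhile_le less_le_trans by blast
    moreover have "dlt d (key (take (k - 1) T ! j)) (key x)"
      using * by (metis nth_mem set_takeWhileD takeWhile_nth)
    ultimately show "j < length T \<and> Suc j < k \<and> dlt d (key (T ! j)) (key x)" by auto
  next
    assume *: "j < length T \<and> Suc j < k \<and> dlt d (key (T ! j)) (key x)"
    show "j < ?l"
    proof (rule ccontr)
      assume "\<not> j < ?l"
      then have "j = ?l" using j by simp
      then show False using * label_stop[of d T x] by auto
    qed
  qed
  have cond: "bval S ?b \<tau> \<longleftrightarrow> j < ?l" "bfits W S ?b \<tau>" if "I j \<tau>" for j \<tau>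
  proof -
    have j: "\<tau> = \<sigma>\<lparr>reg := (reg \<sigma>)(u := j)\<rparr>" "j \<le> ?l" using that by (auto simp: I_def)
    have jk: "j \<le> k" using j(2) takeWhile_label(2)[of d T x] by simp
    show "bval S ?b \<tau> \<longleftrightarrow> j < ?l"
      unfolding test[OF j(2), symmetric] using j assms(1,2,5,6,9) by (cases d) (auto simp: params_simps dlt_def key_def)
    show "bfits W S ?b \<tau>"
    proof (cases "j < length T")
      case True
      have "T ! j - 1 < n" "x - 1 < n" using assms(3,4) assms(7)[OF True] by auto
      then show ?thesis
        using True j assms(1,2,4,5,6,9) assms(7,8) jk bounds bounds(1)[of x] bounds(4)[of j] bounds(4)[of "length T"] bounds(1)[of "T ! j"] bounds(2)[of j]
        by (auto simp: params_simps kk_def)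
    next
      case False
      then show ?thesis using j assms(5,8,9) jk bounds(4)[of j] bounds(4)[of "length T"] by auto
    qed
  qed
  have "run (label_loop d a U u) (\<sigma>\<lparr>reg := (reg \<sigma>)(u := 0)\<rparr>)
    (\<lambda>t \<sigma>'. \<exists>j'. I j' \<sigma>' \<and> \<not> bval S ?b \<sigma>' \<and> t + 50 * (?l - j') \<le> 50 * (?l - 0) + 1 + bcost ?b)"
    unfolding label_loop_def
  proof (rule wp_While[where I = I and j = 0])
    fix j \<tau> assume I: "I j \<tau>" and b: "bval S ?b \<tau>"
    have j: "j < ?l" using cond[OF I] b by simp
    have jk: "j \<le> k" using j takeWhile_label(2)[of d T x] by simp
    have \<tau>: "\<tau> = \<sigma>\<lparr>reg := (reg \<sigma>)(u := j)\<rparr>" using I by (simp add: I_def)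
    have "I (Suc j) (\<tau>\<lparr>reg := (reg \<tau>)(u := Suc j)\<rparr>)" using \<tau> j by (simp add: I_def)
    then show "run (incr u) \<tau> (\<lambda>t \<sigma>'. \<exists>j'. I j' \<sigma>' \<and> t + 1 + bcost ?b + 50 * (?l - j') \<le> 50 * (?l - j))"
      using j jk \<tau> bounds bounds(4)[of j] bounds(2)[of j]
      by (auto simp: incr_def wp_simps kk_def intro!: exI[of _ "Suc j"])
  qed (use cond in \<open>auto simp: I_def\<close>)
  then show ?thesis
  proof (rule wp_mono)
    fix t \<sigma>' assume "\<exists>j'. I j' \<sigma>' \<and> \<not> bval S ?b \<sigma>' \<and> t + 50 * (?l - j') \<le> 50 * (?l - 0) + 1 + bcost ?b"
    then obtain j where j: "I j \<sigma>'" "\<not> bval S ?b \<sigma>'" "t + 50 * (?l - j) \<le> 50 * (?l - 0) + 1 + bcost ?b" by blast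
    then have "\<not> j < ?l" using cond(1)[OF j(1)] by blast
    then have "j = ?l" using j(1) by (simp add: I_def)
    then show "\<sigma>' = \<sigma>\<lparr>reg := (reg \<sigma>)(u := ?l)\<rparr> \<and> t \<le> 50 * k + 50"
      using j takeWhile_label(2)[of d T x] by (auto simp: I_def split: if_splits)
  qed
qed

lemma run_label_prog:
  assumes "params \<sigma>" "reg \<sigma> ''i'' = x" "1 \<le> x" "x \<le> n" "reg \<sigma> U = length T"
    "\<And>j. j < length T \<Longrightarrow> arr \<sigma> a j = T ! j" "\<And>j. j < length T \<Longrightarrow> 1 \<le> T ! j \<and> T ! j \<le> n"
    "length T \<le> k" "u \<notin> {U, ''i'', ''k''}" "U \<notin> {''i'', ''k''}"
  shows "run (label_prog d a U u) \<sigma> (\<lambda>t \<sigma>'. t \<le> 50 * k + 80 \<and>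
    reg \<sigma>' = (reg \<sigma>)(u := label d T x, U := length (put (label d T x) x T)) \<and>
    arr \<sigma>' = (arr \<sigma>)(a := (arr \<sigma> a)(label d T x := x)))"
proof -
  let ?l = "label d T x"
  have l: "?l \<le> length T" "?l < W" "Suc (length T) < W" "x < W" "length T < W"
    using takeWhile_label[of d T x] assms(4,8) bounds(4)[of ?l] bounds(2)[of "length T"] bounds(1)[of x]
      bounds(4)[of "length T"] by (auto simp: kk_def)
  have lp: "length (put ?l x T) = (if ?l < length T then length T else Suc (length T))"
    using l(1) by (simp add: put_def)
  show ?thesis
    unfolding label_prog_def wp_Seq wp_Assign
  proof (intro conjI, goal_cases)
    case 1
    show ?case using bounds by simp
  next
    case 2
    show ?case
      unfolding aval.simps
      by (rule wp_mono[OF run_label_loop[OF assms(1-9)]])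
        (use l lp assms(2,5,9,10) bounds in \<open>auto simp: wp_simps incr_def fun_eq_iff\<close>)
  qed
qed

section \<open>Predecessor search with fingers\<close>

lemma lt_node:
  assumes "stair s t xs" "0 < j" "j \<le> length xs"
  shows "lt s (node xs j) x \<longleftrightarrow> j \<le> rk s xs x"
  using assms lt_nth_rk[OF assms(1), of "j - 1" x] by (cases j) (auto simp: node_def)

lemma node_1: "stair s t xs \<Longrightarrow> 0 < j \<Longrightarrow> j \<le> length xs \<Longrightarrow> 1 \<le> node xs j"
  using node_pos[of s t xs j] by simp

lemma run_left_loop:
  assumes "params \<sigma>" "reg \<sigma> ''i'' = x" "t < x" "x \<le> n" "reg \<sigma> ''s'' = s" "s < kk" "stair s t xs"
    "linked xs (row \<sigma> ''n'' s) (row \<sigma> ''p'' s) (row \<sigma> ''l'' s)" "j0 \<le> length xs"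
  shows "run left_loop (\<sigma>\<lparr>reg := (reg \<sigma>)(''p'' := node xs j0)\<rparr>)
    (\<lambda>t' \<sigma>'. \<sigma>' = \<sigma>\<lparr>reg := (reg \<sigma>)(''p'' := node xs (min j0 (rk s xs x)))\<rparr> \<and>
       t' \<le> 50 * (j0 - rk s xs x) + 50)"
proof -
  let ?r = "rk s xs x"
  let ?b = "Conj (Less (Const 0) (Reg ''p'')) (Neg (before_b (Reg ''p'') (Reg ''i'')))"
  define I where "I = (\<lambda>j \<tau>. \<tau> = \<sigma>\<lparr>reg := (reg \<sigma>)(''p'' := node xs j)\<rparr> \<and> min j0 ?r \<le> j \<and> j \<le> j0)"
  have cond: "bval S ?b \<tau> \<longleftrightarrow> ?r < j" "bfits W S ?b \<tau>" if "I j \<tau>" for j \<tau>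
  proof -
    have \<tau>: "\<tau> = \<sigma>\<lparr>reg := (reg \<sigma>)(''p'' := node xs j)\<rparr>" and j: "j \<le> length xs"
      using that assms(9) by (auto simp: I_def)
    have c: "params \<tau>" using assms(1) \<tau> by (simp add: params_def)
    have nle: "node xs j \<le> n" using node_le[OF assms(7) j] assms(3,4) by simp
    have "(bval S ?b \<tau> \<longleftrightarrow> ?r < j) \<and> bfits W S ?b \<tau>"
    \<comment> \<open>At the head node the first conjunct is false, so the short-circuit conjunction
      never sends the sentinel to an input comparison.\<close>
    proof (cases "j = 0")
      case True
      then show ?thesis using \<tau> bounds by simp
    next
      case False
      then have "1 \<le> node xs j" using node_1[OF assms(7) _ j] by simp
      then show ?thesis
        using before_b[OF c, of "Reg ''p''" "Reg ''i''"] nle assms(2-6) \<tau> lt_node[OF assms(7) _ j, of x] False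
          bounds bounds(1)[of x] bounds(1)[of "node xs j"] by auto
    qed
    then show "bval S ?b \<tau> \<longleftrightarrow> ?r < j" "bfits W S ?b \<tau>" by auto
  qed
  have "run left_loop (\<sigma>\<lparr>reg := (reg \<sigma>)(''p'' := node xs j0)\<rparr>)
    (\<lambda>t \<sigma>'. \<exists>j'. I j' \<sigma>' \<and> \<not> bval S ?b \<sigma>' \<and> t + 50 * j' \<le> 50 * j0 + 1 + bcost ?b)"
    unfolding left_loop_def
  proof (rule wp_While[where I = I and j = j0])
    fix j \<tau> assume I: "I j \<tau>" and b: "bval S ?b \<tau>"
    have j: "?r < j" "j \<le> length xs" using cond[OF I] b I assms(9) by (auto simp: I_def)
    have \<tau>: "\<tau> = \<sigma>\<lparr>reg := (reg \<sigma>)(''p'' := node xs j)\<rparr>" using I by (simp add: I_def)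
    obtain i where i: "j = Suc i" using j by (cases j) auto
    have pv: "row \<sigma> ''p'' s (node xs j) = node xs i"
      using assms(8)[unfolded linked_def, rule_format, of i] succ_node_Suc[of i xs] i j by simp
    have nle: "node xs j \<le> n" "node xs i \<le> n" using node_le[OF assms(7)] j i assms(3,4) by (auto intro: le_trans[of _ t n])
    have I': "I i (\<sigma>\<lparr>reg := (reg \<sigma>)(''p'' := node xs i)\<rparr>)" using I i j by (auto simp: I_def)
    show "run (Assign ''p'' (Arr ''p'' (row_at (Reg ''p'')))) \<tau>
        (\<lambda>t \<sigma>'. \<exists>j'. I j' \<sigma>' \<and> t + 1 + bcost ?b + 50 * j' \<le> 50 * j)"
      using I' \<tau> pv nle i assms(1,5,6) bounds bounds(1)[of "node xs j"] bounds(1)[of "node xs i"] bounds(2)[of s]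
        row_less[OF assms(6), of "node xs j"]
      by (auto simp: wp_simps params_simps bcost_before intro!: exI[of _ i])
  qed (use cond in \<open>auto simp: I_def\<close>)
  then show ?thesis
  proof (rule wp_mono)
    fix t' \<sigma>' assume "\<exists>j'. I j' \<sigma>' \<and> \<not> bval S ?b \<sigma>' \<and> t' + 50 * j' \<le> 50 * j0 + 1 + bcost ?b"
    then obtain j where j: "I j \<sigma>'" "\<not> bval S ?b \<sigma>'" "t' + 50 * j \<le> 50 * j0 + 1 + bcost ?b" by blast
    then have "j = min j0 ?r" using cond(1)[OF j(1)] by (auto simp: I_def)
    then show "\<sigma>' = \<sigma>\<lparr>reg := (reg \<sigma>)(''p'' := node xs (min j0 ?r))\<rparr> \<and> t' \<le> 50 * (j0 - ?r) + 50"
      using j by (auto simp: I_def bcost_before)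
  qed
qed

lemma run_right_loop:
  assumes "params \<sigma>" "reg \<sigma> ''i'' = x" "t < x" "x \<le> n" "reg \<sigma> ''s'' = s" "s < kk" "stair s t xs"
    "linked xs (row \<sigma> ''n'' s) (row \<sigma> ''p'' s) (row \<sigma> ''l'' s)" "j0 \<le> rk s xs x"
  shows "run right_loop (\<sigma>\<lparr>reg := (reg \<sigma>)(''p'' := node xs j0, ''q'' := succ_node xs j0)\<rparr>)
    (\<lambda>t' \<sigma>'. \<sigma>' = \<sigma>\<lparr>reg := (reg \<sigma>)(''p'' := node xs (rk s xs x), ''q'' := succ_node xs (rk s xs x))\<rparr> \<and>
       t' \<le> 50 * (rk s xs x - j0) + 50)"
proof -
  let ?r = "rk s xs x"
  let ?b = "Conj (Less (Const 0) (Reg ''q'')) (before_b (Reg ''q'') (Reg ''i''))"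
  define I where "I = (\<lambda>j \<tau>. \<tau> = \<sigma>\<lparr>reg := (reg \<sigma>)(''p'' := node xs j, ''q'' := succ_node xs j)\<rparr> \<and> j \<le> ?r)"
  have cond: "bval S ?b \<tau> \<longleftrightarrow> j < ?r" "bfits W S ?b \<tau>" if "I j \<tau>" for j \<tau>
  proof -
    have \<tau>: "\<tau> = \<sigma>\<lparr>reg := (reg \<sigma>)(''p'' := node xs j, ''q'' := succ_node xs j)\<rparr>" and j: "j \<le> ?r"
      using that by (auto simp: I_def)
    have c: "params \<tau>" using assms(1) \<tau> by (simp add: params_def)
    have "(bval S ?b \<tau> \<longleftrightarrow> j < ?r) \<and> bfits W S ?b \<tau>"
    proof (cases "j < length xs")
      case False
      then have "j = ?r" "succ_node xs j = 0" using j rk_le[of s xs x] by (auto simp: succ_node_def)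
      then show ?thesis using \<tau> bounds by simp
    next
      case True
      have sn: "succ_node xs j = node xs (Suc j)" using succ_node_Suc[OF True] .
      have nle: "1 \<le> node xs (Suc j)" "node xs (Suc j) \<le> n"
        using node_1[OF assms(7), of "Suc j"] node_le[OF assms(7), of "Suc j"] True assms(3,4) by auto
      then show ?thesis
        using before_b[OF c, of "Reg ''q''" "Reg ''i''"] assms(2-6) \<tau> lt_node[OF assms(7), of "Suc j" x] True sn
          bounds bounds(1)[of x] bounds(1)[of "node xs (Suc j)"] by auto
    qed
    then show "bval S ?b \<tau> \<longleftrightarrow> j < ?r" "bfits W S ?b \<tau>" by auto
  qed
  have "run right_loop (\<sigma>\<lparr>reg := (reg \<sigma>)(''p'' := node xs j0, ''q'' := succ_node xs j0)\<rparr>)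
    (\<lambda>t \<sigma>'. \<exists>j'. I j' \<sigma>' \<and> \<not> bval S ?b \<sigma>' \<and> t + 50 * (?r - j') \<le> 50 * (?r - j0) + 1 + bcost ?b)"
    unfolding right_loop_def
  proof (rule wp_While[where I = I and j = j0])
    fix j \<tau> assume I: "I j \<tau>" and b: "bval S ?b \<tau>"
    have j: "j < ?r" "j < length xs" using cond[OF I] b rk_le[of s xs x] by auto
    have \<tau>: "\<tau> = \<sigma>\<lparr>reg := (reg \<sigma>)(''p'' := node xs j, ''q'' := succ_node xs j)\<rparr>" using I by (simp add: I_def)
    have sn: "succ_node xs j = node xs (Suc j)" using succ_node_Suc[OF j(2)] .
    have nx: "row \<sigma> ''n'' s (node xs (Suc j)) = succ_node xs (Suc j)"
      using assms(8) j unfolding linked_def by auto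
    have nle: "node xs (Suc j) \<le> n" "succ_node xs (Suc j) \<le> n"
      using node_le[OF assms(7), of "Suc j"] succ_node_le[OF assms(7), of "Suc j"] j assms(3,4) by auto
    have I': "I (Suc j) (\<sigma>\<lparr>reg := (reg \<sigma>)(''p'' := node xs (Suc j), ''q'' := succ_node xs (Suc j))\<rparr>)"
      using j by (auto simp: I_def)
    have eq: "(reg \<sigma>)(''p'' := a, ''q'' := b, ''p'' := c, ''q'' := d) = (reg \<sigma>)(''p'' := c, ''q'' := d)" for a b c d
      by (auto simp: fun_eq_iff)
    show "run (Seq (Assign ''p'' (Reg ''q'')) (Assign ''q'' (Arr ''n'' (row_at (Reg ''p''))))) \<tau>
        (\<lambda>t \<sigma>'. \<exists>j'. I j' \<sigma>' \<and> t + 1 + bcost ?b + 50 * (?r - j') \<le> 50 * (?r - j))"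
      using I' \<tau> nx nle j sn eq assms(1,5,6) bounds bounds(1)[of "node xs (Suc j)"] bounds(1)[of "succ_node xs (Suc j)"]
        bounds(2)[of s] row_less[OF assms(6), of "node xs (Suc j)"]
      by (auto simp: wp_simps params_simps bcost_before intro!: exI[of _ "Suc j"])
  qed (use cond assms(9) in \<open>auto simp: I_def\<close>)
  then show ?thesis
  proof (rule wp_mono)
    fix t' \<sigma>' assume "\<exists>j'. I j' \<sigma>' \<and> \<not> bval S ?b \<sigma>' \<and> t' + 50 * (?r - j') \<le> 50 * (?r - j0) + 1 + bcost ?b"
    then obtain j where j: "I j \<sigma>'" "\<not> bval S ?b \<sigma>'" "t' + 50 * (?r - j) \<le> 50 * (?r - j0) + 1 + bcost ?b" by blast
    then have "j = ?r" using cond(1)[OF j(1)] by (auto simp: I_def)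
    then show "\<sigma>' = \<sigma>\<lparr>reg := (reg \<sigma>)(''p'' := node xs ?r, ''q'' := succ_node xs ?r)\<rparr> \<and> t' \<le> 50 * (?r - j0) + 50"
      using j by (auto simp: I_def bcost_before)
  qed
qed

text \<open>At most one of the two loops moves: the left one stops at the minimum of start and
  target, and the right one goes on from there. The cost is therefore proportional to
  \<open>gap\<close>, the quantity paid for by the potential.\<close>

lemma run_search_prog:
  assumes "params \<sigma>" "reg \<sigma> ''i'' = x" "t < x" "x \<le> n" "reg \<sigma> ''s'' = s" "s < kk" "stair s t xs"
    "linked xs (row \<sigma> ''n'' s) (row \<sigma> ''p'' s) (row \<sigma> ''l'' s)" "j0 \<le> length xs"
    "reg \<sigma> ''c'' = c" "c < kk" "arr \<sigma> ''f'' (s * kk + c) = node xs j0"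
  shows "run search_prog \<sigma> (\<lambda>t' \<sigma>'. t' \<le> 50 * gap j0 (rk s xs x) + 200 \<and>
     (\<forall>r. r \<notin> {''p'', ''q''} \<longrightarrow> reg \<sigma>' r = reg \<sigma> r) \<and>
     arr \<sigma>' = (arr \<sigma>)(''f'' := (arr \<sigma> ''f'')(s * kk + c := node xs (rk s xs x)),
       ''w'' := (arr \<sigma> ''w'')(Suc s := succ0 (snd (entry xs (rk s xs x))))))"
proof -
  let ?r = "rk s xs x" and ?j = "min j0 (rk s xs x)"
  have jl: "?j \<le> length xs" "?r \<le> length xs" "?j \<le> ?r" using rk_le[of s xs x] by auto
  have le: "node xs j \<le> n" "succ_node xs j \<le> n" "snd (entry xs j) \<le> n" if "j \<le> length xs" for j
    using node_le[OF assms(7) that] succ_node_le[OF assms(7), of j] snd_entry_le[OF assms(7) that] assms(3,4) by auto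
  have L: "arr \<sigma> ''n'' (s * mm + node xs j) = succ_node xs j" "arr \<sigma> ''l'' (s * mm + node xs j) = snd (entry xs j)"
    if "j \<le> length xs" for j using assms(8) that by (auto simp: linked_def)
  have lt: "node xs j < W" "succ_node xs j < W" "Suc (snd (entry xs j)) < W" "snd (entry xs j) < W"
      "s * mm + node xs j < W" if "j \<le> length xs" for j
    using le[OF that] W row_less[OF assms(6) le(1)[OF that]] by auto
  have sW: "s < W" "Suc s < W" "c < W" "s * mm < W" "s * kk + c < W" "s * kk < W" "mm < W" "kk < W" "Suc 0 < W" "0 < W"
    using bounds(2)[of s] bounds(2)[of c] assms(6,11) row_less(2)[OF assms(6), of 0] finger_less[OF assms(6,11)] bounds by auto
  note ps = params_simps[OF assms(1)]
  have eq: "(reg \<sigma>)(''p'' := a, ''q'' := b, ''q'' := d) = (reg \<sigma>)(''p'' := a, ''q'' := d)" for a b d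
    by (auto simp: fun_eq_iff)
  have fin: "run (Seq (Store ''f'' (finger_at (Reg ''c'')) (Reg ''p'')) (Seq
     (Assign ''q'' (Arr ''l'' (row_at (Reg ''p''))))
     (If (Less (Const 0) (Reg ''q'')) (Store ''w'' (plus1 (Reg ''s'')) (plus1 (Reg ''q'')))
       (Store ''w'' (plus1 (Reg ''s'')) (Const 0)))))
     (\<sigma>\<lparr>reg := (reg \<sigma>)(''p'' := node xs ?r, ''q'' := succ_node xs ?r)\<rparr>)
     (\<lambda>t' \<sigma>'. t' \<le> 40 \<and> (\<forall>r. r \<notin> {''p'', ''q''} \<longrightarrow> reg \<sigma>' r = reg \<sigma> r) \<and>
     arr \<sigma>' = (arr \<sigma>)(''f'' := (arr \<sigma> ''f'')(s * kk + c := node xs ?r),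
       ''w'' := (arr \<sigma> ''w'')(Suc s := succ0 (snd (entry xs ?r)))))"
    using lt[OF jl(2)] sW L[OF jl(2)] assms(5,10) ps by (simp add: wp_simps succ0_def)
  show ?thesis
    unfolding search_prog_def wp_Seq[of _ _ "Assign ''p'' _"] wp_Seq[of _ _ left_loop]
      wp_Seq[of _ _ "Assign ''q'' (Arr ''n'' _)"] wp_Seq[of _ _ right_loop] wp_Assign
  proof (intro conjI, goal_cases)
    case 1
    show ?case using assms(5,10,12) ps sW lt[OF assms(9)] by simp
  next
    case 2
    have av: "aval (Arr ''f'' (finger_at (Reg ''c''))) \<sigma> = node xs j0" using assms(5,10,12) ps by simp
    show ?case
      unfolding av
    proof (rule wp_mono[OF run_left_loop[OF assms(1-9)]], elim conjE, intro conjI, goal_cases)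
      case (1 t1 \<sigma>1)
      then show ?case using assms(5) ps sW lt[OF jl(1)] L[OF jl(1)] by simp
    next
      case (2 t1 \<sigma>1)
      have st: "\<sigma>1\<lparr>reg := (reg \<sigma>1)(''q'' := aval (Arr ''n'' (row_at (Reg ''p''))) \<sigma>1)\<rparr>
          = \<sigma>\<lparr>reg := (reg \<sigma>)(''p'' := node xs ?j, ''q'' := succ_node xs ?j)\<rparr>"
        using 2(1) assms(5) ps L[OF jl(1)] by simp
      show ?case
        unfolding st
      proof (rule wp_mono[OF run_right_loop[OF assms(1-8) jl(3)]], elim conjE, goal_cases)
        case (1 t2 \<sigma>2)
        show ?case
          unfolding 1(1)
          by (rule wp_mono[OF fin]) (use 1(2) 2(2) in \<open>auto simp: gap_def min_def split: if_splits\<close>)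
      qed
    qed
  qed
qed

lemma run_lengths_prog:
  assumes "params \<sigma>" "x \<le> n" "\<And>s. s < kk \<Longrightarrow> arr \<sigma> ''w'' (Suc s) = succ0 (pred_len X s x)"
    "\<And>s. s < kk \<Longrightarrow> succ0 (pred_len X s x) \<le> x" "reg \<sigma> ''x'' = L True" "reg \<sigma> ''y'' = L False"
    "\<And>d. L d \<le> n"
  shows "run lengths_prog \<sigma> (\<lambda>t \<sigma>'. t \<le> 200 \<and>
    (\<forall>r. r \<notin> {''a'', ''b'', ''x'', ''y''} \<longrightarrow> reg \<sigma>' r = reg \<sigma> r) \<and>
    reg \<sigma>' ''x'' = new_best X x L True \<and> reg \<sigma>' ''y'' = new_best X x L False \<and>
    (\<forall>a. a \<noteq> ''w'' \<longrightarrow> arr \<sigma>' a = arr \<sigma> a) \<and> (\<forall>s<kk. arr \<sigma>' ''w'' s = new_len X s x))"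
proof -
  let ?w = "arr \<sigma> ''w''"
  have ix: "k - 2 < kk" "k - 1 < kk" "k + k - 2 < kk" "k + k - 1 < kk" "Suc (k - 2) = k - 1" "Suc (k - 1) = k"
    "Suc (k + k - 2) = kk - 1" "Suc (k + k - 1) = kk" using k3 by (auto simp: kk_def)
  have w: "?w (k - 1) = succ0 (pred_len X (k - 2) x)" "?w k = succ0 (pred_len X (k - 1) x)"
    "?w (kk - 1) = succ0 (pred_len X (k + k - 2) x)" "?w kk = succ0 (pred_len X (k + k - 1) x)"
    using assms(3)[OF ix(1)] assms(3)[OF ix(2)] assms(3)[OF ix(3)] assms(3)[OF ix(4)] unfolding ix by auto
  have F: "full_len X 0 x = max (?w (k - 1)) (?w k)" "full_len X k x = max (?w (kk - 1)) (?w kk)"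
    unfolding full_len_def w by simp_all
  have wl: "?w (k - 1) < W" "?w k < W" "?w (kk - 1) < W" "?w kk < W"
    using assms(4)[OF ix(1)] assms(4)[OF ix(2)] assms(4)[OF ix(3)] assms(4)[OF ix(4)] assms(2) W unfolding w by linarith+
  have Lw: "L d < W" for d using assms(7)[of d] W by simp
  have cW: "k < W" "kk < W" "0 < W" "Suc 0 < W" "1 < W" using bounds by auto
  note ps = params_simps[OF assms(1)]
  let ?a = "full_len X 0 x" and ?b = "full_len X k x"
  have abW: "?a < W" "?b < W" using wl unfolding F by auto
  \<comment> \<open>Both maxima are formed in registers before the first write, since the cells
    \<open>k - 1\<close>, \<open>k\<close> and \<open>kk - 1\<close> are sources as well as
    targets.\<close>
  let ?w' = "?w(k - 1 := ?a, kk - 1 := ?b, 0 := max 1 ?b, k := max 1 ?a)"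
  have new: "?w' s = new_len X s x" if "s < kk" for s
  proof -
    consider "s = 0" | "s = k" | "s = k - 1" "s \<noteq> 0" | "s = kk - 1" "s \<noteq> k" "s \<noteq> k - 1" "s \<noteq> 0"
      | "s \<noteq> 0" "s \<noteq> k" "s \<noteq> k - 1" "s \<noteq> kk - 1" by blast
    then show ?thesis
    proof cases
      case 5
      then have "?w s = succ0 (pred_len X (s - 1) x)" using assms(3)[of "s - 1"] that by simp
      then show ?thesis using 5 by (simp add: new_len_def kk_def)
    qed (use k3 in \<open>auto simp: new_len_def kk_def\<close>)
  qed
  have nb: "new_best X x L True = max (L True) ?a" "new_best X x L False = max (L False) ?b"
    by (simp_all add: new_best_def index_def)
  have dis: "k - 1 \<noteq> kk" "k \<noteq> kk" "kk - 1 \<noteq> kk" "k - 1 \<noteq> k" "kk - 1 \<noteq> k" using k3 by (auto simp: kk_def)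
  have "run lengths_prog \<sigma> (\<lambda>t \<tau>. t \<le> 200 \<and> arr \<tau> = (arr \<sigma>)(''w'' := ?w') \<and>
    reg \<tau> = (reg \<sigma>)(''a'' := ?a, ''b'' := ?b, ''x'' := max (L True) ?a, ''y'' := max (L False) ?b))"
  proof -
    define a b a1 b1 xx yy where d: "a = ?a" "b = ?b" "a1 = max 1 a" "b1 = max 1 b"
      "xx = max (L True) a" "yy = max (L False) b"
    note abs = d[symmetric]
    have m: "max (?w (k - 1)) (?w k) = a" "max (?w (kk - 1)) (?w kk) = b" unfolding d F by (rule refl)+
    note m' = m[unfolded One_nat_def] d(3,4)[symmetric, unfolded One_nat_def]
    show ?thesis
      unfolding abs lengths_prog_def
      apply (insert ps cW abW[folded d] Lw[of True] Lw[of False] dis wl assms(5,6))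
      apply (simp add: wp_Seq wp_Assign wp_max_prog m' cong: wp_cong)
      apply (simp add: wp_Seq wp_Store wp_store_pos m' cong: wp_cong)
      apply (simp add: wp_Seq wp_max_prog cong: wp_cong del: One_nat_def)
      apply (simp add: d(3-6)[symmetric])
      done
  qed
  then show ?thesis
    by (rule wp_mono) (use new nb in auto)
qed

section \<open>Insertion, deletion and finger repair\<close>

lemma run_finger_loop:
  assumes "params \<sigma>" "reg \<sigma> ''i'' = x" "1 \<le> x" "x \<le> n" "reg \<sigma> ''s'' = s" "s < kk" "reg \<sigma> ''w'' = w" "w < W"
    "\<And>g. g < kk \<Longrightarrow> arr \<sigma> ''x'' g = L g \<and> L g \<le> n"
    "\<And>g. g < kk \<Longrightarrow> arr \<sigma> ''f'' (s * kk + g) = F g \<and> F g \<le> n \<and> arr \<sigma> ''l'' (s * mm + F g) < W"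
  shows "run (for_loop ''g'' finger_step) \<sigma> (\<lambda>t \<tau>. t \<le> 150 * kk + 10 \<and>
    (\<forall>r. r \<noteq> ''g'' \<longrightarrow> reg \<tau> r = reg \<sigma> r) \<and> (\<forall>a. a \<noteq> ''f'' \<longrightarrow> arr \<tau> a = arr \<sigma> a) \<and>
    (\<forall>s' g. s' \<noteq> s \<longrightarrow> g < kk \<longrightarrow> arr \<tau> ''f'' (s' * kk + g) = arr \<sigma> ''f'' (s' * kk + g)) \<and>
    (\<forall>g<kk. arr \<tau> ''f'' (s * kk + g) =
      (if L g \<noteq> 0 \<and> lt s x (L g) \<and> arr \<sigma> ''l'' (s * mm + F g) \<le> w then x else F g)))"
proof -
  let ?new = "\<lambda>g. if L g \<noteq> 0 \<and> lt s x (L g) \<and> arr \<sigma> ''l'' (s * mm + F g) \<le> w then x else F g"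
  define I where "I = (\<lambda>j (\<tau> :: state). j \<le> kk \<and> reg \<tau> = (reg \<sigma>)(''g'' := j) \<and> (\<forall>a. a \<noteq> ''f'' \<longrightarrow> arr \<tau> a = arr \<sigma> a) \<and>
    (\<forall>s' g. s' \<noteq> s \<longrightarrow> g < kk \<longrightarrow> arr \<tau> ''f'' (s' * kk + g) = arr \<sigma> ''f'' (s' * kk + g)) \<and>
    (\<forall>g<kk. arr \<tau> ''f'' (s * kk + g) = (if g < j then ?new g else F g)))"
  have step: "run finger_step \<tau> (\<lambda>t \<tau>'. t \<le> 140 \<and> reg \<tau>' ''g'' = j \<and> I (Suc j) (\<tau>'\<lparr>reg := (reg \<tau>')(''g'' := Suc j)\<rparr>))"
    if I: "I j \<tau>" and j: "j < kk" for j \<tau>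
  proof -
    have r: "reg \<tau> = (reg \<sigma>)(''g'' := j)" and a: "\<And>a. a \<noteq> ''f'' \<Longrightarrow> arr \<tau> a = arr \<sigma> a"
      and fo: "\<And>s' g. s' \<noteq> s \<Longrightarrow> g < kk \<Longrightarrow> arr \<tau> ''f'' (s' * kk + g) = arr \<sigma> ''f'' (s' * kk + g)"
      and f: "\<And>g. g < kk \<Longrightarrow> arr \<tau> ''f'' (s * kk + g) = (if g < j then ?new g else F g)"
      using I by (auto simp: I_def)
    have p: "params \<tau>" using assms(1) r by (simp add: params_def)
    note ps = params_simps[OF p]
    have regs: "reg \<tau> ''i'' = x" "reg \<tau> ''s'' = s" "reg \<tau> ''w'' = w" "reg \<tau> ''g'' = j"
      using r assms(2,5,7) by auto
    have fj: "arr \<tau> ''f'' (s * kk + j) = F j" using f[OF j] by simp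
    note xj = assms(9)[OF j] and fj' = assms(10)[OF j]
    have lj: "arr \<tau> ''x'' j = L j" "arr \<tau> ''l'' (s * mm + F j) = arr \<sigma> ''l'' (s * mm + F j)"
      using a xj by auto
    have lw: "x < W" "L j < W" "F j < W" "s < W" "j < W" "mm < W" "kk < W" "s * mm < W" "s * kk < W" "s * mm + F j < W" "s * kk + j < W" "0 < W"
      using bounds bounds(1)[of x] bounds(1)[of "L j"] bounds(1)[of "F j"] bounds(2)[of s] bounds(2)[of j]
        assms(4,6) xj fj' j row_less[OF assms(6), of "F j"] finger_less[OF assms(6) j] by auto
    let ?b = "Conj (Less (Const 0) (Arr ''x'' (Reg ''g'')))
       (Conj (before_b (Reg ''i'') (Arr ''x'' (Reg ''g'')))
         (Neg (Less (Reg ''w'') (Arr ''l'' (row_at (Arr ''f'' (finger_at (Reg ''g''))))))))"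
    have b: "(bval S ?b \<tau> \<longleftrightarrow> L j \<noteq> 0 \<and> lt s x (L j) \<and> arr \<sigma> ''l'' (s * mm + F j) \<le> w) \<and> bfits W S ?b \<tau>"
    proof (cases "L j = 0")
      case True
      then show ?thesis using lw regs lj by simp
    next
      case False
      then show ?thesis
        using before_b[OF p, of "Reg ''i''" "Arr ''x'' (Reg ''g'')"] assms(3,4,6,8) xj fj fj' lw regs lj ps by auto
    qed
    have c: "bcost ?b \<le> 100" by (simp add: bcost_before)
    have upd: "I (Suc j) (\<tau>'\<lparr>reg := (reg \<tau>')(''g'' := Suc j)\<rparr>)"
      if "reg \<tau>' = reg \<tau>" "arr \<tau>' = (arr \<tau>)(''f'' := (arr \<tau> ''f'')(s * kk + j := ?new j))" for \<tau>'
      unfolding I_def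
      using that r a fo f j finger_inj[of _ j _ s] by (auto simp: fun_eq_iff)
    show ?thesis
    proof (cases "bval S ?b \<tau>")
      case True
      then have "L j \<noteq> 0 \<and> lt s x (L j) \<and> arr \<sigma> ''l'' (s * mm + F j) \<le> w" using b by blast
      then have n: "?new j = x" by simp
      show ?thesis
        unfolding finger_step_def wp_If if_P[OF True] wp_Store
        by (rule conjI[OF conjunct2[OF b]])
          (use c regs ps lw upd[of "\<tau>\<lparr>arr := (arr \<tau>)(''f'' := (arr \<tau> ''f'')(s * kk + j := x))\<rparr>", unfolded n] in simp)
    next
      case False
      then have "\<not> (L j \<noteq> 0 \<and> lt s x (L j) \<and> arr \<sigma> ''l'' (s * mm + F j) \<le> w)" using b by blast
      then have n: "?new j = F j" by (simp only: if_False)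
      have same: "(arr \<tau>)(''f'' := (arr \<tau> ''f'')(s * kk + j := F j)) = arr \<tau>" using fj by (auto simp: fun_eq_iff)
      show ?thesis
        unfolding finger_step_def wp_If if_not_P[OF False] wp_Skip
        by (rule conjI[OF conjunct2[OF b]]) (use c regs upd[of \<tau>, unfolded n] same in simp)
    qed
  qed
  have "run (for_loop ''g'' finger_step) \<sigma> (\<lambda>t \<tau>. I kk \<tau> \<and> t \<le> (\<Sum>j<kk. 140 + 10) + 10)"
  proof (rule run_for_loop)
    show "I 0 (\<sigma>\<lparr>reg := (reg \<sigma>)(''g'' := 0)\<rparr>)" using assms(10) by (simp add: I_def)
    show "reg \<tau> ''g'' = j \<and> j \<le> kk \<and> reg \<tau> ''K'' = kk" if "I j \<tau>" for j \<tau>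
      using that params_simps[OF assms(1)] by (simp add: I_def)
  qed (rule step)
  then show ?thesis
    by (rule wp_mono) (auto simp: I_def)
qed

lemma run_drop_loop:
  assumes "params \<sigma>" "reg \<sigma> ''s'' = s" "s < kk" "stair s t xs" "t \<le> n"
    "linked xs (row \<sigma> ''n'' s) (row \<sigma> ''p'' s) (row \<sigma> ''l'' s)" "r \<le> length xs" "reg \<sigma> ''w'' = w" "w < W"
  shows "run drop_loop (\<sigma>\<lparr>reg := (reg \<sigma>)(''q'' := succ_node xs r)\<rparr>)
    (\<lambda>t' \<sigma>'. \<sigma>' = \<sigma>\<lparr>reg := (reg \<sigma>)(''q'' := succ_node xs (kept_from xs r w))\<rparr> \<and>
       t' \<le> 50 * (kept_from xs r w - r) + 50)"
proof -
  let ?e = "kept_from xs r w"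
  let ?b = "Conj (Less (Const 0) (Reg ''q'')) (Neg (Less (Reg ''w'') (Arr ''l'' (row_at (Reg ''q'')))))"
  note K = kept_from[OF assms(4,7), where w = w]
  define I where "I = (\<lambda>j \<tau>. \<tau> = \<sigma>\<lparr>reg := (reg \<sigma>)(''q'' := succ_node xs j)\<rparr> \<and> r \<le> j \<and> j \<le> ?e)"
  have L: "row \<sigma> ''n'' s (succ_node xs j) = succ_node xs (Suc j)" "row \<sigma> ''l'' s (succ_node xs j) = snd (xs ! j)"
    "1 \<le> succ_node xs j" "snd (xs ! j) \<le> n" if "j < length xs" for j
    using assms(6)[unfolded linked_def, rule_format, of "Suc j"] succ_node_Suc[OF that] that
      succ_node_pos[OF assms(4), of j] stair_nth[OF assms(4) that] assms(5) by auto
  have lw: "succ_node xs j \<le> n" "succ_node xs j < W" "s * mm + succ_node xs j < W" for j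
    using succ_node_le[OF assms(4), of j] assms(5) bounds(1)[of "succ_node xs j"]
      row_less[OF assms(3), of "succ_node xs j"] by auto
  have sW: "s < W" "mm < W" "s * mm < W" "0 < W"
    using bounds(2)[of s] assms(3) row_less(2)[OF assms(3), of 0] bounds by auto
  note ps = params_simps[OF assms(1)]
  have cond: "(bval S ?b \<tau> \<longleftrightarrow> j < ?e) \<and> bfits W S ?b \<tau>" if I: "I j \<tau>" for j \<tau>
  proof (cases "j < length xs")
    case True
    then show ?thesis using I L[OF True] lw sW ps assms(2,8,9) K(3)[of j] bounds(1)[of "snd (xs ! j)"]
      by (auto simp: I_def)
  next
    case False
    then show ?thesis using I K(2) lw sW by (auto simp: I_def succ_node_def)
  qed
  have "run drop_loop (\<sigma>\<lparr>reg := (reg \<sigma>)(''q'' := succ_node xs r)\<rparr>)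
    (\<lambda>t \<sigma>'. \<exists>j'. I j' \<sigma>' \<and> \<not> bval S ?b \<sigma>' \<and> t + 50 * (?e - j') \<le> 50 * (?e - r) + 1 + bcost ?b)"
    unfolding drop_loop_def
  proof (rule wp_While[where I = I and j = r])
    fix j \<tau> assume I: "I j \<tau>" and b: "bval S ?b \<tau>"
    have j: "j < ?e" "j < length xs" using cond[OF I] b K(2) by auto
    have \<tau>: "\<tau> = \<sigma>\<lparr>reg := (reg \<sigma>)(''q'' := succ_node xs j)\<rparr>" using I by (simp add: I_def)
    have I': "I (Suc j) (\<sigma>\<lparr>reg := (reg \<sigma>)(''q'' := succ_node xs (Suc j))\<rparr>)" using I j by (simp add: I_def)
    show "run (Assign ''q'' (Arr ''n'' (row_at (Reg ''q'')))) \<tau>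
        (\<lambda>t \<sigma>'. \<exists>j'. I j' \<sigma>' \<and> t + 1 + bcost ?b + 50 * (?e - j') \<le> 50 * (?e - j))"
      unfolding wp_Assign using \<tau> I' L[OF j(2)] lw[of j] lw[of "Suc j"] sW ps assms(2) j
      by (auto intro!: exI[of _ "Suc j"])
  qed (use cond K(1) in \<open>auto simp: I_def\<close>)
  then show ?thesis
  proof (rule wp_mono)
    fix t' \<sigma>' assume "\<exists>j'. I j' \<sigma>' \<and> \<not> bval S ?b \<sigma>' \<and> t' + 50 * (?e - j') \<le> 50 * (?e - r) + 1 + bcost ?b"
    then obtain j where j: "I j \<sigma>'" "\<not> bval S ?b \<sigma>'" "t' + 50 * (?e - j) \<le> 50 * (?e - r) + 1 + bcost ?b" by blast
    have "\<not> j < ?e" using cond[OF j(1)] j(2) by blast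
    then have "j = ?e" using j(1) by (simp add: I_def)
    then show "\<sigma>' = \<sigma>\<lparr>reg := (reg \<sigma>)(''q'' := succ_node xs ?e)\<rparr> \<and> t' \<le> 50 * (?e - r) + 50"
      using j(1,3) by (simp add: I_def)
  qed
qed

lemma run_link_prog:
  assumes "params \<sigma>" "reg \<sigma> ''s'' = s" "s < kk" "reg \<sigma> ''p'' = p" "reg \<sigma> ''q'' = q" "reg \<sigma> ''i'' = x" "reg \<sigma> ''w'' = w"
    "p \<le> n" "q \<le> n" "x \<le> n" "w < W"
  shows "run link_prog \<sigma> (\<lambda>t' \<sigma>'. t' \<le> 100 \<and> reg \<sigma>' = reg \<sigma> \<and>
    arr \<sigma>' = (arr \<sigma>)(''n'' := (arr \<sigma> ''n'')(s * mm + p := x, s * mm + x := q),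
      ''p'' := (arr \<sigma> ''p'')(s * mm + x := p, s * mm + q := x), ''l'' := (arr \<sigma> ''l'')(s * mm + x := w)))"
proof -
  have lw: "s < W" "mm < W" "s * mm < W" "p < W" "q < W" "x < W" "s * mm + p < W" "s * mm + q < W" "s * mm + x < W"
    using bounds(2)[of s] bounds assms(3) row_less[OF assms(3)] assms(8-10) by auto
  show ?thesis
    unfolding link_prog_def
    using lw params_simps[OF assms(1)] assms(2,4-7,11)
    by (simp add: wp_Seq wp_Store cong: wp_cong)
qed

text \<open>The conjuncts about \<open>s' \<noteq> s\<close> are frame conditions that allow the
  loop over all staircases. The deletion loop visits just the removed entries, so its time is
  charged to the amount by which the list stays below \<open>Suc (length xs)\<close>.\<close>

lemma run_insert_prog:
  assumes "params \<sigma>" "reg \<sigma> ''i'' = x" "x = Suc t" "x \<le> n" "reg \<sigma> ''s'' = s" "s < kk"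
    "reg \<sigma> ''c'' = c" "c < kk" "stair s t xs"
    "linked xs (row \<sigma> ''n'' s) (row \<sigma> ''p'' s) (row \<sigma> ''l'' s)"
    "arr \<sigma> ''w'' s = w" "w \<le> x" "L c = x"
    "\<And>g. g < kk \<Longrightarrow> arr \<sigma> ''x'' g = L g \<and> L g \<le> x"
    "\<And>g. g < kk \<Longrightarrow> arr \<sigma> ''f'' (s * kk + g) = node xs (if L g = 0 then 0 else rk s xs (L g))"
  shows "run insert_prog \<sigma> (\<lambda>t' \<tau>.
    t' \<le> 60 * (Suc (length xs) - length (ins s xs x w)) + 150 * kk + 400 \<and>
    (\<forall>r. r \<notin> {''p'', ''q'', ''w'', ''g''} \<longrightarrow> reg \<tau> r = reg \<sigma> r) \<and>
    (\<forall>a. a \<notin> {''n'', ''p'', ''l'', ''f''} \<longrightarrow> arr \<tau> a = arr \<sigma> a) \<and>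
    (\<forall>a s' q. a \<noteq> ''f'' \<longrightarrow> s' \<noteq> s \<longrightarrow> q \<le> n \<longrightarrow> arr \<tau> a (s' * mm + q) = arr \<sigma> a (s' * mm + q)) \<and>
    (\<forall>s' g. s' \<noteq> s \<longrightarrow> g < kk \<longrightarrow> arr \<tau> ''f'' (s' * kk + g) = arr \<sigma> ''f'' (s' * kk + g)) \<and>
    linked (ins s xs x w) (row \<tau> ''n'' s) (row \<tau> ''p'' s) (row \<tau> ''l'' s) \<and>
    (\<forall>g<kk. arr \<tau> ''f'' (s * kk + g) =
      node (ins s xs x w) (if L g = 0 then 0 else rk s (ins s xs x w) (L g))))"
proof -
  let ?r = "rk s xs x" and ?zs = "ins s xs x w"
  let ?p = "node xs ?r" and ?e = "kept_from xs ?r w"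
  let ?F = "\<lambda>g. node xs (if L g = 0 then 0 else rk s xs (L g))"
  have r: "?r \<le> length xs" by (rule rk_le)
  note K = kept_from[OF assms(9) r, where w = w]
  have tn: "t \<le> n" "t < x" "1 \<le> x" using assms(3,4) by auto
  have le: "node xs j \<le> t" "succ_node xs i \<le> t" "snd (entry xs j) \<le> t" if "j \<le> length xs" for i j
    using node_le[OF assms(9) that] succ_node_le[OF assms(9), of i] snd_entry_le[OF assms(9) that] by auto
  have lens: "arr \<sigma> ''l'' (s * mm + node xs j) = snd (entry xs j)" "arr \<sigma> ''n'' (s * mm + node xs j) = succ_node xs j"
    if "j \<le> length xs" for j using assms(10) that by (auto simp: linked_def)
  have pW: "?p < W" "?p \<le> n" "s * mm + ?p < W" "snd (entry xs ?r) < W" "succ_node xs ?r < W"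
    using le(1,3)[OF r] le(2)[OF r, of ?r] tn bounds(1)[of ?p] bounds(1)[of "snd (entry xs ?r)"] bounds(1)[of "succ_node xs ?r"]
      row_less[OF assms(6), of ?p] by auto
  have lw: "w < W" "s < W" "c < W" "mm < W" "kk < W" "s * mm < W" "s * kk < W" "s * kk + c < W"
    using bounds(1)[of w] bounds(2)[of s] bounds(2)[of c] assms(4,6,8,12) bounds finger_less[OF assms(6,8)]
      row_less(2)[OF assms(6), of 0] by auto
  note ps = params_simps[OF assms(1)]
  \<comment> \<open>Since \<open>L c = x\<close> already holds, the finger of this class is the
    predecessor of \<open>x\<close>, where the search left it.\<close>
  have fc: "arr \<sigma> ''f'' (s * kk + c) = ?p" using assms(13) assms(15)[OF assms(8)] tn by simp
  let ?s1 = "\<sigma>\<lparr>reg := (reg \<sigma>)(''p'' := ?p, ''w'' := w)\<rparr>"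
  let ?b = "Less (Arr ''l'' (row_at (Reg ''p''))) (Reg ''w'')"
  let ?ins = "Seq (Assign ''q'' (Arr ''n'' (row_at (Reg ''p'')))) (Seq drop_loop
         (Seq link_prog (for_loop ''g'' finger_step)))"
  let ?post = "\<lambda>\<tau>. (\<forall>r. r \<notin> {''p'', ''q'', ''w'', ''g''} \<longrightarrow> reg \<tau> r = reg \<sigma> r) \<and>
    (\<forall>a. a \<notin> {''n'', ''p'', ''l'', ''f''} \<longrightarrow> arr \<tau> a = arr \<sigma> a) \<and>
    (\<forall>a s' q. a \<noteq> ''f'' \<longrightarrow> s' \<noteq> s \<longrightarrow> q \<le> n \<longrightarrow> arr \<tau> a (s' * mm + q) = arr \<sigma> a (s' * mm + q)) \<and>
    (\<forall>s' g. s' \<noteq> s \<longrightarrow> g < kk \<longrightarrow> arr \<tau> ''f'' (s' * kk + g) = arr \<sigma> ''f'' (s' * kk + g)) \<and>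
    linked ?zs (row \<tau> ''n'' s) (row \<tau> ''p'' s) (row \<tau> ''l'' s) \<and>
    (\<forall>g<kk. arr \<tau> ''f'' (s * kk + g) = node ?zs (if L g = 0 then 0 else rk s ?zs (L g)))"
  have b: "(bval S ?b ?s1 \<longleftrightarrow> snd (entry xs ?r) < w) \<and> bfits W S ?b ?s1 \<and> bcost ?b \<le> 20"
    using lens[OF r] pW lw ps assms(5) by simp
  have body: "run (If ?b ?ins Skip) ?s1 (\<lambda>t' \<tau>. t' \<le> 60 * (Suc (length xs) - length ?zs) + 150 * kk + 350 \<and> ?post \<tau>)"
  proof (cases "snd (entry xs ?r) < w")
    case False
    then have zs: "?zs = xs" by (simp add: ins_def)
    have "?post ?s1" unfolding zs using assms(10,15) by simp
    then show ?thesis unfolding wp_If wp_Skip using b False by simp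
  next
    case True
    have zs: "?zs = take ?r xs @ (x, w) # drop ?e xs" using True K(4) by (simp add: ins_def Let_def)
    have len: "Suc (length xs) - length ?zs = ?e - ?r" using zs K(1,2) r by simp
    let ?q = "succ_node xs ?e"
    let ?s3 = "?s1\<lparr>reg := (reg ?s1)(''q'' := ?q)\<rparr>"
    let ?arr = "(arr \<sigma>)(''n'' := (arr \<sigma> ''n'')(s * mm + ?p := x, s * mm + x := ?q),
      ''p'' := (arr \<sigma> ''p'')(s * mm + x := ?p, s * mm + ?q := x), ''l'' := (arr \<sigma> ''l'')(s * mm + x := w))"
    have q: "?q \<le> n" "?q \<le> t" using le(2)[OF r, of ?e] tn by auto
    have av: "aval (Arr ''n'' (row_at (Reg ''p''))) ?s1 = succ_node xs ?r" "afits W (Arr ''n'' (row_at (Reg ''p''))) ?s1"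
      using lens[OF r] pW lw ps assms(5) by auto
    have F: "?F g \<le> t" "arr \<sigma> ''l'' (s * mm + ?F g) = snd (entry xs (if L g = 0 then 0 else rk s xs (L g)))"
      "snd (entry xs (if L g = 0 then 0 else rk s xs (L g))) \<le> t" for g
      using le(1,3)[of "if L g = 0 then 0 else rk s xs (L g)"] lens[of "if L g = 0 then 0 else rk s xs (L g)"] rk_le[of s xs "L g"]
      by auto
    have ins: "run ?ins ?s1 (\<lambda>t' \<tau>. t' \<le> 50 * (?e - ?r) + 150 * kk + 250 \<and> ?post \<tau>)"
      unfolding wp_Seq wp_Assign
    proof (intro conjI, goal_cases)
      case 1
      show ?case by (rule av)
    next
      case 2
      have p1: "params ?s1" "reg ?s1 ''s'' = s" "reg ?s1 ''w'' = w"
        "linked xs (row ?s1 ''n'' s) (row ?s1 ''p'' s) (row ?s1 ''l'' s)"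
        using assms(1,5,10) by (auto simp: params_def)
      show ?case
        unfolding av
      proof (rule wp_mono[OF run_drop_loop[OF p1(1,2) assms(6,9) tn(1) p1(4) r p1(3) lw(1)]], elim conjE, goal_cases)
        case (1 t2 \<sigma>2)
        have p2: "params \<sigma>2" "reg \<sigma>2 ''s'' = s" "reg \<sigma>2 ''p'' = ?p" "reg \<sigma>2 ''q'' = ?q" "reg \<sigma>2 ''i'' = x" "reg \<sigma>2 ''w'' = w"
          "arr \<sigma>2 = arr \<sigma>"
          using 1(1) assms(1,2,5) by (auto simp: params_def)
        show ?case
        proof (rule wp_mono[OF run_link_prog[OF p2(1,2) assms(6) p2(3-6) pW(2) q(1) assms(4) lw(1)]], elim conjE, goal_cases)
          case (1 t3 \<sigma>3)
          have a3: "arr \<sigma>3 = ?arr" using 1(3) p2(7) by simp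
          have p3: "params \<sigma>3" "reg \<sigma>3 ''s'' = s" "reg \<sigma>3 ''i'' = x" "reg \<sigma>3 ''w'' = w"
            using 1(2) p2 by (auto simp: params_def)
          have row3: "row \<sigma>3 ''l'' s j = (if j = x then w else arr \<sigma> ''l'' (s * mm + j))" if "j \<le> n" for j
            unfolding a3 using row_inj[OF that assms(4)] by simp
          \<comment> \<open>The repair reads old lengths: linking writes a length only at
            \<open>x\<close>, and every finger still points to an older element.\<close>
          have l3: "arr \<sigma>3 ''l'' (s * mm + ?F g) = snd (entry xs (if L g = 0 then 0 else rk s xs (L g)))" for g
            using row3[of "?F g"] F[of g] tn by auto
          have pre: "arr \<sigma>3 ''x'' g = L g \<and> L g \<le> n"
            "arr \<sigma>3 ''f'' (s * kk + g) = ?F g \<and> ?F g \<le> n \<and> arr \<sigma>3 ''l'' (s * mm + ?F g) < W" if "g < kk" for g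
            using assms(14)[OF that] assms(15)[OF that] assms(4) F[of g] tn(1) l3[of g]
              bounds(1)[of "snd (entry xs (if L g = 0 then 0 else rk s xs (L g)))"]
            by (auto simp: a3)
          have lk: "linked ?zs (row \<sigma>3 ''n'' s) (row \<sigma>3 ''p'' s) (row \<sigma>3 ''l'' s)"
            unfolding zs
          proof (rule linked_insert[OF assms(9,10) K(1,2) tn(2)])
            fix j assume "j \<le> x"
            then have j: "j \<le> n" using assms(4) by simp
            show "row \<sigma>3 ''n'' s j = ((row \<sigma> ''n'' s)(?p := x, x := ?q)) j"
              unfolding a3 using row_inj[OF j assms(4)] row_inj[OF j pW(2)] by simp
            show "row \<sigma>3 ''p'' s j = ((row \<sigma> ''p'' s)(x := ?p, ?q := x)) j"
              unfolding a3 using row_inj[OF j assms(4)] row_inj[OF j q(1)] by simp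
            show "row \<sigma>3 ''l'' s j = ((row \<sigma> ''l'' s)(x := w)) j"
              using row3[OF j] by simp
          qed
          have fr: "arr \<sigma>3 a (s' * mm + j) = arr \<sigma> a (s' * mm + j)" if "s' \<noteq> s" "j \<le> n" for a s' j
            unfolding a3 using that row_inj[OF that(2) assms(4)] row_inj[OF that(2) pW(2)] row_inj[OF that(2) q(1)] by simp
          have fing: "(if L g \<noteq> 0 \<and> lt s x (L g) \<and> arr \<sigma>3 ''l'' (s * mm + ?F g) \<le> w then x else ?F g) =
              node ?zs (if L g = 0 then 0 else rk s ?zs (L g))" if "g < kk" for g
          proof (cases "L g = 0")
            case False
            then show ?thesis
              using node_rk_ins[OF assms(9,3,4,12) True, of "L g"] assms(14)[OF that] l3[of g] by simp
          qed simp
          show ?case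
          proof (rule wp_mono[OF run_finger_loop[OF p3(1,3) tn(3) assms(4) p3(2) assms(6) p3(4) lw(1) pre]], assumption, assumption,
              elim conjE, goal_cases)
            case (1 t4 \<tau>)
            have rows: "row \<tau> ''n'' s = row \<sigma>3 ''n'' s" "row \<tau> ''p'' s = row \<sigma>3 ''p'' s" "row \<tau> ''l'' s = row \<sigma>3 ''l'' s"
              using 1(3) by auto
            have post: "?post \<tau>"
            proof (intro conjI)
              show "\<forall>r. r \<notin> {''p'', ''q'', ''w'', ''g''} \<longrightarrow> reg \<tau> r = reg \<sigma> r"
                using 1(2) \<open>reg \<sigma>3 = reg \<sigma>2\<close> \<open>\<sigma>2 = _\<close> by simp
              show "\<forall>a. a \<notin> {''n'', ''p'', ''l'', ''f''} \<longrightarrow> arr \<tau> a = arr \<sigma> a"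
                using 1(3) a3 by simp
              show "\<forall>a s' q. a \<noteq> ''f'' \<longrightarrow> s' \<noteq> s \<longrightarrow> q \<le> n \<longrightarrow> arr \<tau> a (s' * mm + q) = arr \<sigma> a (s' * mm + q)"
                using 1(3) fr by simp
              show "\<forall>s' g. s' \<noteq> s \<longrightarrow> g < kk \<longrightarrow> arr \<tau> ''f'' (s' * kk + g) = arr \<sigma> ''f'' (s' * kk + g)"
                using 1(4) a3 by simp
              show "linked ?zs (row \<tau> ''n'' s) (row \<tau> ''p'' s) (row \<tau> ''l'' s)"
                unfolding rows by (rule lk)
              show "\<forall>g<kk. arr \<tau> ''f'' (s * kk + g) = node ?zs (if L g = 0 then 0 else rk s ?zs (L g))"
                using 1(5) fing by simp
            qed
            show ?case
              by (rule conjI[OF _ post]) (use 1(1) \<open>t3 \<le> 100\<close> \<open>t2 \<le> _\<close> in simp)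
          qed
        qed
      qed
    qed
    have bt: "bval S ?b ?s1" using b True by blast
    show ?thesis
      unfolding wp_If if_P[OF bt]
    proof (rule conjI)
      show "bfits W S ?b ?s1" using b by blast
      show "run ?ins ?s1 (\<lambda>t' \<tau>. 1 + bcost ?b + t' \<le> 60 * (Suc (length xs) - length ?zs) + 150 * kk + 350 \<and> ?post \<tau>)"
      proof (rule wp_mono[OF ins], erule conjE, rule conjI)
        fix t' \<tau> assume "t' \<le> 50 * (?e - ?r) + 150 * kk + 250"
        moreover have "bcost ?b \<le> 20" using b by blast
        ultimately show "1 + bcost ?b + t' \<le> 60 * (Suc (length xs) - length ?zs) + 150 * kk + 350"
          unfolding len by linarith
      qed assumption
    qed
  qed
  show ?thesis
    unfolding insert_prog_def wp_Seq wp_Assign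
  proof (intro conjI, goal_cases)
    case 1
    show ?case using lw pW fc assms(5,7) ps by simp
  next
    case 2
    show ?case using lw assms(5,11) by simp
  next
    case 3
    have st: "\<sigma>\<lparr>reg := (reg \<sigma>)(''p'' := aval (Arr ''f'' (finger_at (Reg ''c''))) \<sigma>)\<rparr>
      \<lparr>reg := (reg (\<sigma>\<lparr>reg := (reg \<sigma>)(''p'' := aval (Arr ''f'' (finger_at (Reg ''c''))) \<sigma>)\<rparr>))
        (''w'' := aval (Arr ''w'' (Reg ''s'')) (\<sigma>\<lparr>reg := (reg \<sigma>)(''p'' := aval (Arr ''f'' (finger_at (Reg ''c''))) \<sigma>)\<rparr>))\<rparr> = ?s1"
      using fc assms(5,7,11) ps by simp
    show ?case
      unfolding st by (rule wp_mono[OF body]) auto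
  qed
qed

lemma takeWhile_test:
  assumes "j \<le> length (takeWhile P xs)"
  shows "j < length xs \<and> P (xs ! j) \<longleftrightarrow> j < length (takeWhile P xs)"
  using assms nth_length_takeWhile[of P xs] length_takeWhile_le[of P xs]
  by (metis le_neq_implies_less less_le_trans nth_mem set_takeWhileD takeWhile_nth)

lemma run_prune_prog:
  assumes "params \<sigma>" "reg \<sigma> ''s'' = s" "s < kk" "stair s t xs" "t \<le> n"
    "linked xs (row \<sigma> ''n'' s) (row \<sigma> ''p'' s) (row \<sigma> ''l'' s)" "reg \<sigma> ''l'' = m" "m \<le> n"
  shows "run prune_prog \<sigma> (\<lambda>t' \<tau>.
    t' \<le> 60 * (length xs - length (prune m xs)) + 50 * kk + 200 \<and>
    (\<forall>r. r \<notin> {''p'', ''g''} \<longrightarrow> reg \<tau> r = reg \<sigma> r) \<and>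
    (\<forall>a. a \<notin> {''n'', ''p'', ''f''} \<longrightarrow> arr \<tau> a = arr \<sigma> a) \<and>
    (\<forall>a s' q. a \<noteq> ''f'' \<longrightarrow> s' \<noteq> s \<longrightarrow> q \<le> n \<longrightarrow> arr \<tau> a (s' * mm + q) = arr \<sigma> a (s' * mm + q)) \<and>
    (\<forall>s' g. s' \<noteq> s \<longrightarrow> g < kk \<longrightarrow> arr \<tau> ''f'' (s' * kk + g) = arr \<sigma> ''f'' (s' * kk + g)) \<and>
    linked (prune m xs) (row \<tau> ''n'' s) (row \<tau> ''p'' s) (row \<tau> ''l'' s) \<and>
    (\<forall>g<kk. arr \<tau> ''f'' (s * kk + g) = 0))"
proof -
  let ?P = "\<lambda>e. snd e + k \<le> m"
  let ?e = "length (takeWhile ?P xs)"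
  have zs: "prune m xs = drop ?e xs" by (simp add: prune_def dropWhile_eq_drop)
  have e: "?e \<le> length xs" by (rule length_takeWhile_le)
  have len: "length xs - length (prune m xs) = ?e" using zs e by simp
  note ps = params_simps[OF assms(1)]
  have sW: "s < W" "mm < W" "s * mm < W" "0 < W" "kk < W" "s * kk < W" "m < W" "k < W"
    using bounds(2)[of s] assms(3,8) row_less(2)[OF assms(3), of 0] finger_less(2)[OF assms(3), of s] bounds bounds(1)[of m] by auto
  have lw: "succ_node xs j \<le> n" "succ_node xs j < W" "s * mm + succ_node xs j < W" for j
    using succ_node_le[OF assms(4), of j] assms(5) bounds(1)[of "succ_node xs j"]
      row_less[OF assms(3), of "succ_node xs j"] by auto
  have L: "row \<sigma> ''n'' s (succ_node xs j) = succ_node xs (Suc j)" "row \<sigma> ''l'' s (succ_node xs j) = snd (xs ! j)"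
    "1 \<le> succ_node xs j" "snd (xs ! j) \<le> n" if "j < length xs" for j
    using assms(6)[unfolded linked_def, rule_format, of "Suc j"] succ_node_Suc[OF that] that
      succ_node_pos[OF assms(4), of j] stair_nth[OF assms(4) that] assms(5) by auto
  let ?b = "Conj (Less (Const 0) (Reg ''p'')) (Neg (Less (Reg ''l'') (Plus (Arr ''l'' (row_at (Reg ''p''))) (Reg ''k''))))"
  define I where "I = (\<lambda>j (\<tau> :: state). \<tau> = \<sigma>\<lparr>reg := (reg \<sigma>)(''p'' := succ_node xs j)\<rparr> \<and> j \<le> ?e)"
  have cond: "(bval S ?b \<tau> \<longleftrightarrow> j < ?e) \<and> bfits W S ?b \<tau>" if I: "I j \<tau>" for j \<tau>
  proof (cases "j < length xs")
    case True
    have "j < ?e \<longleftrightarrow> snd (xs ! j) + k \<le> m" using takeWhile_test[of j ?P xs] I True by (simp add: I_def)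
    then show ?thesis using I L[OF True] lw sW ps assms(2,7,8) bounds(1)[of "snd (xs ! j)"] bounds(3)[of "snd (xs ! j)"]
      by (auto simp: I_def)
  next
    case False
    then show ?thesis using I e lw sW by (auto simp: I_def succ_node_def)
  qed
  have loop: "run prune_loop (\<sigma>\<lparr>reg := (reg \<sigma>)(''p'' := succ_node xs 0)\<rparr>)
    (\<lambda>t \<sigma>'. \<sigma>' = \<sigma>\<lparr>reg := (reg \<sigma>)(''p'' := succ_node xs ?e)\<rparr> \<and> t \<le> 50 * ?e + 50)"
  proof -
    have "run prune_loop (\<sigma>\<lparr>reg := (reg \<sigma>)(''p'' := succ_node xs 0)\<rparr>)
      (\<lambda>t \<sigma>'. \<exists>j'. I j' \<sigma>' \<and> \<not> bval S ?b \<sigma>' \<and> t + 50 * (?e - j') \<le> 50 * (?e - 0) + 1 + bcost ?b)"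
      unfolding prune_loop_def
    proof (rule wp_While[where I = I and j = 0])
      fix j \<tau> assume I: "I j \<tau>" and b: "bval S ?b \<tau>"
      have j: "j < ?e" "j < length xs" using cond[OF I] b e by auto
      have \<tau>: "\<tau> = \<sigma>\<lparr>reg := (reg \<sigma>)(''p'' := succ_node xs j)\<rparr>" using I by (simp add: I_def)
      have I': "I (Suc j) (\<sigma>\<lparr>reg := (reg \<sigma>)(''p'' := succ_node xs (Suc j))\<rparr>)" using I j by (simp add: I_def)
      show "run (Assign ''p'' (Arr ''n'' (row_at (Reg ''p'')))) \<tau>
          (\<lambda>t \<sigma>'. \<exists>j'. I j' \<sigma>' \<and> t + 1 + bcost ?b + 50 * (?e - j') \<le> 50 * (?e - j))"
        unfolding wp_Assign using \<tau> I' L[OF j(2)] lw[of j] lw[of "Suc j"] sW ps assms(2) j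
        by (auto intro!: exI[of _ "Suc j"])
    qed (use cond in \<open>auto simp: I_def\<close>)
    then show ?thesis
    proof (rule wp_mono)
      fix t' \<sigma>' assume "\<exists>j'. I j' \<sigma>' \<and> \<not> bval S ?b \<sigma>' \<and> t' + 50 * (?e - j') \<le> 50 * (?e - 0) + 1 + bcost ?b"
      then obtain j where j: "I j \<sigma>'" "\<not> bval S ?b \<sigma>'" "t' + 50 * (?e - j) \<le> 50 * (?e - 0) + 1 + bcost ?b" by blast
      have "\<not> j < ?e" using cond[OF j(1)] j(2) by blast
      then have "j = ?e" using j(1) by (simp add: I_def)
      then show "\<sigma>' = \<sigma>\<lparr>reg := (reg \<sigma>)(''p'' := succ_node xs ?e)\<rparr> \<and> t' \<le> 50 * ?e + 50"
        using j(1,3) by (simp add: I_def)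
    qed
  qed
  \<comment> \<open>If the whole list is cut, this is 0, and the two stores link the head node to
    itself.\<close>
  let ?q = "succ_node xs ?e"
  let ?arr = "(arr \<sigma>)(''n'' := (arr \<sigma> ''n'')(s * mm := ?q), ''p'' := (arr \<sigma> ''p'')(s * mm + ?q := 0))"
  let ?s2 = "\<sigma>\<lparr>reg := (reg \<sigma>)(''p'' := ?q), arr := ?arr\<rparr>"
  let ?post = "\<lambda>\<tau>. (\<forall>r. r \<notin> {''p'', ''g''} \<longrightarrow> reg \<tau> r = reg \<sigma> r) \<and>
    (\<forall>a. a \<notin> {''n'', ''p'', ''f''} \<longrightarrow> arr \<tau> a = arr \<sigma> a) \<and>
    (\<forall>a s' q. a \<noteq> ''f'' \<longrightarrow> s' \<noteq> s \<longrightarrow> q \<le> n \<longrightarrow> arr \<tau> a (s' * mm + q) = arr \<sigma> a (s' * mm + q)) \<and>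
    (\<forall>s' g. s' \<noteq> s \<longrightarrow> g < kk \<longrightarrow> arr \<tau> ''f'' (s' * kk + g) = arr \<sigma> ''f'' (s' * kk + g)) \<and>
    linked (prune m xs) (row \<tau> ''n'' s) (row \<tau> ''p'' s) (row \<tau> ''l'' s) \<and>
    (\<forall>g<kk. arr \<tau> ''f'' (s * kk + g) = 0)"
  define J where "J = (\<lambda>j (\<tau> :: state). j \<le> kk \<and> reg \<tau> = (reg \<sigma>)(''p'' := ?q, ''g'' := j) \<and>
    (\<forall>a. a \<noteq> ''f'' \<longrightarrow> arr \<tau> a = ?arr a) \<and>
    (\<forall>s' g. s' \<noteq> s \<longrightarrow> g < kk \<longrightarrow> arr \<tau> ''f'' (s' * kk + g) = arr \<sigma> ''f'' (s' * kk + g)) \<and>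
    (\<forall>g<j. arr \<tau> ''f'' (s * kk + g) = 0))"
  have clear: "run (for_loop ''g'' (Store ''f'' (finger_at (Reg ''g'')) (Const 0))) ?s2
    (\<lambda>t \<tau>. J kk \<tau> \<and> t \<le> (\<Sum>j<kk. 10 + 10) + 10)"
  proof (rule run_for_loop)
    show "J 0 (?s2\<lparr>reg := (reg ?s2)(''g'' := 0)\<rparr>)" by (simp add: J_def)
    show "reg \<tau> ''g'' = j \<and> j \<le> kk \<and> reg \<tau> ''K'' = kk" if "J j \<tau>" for j \<tau>
      using that ps by (simp add: J_def)
    fix j \<tau> assume J: "J j \<tau>" and j: "j < kk"
    have jW: "s * kk + j < W" "j < W" using finger_less[OF assms(3) j] bounds(2)[of j] j by auto
    show "run (Store ''f'' (finger_at (Reg ''g'')) (Const 0)) \<tau> (\<lambda>t \<tau>'. t \<le> 10 \<and> reg \<tau>' ''g'' = j \<and>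
        J (Suc j) (\<tau>'\<lparr>reg := (reg \<tau>')(''g'' := Suc j)\<rparr>))"
      unfolding wp_Store using J j jW sW ps assms(2) finger_inj[of _ j _ s]
      by (auto simp: J_def less_Suc_eq)
  qed
  have nodes: "row \<sigma> ''n'' s 0 = succ_node xs 0"
    using assms(6)[unfolded linked_def, rule_format, of 0] by simp
  have fin: "?post \<tau>" if J: "J kk \<tau>" for \<tau>
  proof -
    have r: "reg \<tau> = (reg \<sigma>)(''p'' := ?q, ''g'' := kk)" and a: "\<And>a. a \<noteq> ''f'' \<Longrightarrow> arr \<tau> a = ?arr a"
      and f: "\<And>s' g. s' \<noteq> s \<Longrightarrow> g < kk \<Longrightarrow> arr \<tau> ''f'' (s' * kk + g) = arr \<sigma> ''f'' (s' * kk + g)"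
      "\<And>g. g < kk \<Longrightarrow> arr \<tau> ''f'' (s * kk + g) = 0"
      using J by (auto simp: J_def)
    show ?thesis
    proof (intro conjI)
      show "\<forall>a s' q. a \<noteq> ''f'' \<longrightarrow> s' \<noteq> s \<longrightarrow> q \<le> n \<longrightarrow> arr \<tau> a (s' * mm + q) = arr \<sigma> a (s' * mm + q)"
        using a row_inj[of _ 0 _ s] row_inj[of _ ?q _ s] lw[of ?e] by auto
      show "linked (prune m xs) (row \<tau> ''n'' s) (row \<tau> ''p'' s) (row \<tau> ''l'' s)"
        unfolding zs
      proof (rule linked_drop[OF assms(4,6) e])
        fix j assume "j \<le> t"
        then have j: "j \<le> n" using assms(5) by simp
        show "row \<tau> ''n'' s j = ((row \<sigma> ''n'' s)(0 := ?q)) j" using a row_inj[OF j, of 0 s s] by simp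
        show "row \<tau> ''p'' s j = ((row \<sigma> ''p'' s)(?q := 0)) j" using a row_inj[OF j lw(1)[of ?e], of s s] by simp
        show "row \<tau> ''l'' s j = row \<sigma> ''l'' s j" using a by simp
      qed
    qed (use r a f in auto)
  qed
  show ?thesis
    unfolding prune_prog_def wp_Seq[of _ _ "Assign _ _"] wp_Assign wp_Seq[of _ _ prune_loop]
  proof (intro conjI, goal_cases)
    case 1
    show ?case using nodes lw[of 0] sW ps assms(2) by simp
  next
    case 2
    have av: "aval (Arr ''n'' (row_at (Const 0))) \<sigma> = succ_node xs 0" using nodes ps assms(2) by simp
    show ?case
      unfolding av
    proof (rule wp_mono[OF loop], elim conjE, goal_cases)
      case (1 t2 \<sigma>2)
      have cl: "run (for_loop ''g'' (Store ''f'' (finger_at (Reg ''g'')) (Const 0))) ?s2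
        (\<lambda>t \<tau>. t \<le> 20 * kk + 10 \<and> ?post \<tau>)"
      proof (rule wp_mono[OF clear], elim conjE, intro conjI[OF _ fin])
        fix t \<tau> assume "t \<le> (\<Sum>j<kk. 10 + 10) + (10::nat)"
        then show "t \<le> 20 * kk + 10" by simp
      qed
      let ?s3 = "\<sigma>2\<lparr>arr := (arr \<sigma>2)(''n'' := (arr \<sigma>2 ''n'')(s * mm := ?q))\<rparr>"
      have e1: "aval (row_at (Const 0)) \<sigma>2 = s * mm" "aval (Reg ''p'') \<sigma>2 = ?q"
        using 1(1) ps assms(2) by auto
      have e2: "aval (row_at (Reg ''p'')) ?s3 = s * mm + ?q" "aval (Const 0) ?s3 = 0" using 1(1) ps assms(2) by auto
      have st: "?s3\<lparr>arr := (arr ?s3)(''p'' := (arr ?s3 ''p'')(s * mm + ?q := 0))\<rparr> = ?s2"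
        using 1(1) by simp
      show ?case
        unfolding wp_Seq wp_Store len e1 e2 st
      proof (intro conjI, goal_cases)
        case 5
        show ?case
        proof (rule wp_mono[OF cl], erule conjE, rule conjI)
          fix t' \<tau> assume t: "t' \<le> 20 * kk + 10"
          show "1 + (1 + acost (Arr ''n'' (row_at (Const 0)))) + (1 + t2 +
            (1 + (1 + acost (row_at (Const 0)) + acost (Reg ''p'')) +
              (1 + (1 + acost (row_at (Reg ''p'')) + acost (Const 0)) + t'))) \<le> 60 * ?e + 50 * kk + 200"
            using t 1(2) by simp
        qed assumption
      qed (use 1(1) lw[of ?e] sW ps assms(2) in auto)
    qed
  qed
qed

section \<open>Refinement of whole steps\<close>

text \<open>The machine stores no list positions. A finger is the node at the abstract position
  \<open>fpos\<close>, so insertions and deletions elsewhere shift the position without invalidating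
  the finger.\<close>

definition represents :: "state \<Rightarrow> config \<Rightarrow> bool" where
  "represents \<sigma> A \<longleftrightarrow> params \<sigma> \<and>
     (\<forall>s<kk. linked (stairs A s) (row \<sigma> ''n'' s) (row \<sigma> ''p'' s) (row \<sigma> ''l'' s)) \<and>
     (\<forall>s<kk. \<forall>g<kk. arr \<sigma> ''f'' (s * kk + g) = node (stairs A s) (fpos A s g)) \<and>
     (\<forall>g<kk. arr \<sigma> ''x'' g = lastx A g) \<and>
     reg \<sigma> ''x'' = best A True \<and> reg \<sigma> ''y'' = best A False \<and>
     reg \<sigma> ''U'' = length (tails A True) \<and> reg \<sigma> ''V'' = length (tails A False) \<and>
     (\<forall>j<length (tails A True). arr \<sigma> ''t'' j = tails A True ! j) \<and>
     (\<forall>j<length (tails A False). arr \<sigma> ''d'' j = tails A False ! j)"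

lemma run_search_all:
  assumes "params \<sigma>" "reg \<sigma> ''i'' = x" "t < x" "x \<le> n" "reg \<sigma> ''c'' = c" "c < kk"
    "\<And>s. s < kk \<Longrightarrow> stair s t (X s)"
    "\<And>s. s < kk \<Longrightarrow> linked (X s) (row \<sigma> ''n'' s) (row \<sigma> ''p'' s) (row \<sigma> ''l'' s)"
    "\<And>s g. s < kk \<Longrightarrow> g < kk \<Longrightarrow> arr \<sigma> ''f'' (s * kk + g) = node (X s) (F s g) \<and> F s g \<le> length (X s)"
  shows "run (for_loop ''s'' search_prog) \<sigma> (\<lambda>t' \<tau>.
    t' \<le> (\<Sum>s<kk. 50 * gap (F s c) (rk s (X s) x) + 210) + 10 \<and>
    (\<forall>r. r \<notin> {''s'', ''p'', ''q''} \<longrightarrow> reg \<tau> r = reg \<sigma> r) \<and>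
    (\<forall>a. a \<notin> {''f'', ''w''} \<longrightarrow> arr \<tau> a = arr \<sigma> a) \<and>
    (\<forall>s<kk. arr \<tau> ''w'' (Suc s) = succ0 (pred_len X s x)) \<and>
    (\<forall>s<kk. \<forall>g<kk. arr \<tau> ''f'' (s * kk + g) = node (X s) (if g = c then rk s (X s) x else F s g)))"
proof -
  define I where "I = (\<lambda>j (\<tau> :: state). j \<le> kk \<and> reg \<tau> ''s'' = j \<and>
    (\<forall>r. r \<notin> {''s'', ''p'', ''q''} \<longrightarrow> reg \<tau> r = reg \<sigma> r) \<and>
    (\<forall>a. a \<notin> {''f'', ''w''} \<longrightarrow> arr \<tau> a = arr \<sigma> a) \<and>
    (\<forall>s<j. arr \<tau> ''w'' (Suc s) = succ0 (pred_len X s x)) \<and>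
    (\<forall>s<kk. \<forall>g<kk. arr \<tau> ''f'' (s * kk + g) = node (X s) (if s < j \<and> g = c then rk s (X s) x else F s g)))"
  have "run (for_loop ''s'' search_prog) \<sigma> (\<lambda>t' \<tau>. I kk \<tau> \<and>
    t' \<le> (\<Sum>s<kk. (50 * gap (F s c) (rk s (X s) x) + 200) + 10) + 10)"
  proof (rule run_for_loop)
    show "I 0 (\<sigma>\<lparr>reg := (reg \<sigma>)(''s'' := 0)\<rparr>)" using assms(9) by (simp add: I_def)
    show "reg \<tau> ''s'' = j \<and> j \<le> kk \<and> reg \<tau> ''K'' = kk" if "I j \<tau>" for j \<tau>
      using that params_simps[OF assms(1)] by (simp add: I_def)
    fix j \<tau> assume I: "I j \<tau>" and j: "j < kk"
    have r: "reg \<tau> ''s'' = j" "\<And>r. r \<notin> {''s'', ''p'', ''q''} \<Longrightarrow> reg \<tau> r = reg \<sigma> r"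
      and a: "\<And>a. a \<notin> {''f'', ''w''} \<Longrightarrow> arr \<tau> a = arr \<sigma> a"
      and w: "\<And>s. s < j \<Longrightarrow> arr \<tau> ''w'' (Suc s) = succ0 (pred_len X s x)"
      and f: "\<And>s g. s < kk \<Longrightarrow> g < kk \<Longrightarrow>
        arr \<tau> ''f'' (s * kk + g) = node (X s) (if s < j \<and> g = c then rk s (X s) x else F s g)"
      using I unfolding I_def by auto
    have p: "params \<tau>" using assms(1) r by (simp add: params_def)
    have rg: "reg \<tau> ''i'' = x" "reg \<tau> ''c'' = c" using r assms(2,5) by auto
    have lk: "linked (X j) (row \<tau> ''n'' j) (row \<tau> ''p'' j) (row \<tau> ''l'' j)"
      using assms(8)[OF j] a by simp
    have fj: "arr \<tau> ''f'' (j * kk + c) = node (X j) (F j c)" using f[OF j assms(6)] by simp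
    have F: "F j c \<le> length (X j)" using assms(9)[OF j assms(6)] by blast
    show "run search_prog \<tau> (\<lambda>t \<tau>'. t \<le> 50 * gap (F j c) (rk j (X j) x) + 200 \<and> reg \<tau>' ''s'' = j \<and>
        I (Suc j) (\<tau>'\<lparr>reg := (reg \<tau>')(''s'' := Suc j)\<rparr>))"
    proof (rule wp_mono[OF run_search_prog[OF p rg(1) assms(3,4) r(1) j assms(7)[OF j] lk F rg(2) assms(6) fj]],
        elim conjE, intro conjI, goal_cases)
      case (3 t1 \<tau>1)
      have "arr \<tau>1 ''f'' (s * kk + g) = node (X s) (if s < Suc j \<and> g = c then rk s (X s) x else F s g)"
        if "s < kk" "g < kk" for s g
        using 3(3) f[OF that] finger_inj[OF that(2) assms(6), of s j] by (auto simp: less_Suc_eq)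
      then show ?case
        unfolding I_def using 3 r a w j by (auto simp: less_Suc_eq pred_len_def)
    qed (use r in auto)
  qed
  then show ?thesis
    by (rule wp_mono, elim conjE, intro conjI) (simp_all add: I_def add_ac)
qed

lemma run_insert_all:
  assumes "params \<sigma>" "reg \<sigma> ''i'' = x" "x = Suc t" "x \<le> n" "reg \<sigma> ''c'' = c" "c < kk" "L c = x"
    "\<And>s. s < kk \<Longrightarrow> stair s t (X s)"
    "\<And>s. s < kk \<Longrightarrow> linked (X s) (row \<sigma> ''n'' s) (row \<sigma> ''p'' s) (row \<sigma> ''l'' s)"
    "\<And>s. s < kk \<Longrightarrow> arr \<sigma> ''w'' s = new_len X s x \<and> new_len X s x \<le> x"
    "\<And>g. g < kk \<Longrightarrow> arr \<sigma> ''x'' g = L g \<and> L g \<le> x"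
    "\<And>s g. s < kk \<Longrightarrow> g < kk \<Longrightarrow> arr \<sigma> ''f'' (s * kk + g) = node (X s) (if L g = 0 then 0 else rk s (X s) (L g))"
  shows "run (for_loop ''s'' insert_prog) \<sigma> (\<lambda>t' \<tau>.
    t' \<le> (\<Sum>s<kk. 60 * (Suc (length (X s)) - length (insert_all X x s)) + 150 * kk + 410) + 10 \<and>
    (\<forall>r. r \<notin> {''s'', ''p'', ''q'', ''w'', ''g''} \<longrightarrow> reg \<tau> r = reg \<sigma> r) \<and>
    (\<forall>a. a \<notin> {''n'', ''p'', ''l'', ''f''} \<longrightarrow> arr \<tau> a = arr \<sigma> a) \<and>
    (\<forall>s<kk. linked (insert_all X x s) (row \<tau> ''n'' s) (row \<tau> ''p'' s) (row \<tau> ''l'' s)) \<and>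
    (\<forall>s<kk. \<forall>g<kk. arr \<tau> ''f'' (s * kk + g) =
      node (insert_all X x s) (if L g = 0 then 0 else rk s (insert_all X x s) (L g))))"
proof -
  \<comment> \<open>Halfway through the loop the tables are a mixture. This is harmless because all
    new lengths were computed from the old \<open>X\<close> beforehand.\<close>
  let ?Y = "\<lambda>j s. if s < j then insert_all X x s else X s"
  define I where "I = (\<lambda>j (\<tau> :: state). j \<le> kk \<and> reg \<tau> ''s'' = j \<and>
    (\<forall>r. r \<notin> {''s'', ''p'', ''q'', ''w'', ''g''} \<longrightarrow> reg \<tau> r = reg \<sigma> r) \<and>
    (\<forall>a. a \<notin> {''n'', ''p'', ''l'', ''f''} \<longrightarrow> arr \<tau> a = arr \<sigma> a) \<and>
    (\<forall>s<kk. linked (?Y j s) (row \<tau> ''n'' s) (row \<tau> ''p'' s) (row \<tau> ''l'' s)) \<and>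
    (\<forall>s<kk. \<forall>g<kk. arr \<tau> ''f'' (s * kk + g) = node (?Y j s) (if L g = 0 then 0 else rk s (?Y j s) (L g))))"
  have st: "stair s x (?Y j s)" if "s < kk" for s j
    using stair_ins[OF assms(8)[OF that] assms(3,4), of "new_len X s x"] assms(10)[OF that]
      stair_mono[OF assms(8)[OF that], of x] assms(3) by (simp add: insert_all_def)
  have "run (for_loop ''s'' insert_prog) \<sigma> (\<lambda>t' \<tau>. I kk \<tau> \<and>
    t' \<le> (\<Sum>s<kk. (60 * (Suc (length (X s)) - length (insert_all X x s)) + 150 * kk + 400) + 10) + 10)"
  proof (rule run_for_loop)
    show "I 0 (\<sigma>\<lparr>reg := (reg \<sigma>)(''s'' := 0)\<rparr>)" using assms(9,12) by (simp add: I_def)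
    show "reg \<tau> ''s'' = j \<and> j \<le> kk \<and> reg \<tau> ''K'' = kk" if "I j \<tau>" for j \<tau>
      using that params_simps[OF assms(1)] by (simp add: I_def)
    fix j \<tau> assume I: "I j \<tau>" and j: "j < kk"
    have r: "reg \<tau> ''s'' = j" "\<And>r. r \<notin> {''s'', ''p'', ''q'', ''w'', ''g''} \<Longrightarrow> reg \<tau> r = reg \<sigma> r"
      and a: "\<And>a. a \<notin> {''n'', ''p'', ''l'', ''f''} \<Longrightarrow> arr \<tau> a = arr \<sigma> a"
      and l: "\<And>s. s < kk \<Longrightarrow> linked (?Y j s) (row \<tau> ''n'' s) (row \<tau> ''p'' s) (row \<tau> ''l'' s)"
      and f: "\<And>s g. s < kk \<Longrightarrow> g < kk \<Longrightarrow>
        arr \<tau> ''f'' (s * kk + g) = node (?Y j s) (if L g = 0 then 0 else rk s (?Y j s) (L g))"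
      using I unfolding I_def by auto
    have p: "params \<tau>" using assms(1) r by (simp add: params_def)
    have rg: "reg \<tau> ''i'' = x" "reg \<tau> ''c'' = c" using r assms(2,5) by auto
    have lj: "linked (X j) (row \<tau> ''n'' j) (row \<tau> ''p'' j) (row \<tau> ''l'' j)" using l[OF j] by simp
    have w: "arr \<tau> ''w'' j = new_len X j x" "new_len X j x \<le> x" using a assms(10)[OF j] by auto
    have xg: "arr \<tau> ''x'' g = L g \<and> L g \<le> x" if "g < kk" for g using a assms(11)[OF that] by simp
    have fj: "arr \<tau> ''f'' (j * kk + g) = node (X j) (if L g = 0 then 0 else rk j (X j) (L g))" if "g < kk" for g
      using f[OF j that] by simp
    have ia: "ins j (X j) x (new_len X j x) = insert_all X x j" by (simp add: insert_all_def)
    show "run insert_prog \<tau> (\<lambda>t \<tau>'. t \<le> 60 * (Suc (length (X j)) - length (insert_all X x j)) + 150 * kk + 400 \<and>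
        reg \<tau>' ''s'' = j \<and> I (Suc j) (\<tau>'\<lparr>reg := (reg \<tau>')(''s'' := Suc j)\<rparr>))"
    proof (rule wp_mono[OF run_insert_prog[OF p rg(1) assms(3,4) r(1) j rg(2) assms(6) assms(8)[OF j] lj w assms(7) xg fj, unfolded ia]],
        assumption, assumption, elim conjE, intro conjI, goal_cases)
      case (3 t1 \<tau>1)
      have L: "linked (?Y (Suc j) s) (row \<tau>1 ''n'' s) (row \<tau>1 ''p'' s) (row \<tau>1 ''l'' s)" if s: "s < kk" for s
      proof (cases "s = j")
        case True
        then show ?thesis using 3(6) by simp
      next
        case False
        then have Y: "?Y (Suc j) s = ?Y j s" by auto
        show ?thesis
          unfolding Y by (rule linked_cong[OF l[OF s] st[OF s] assms(4)]) (use 3(4) False in auto)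
      qed
      have F: "arr \<tau>1 ''f'' (s * kk + g) = node (?Y (Suc j) s) (if L g = 0 then 0 else rk s (?Y (Suc j) s) (L g))"
        if "s < kk" "g < kk" for s g
      proof (cases "s = j")
        case True
        then show ?thesis using 3(7) that by simp
      next
        case False
        then have Y: "?Y (Suc j) s = ?Y j s" by auto
        show ?thesis unfolding Y using 3(5) f[OF that] that False by simp
      qed
      show ?case
        unfolding I_def using 3(2,3) r a j L F by simp
    qed (use r in auto)
  qed
  then show ?thesis
    by (rule wp_mono, elim conjE, intro conjI) (simp_all add: I_def add_ac)
qed

lemma run_prune_all:
  assumes "params \<sigma>" "t \<le> n" "reg \<sigma> ''l'' = m" "m \<le> n"
    "\<And>s. s < kk \<Longrightarrow> stair s t (X s)"
    "\<And>s. s < kk \<Longrightarrow> linked (X s) (row \<sigma> ''n'' s) (row \<sigma> ''p'' s) (row \<sigma> ''l'' s)"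
  shows "run (for_loop ''s'' prune_prog) \<sigma> (\<lambda>t' \<tau>.
    t' \<le> (\<Sum>s<kk. 60 * (length (X s) - length (prune m (X s))) + 50 * kk + 210) + 10 \<and>
    (\<forall>r. r \<notin> {''s'', ''p'', ''g''} \<longrightarrow> reg \<tau> r = reg \<sigma> r) \<and>
    (\<forall>a. a \<notin> {''n'', ''p'', ''f''} \<longrightarrow> arr \<tau> a = arr \<sigma> a) \<and>
    (\<forall>s<kk. linked (prune m (X s)) (row \<tau> ''n'' s) (row \<tau> ''p'' s) (row \<tau> ''l'' s)) \<and>
    (\<forall>s<kk. \<forall>g<kk. arr \<tau> ''f'' (s * kk + g) = 0))"
proof -
  let ?Y = "\<lambda>j s. if s < j then prune m (X s) else X s"
  define I where "I = (\<lambda>j (\<tau> :: state). j \<le> kk \<and> reg \<tau> ''s'' = j \<and>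
    (\<forall>r. r \<notin> {''s'', ''p'', ''g''} \<longrightarrow> reg \<tau> r = reg \<sigma> r) \<and>
    (\<forall>a. a \<notin> {''n'', ''p'', ''f''} \<longrightarrow> arr \<tau> a = arr \<sigma> a) \<and>
    (\<forall>s<kk. linked (?Y j s) (row \<tau> ''n'' s) (row \<tau> ''p'' s) (row \<tau> ''l'' s)) \<and>
    (\<forall>s<j. \<forall>g<kk. arr \<tau> ''f'' (s * kk + g) = 0))"
  have st: "stair s t (?Y j s)" if "s < kk" for s j
    using assms(5)[OF that] stair_prune by simp
  have "run (for_loop ''s'' prune_prog) \<sigma> (\<lambda>t' \<tau>. I kk \<tau> \<and>
    t' \<le> (\<Sum>s<kk. (60 * (length (X s) - length (prune m (X s))) + 50 * kk + 200) + 10) + 10)"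
  proof (rule run_for_loop)
    show "I 0 (\<sigma>\<lparr>reg := (reg \<sigma>)(''s'' := 0)\<rparr>)" using assms(6) by (simp add: I_def)
    show "reg \<tau> ''s'' = j \<and> j \<le> kk \<and> reg \<tau> ''K'' = kk" if "I j \<tau>" for j \<tau>
      using that params_simps[OF assms(1)] by (simp add: I_def)
    fix j \<tau> assume I: "I j \<tau>" and j: "j < kk"
    have r: "reg \<tau> ''s'' = j" "\<And>r. r \<notin> {''s'', ''p'', ''g''} \<Longrightarrow> reg \<tau> r = reg \<sigma> r"
      and a: "\<And>a. a \<notin> {''n'', ''p'', ''f''} \<Longrightarrow> arr \<tau> a = arr \<sigma> a"
      and l: "\<And>s. s < kk \<Longrightarrow> linked (?Y j s) (row \<tau> ''n'' s) (row \<tau> ''p'' s) (row \<tau> ''l'' s)"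
      and f: "\<And>s g. s < j \<Longrightarrow> g < kk \<Longrightarrow> arr \<tau> ''f'' (s * kk + g) = 0"
      using I unfolding I_def by blast+
    have p: "params \<tau>" using assms(1) r by (simp add: params_def)
    have rm: "reg \<tau> ''l'' = m" using r assms(3) by auto
    have lj: "linked (X j) (row \<tau> ''n'' j) (row \<tau> ''p'' j) (row \<tau> ''l'' j)" using l[OF j] by simp
    show "run prune_prog \<tau> (\<lambda>t \<tau>'. t \<le> 60 * (length (X j) - length (prune m (X j))) + 50 * kk + 200 \<and>
        reg \<tau>' ''s'' = j \<and> I (Suc j) (\<tau>'\<lparr>reg := (reg \<tau>')(''s'' := Suc j)\<rparr>))"
    proof (rule wp_mono[OF run_prune_prog[OF p r(1) j assms(5)[OF j] assms(2) lj rm assms(4)]],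
        elim conjE, intro conjI, goal_cases)
      case (3 t1 \<tau>1)
      have L: "linked (?Y (Suc j) s) (row \<tau>1 ''n'' s) (row \<tau>1 ''p'' s) (row \<tau>1 ''l'' s)" if s: "s < kk" for s
      proof (cases "s = j")
        case True
        then show ?thesis using 3(6) by simp
      next
        case False
        then have Y: "?Y (Suc j) s = ?Y j s" by auto
        show ?thesis
          unfolding Y by (rule linked_cong[OF l[OF s] st[OF s] assms(2)]) (use 3(4) False in auto)
      qed
      have F: "arr \<tau>1 ''f'' (s * kk + g) = 0" if "s < Suc j" "g < kk" for s g
        using 3(5,7) f[of s g] that by (cases "s = j") auto
      show ?case
        unfolding I_def using 3(2,3) r a j L F by simp
    qed (use r in auto)
  qed
  then show ?thesis
  proof (rule wp_mono, elim conjE, intro conjI, goal_cases)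
    case (1 t' \<tau>)
    then show ?case by (simp add: add_ac)
  next
    case (4 t' \<tau>)
    show ?case
    proof (intro allI impI)
      fix s assume s: "s < kk"
      have "linked (?Y kk s) (row \<tau> ''n'' s) (row \<tau> ''p'' s) (row \<tau> ''l'' s)"
        using 4(2) s unfolding I_def by blast
      then show "linked (prune m (X s)) (row \<tau> ''n'' s) (row \<tau> ''p'' s) (row \<tau> ''l'' s)"
        unfolding if_P[OF s] .
    qed
  qed (unfold I_def, blast+)
qed

lemma best_sound_le: "best_sound t L \<Longrightarrow> L d \<le> t"
proof -
  assume "best_sound t L"
  then have "L d = 0 \<or> (\<exists>ys. subseq ys (take t S) \<and> ends k d k ys \<and> length ys = L d)"
    by (simp add: best_sound_def)
  then show ?thesis using list_emb_length by fastforce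
qed

lemma run_advance_prog:
  assumes R: "represents \<sigma> A" and inv: "inv t t0 L0 A" and i: "reg \<sigma> ''i'' = x" and x: "x = Suc t" "x \<le> n"
  shows "run advance_prog \<sigma> (\<lambda>t' \<tau>. t' \<le> 2000 * k\<^sup>2 + 60 * ((\<Sum>s<kk. moves x A s) + (\<Sum>s<kk. dels x A s)) \<and>
    represents \<tau> (advance x A) \<and> reg \<tau> ''i'' = x)"
proof -
  let ?X = "stairs A" and ?c = "cls A x" and ?B = "advance x A"
  let ?u = "label True (tails A True) x" and ?v = "label False (tails A False) x"
  have snd: "sound t ?X" and bs: "best_sound t (best A)" and ph: "phase t t0 L0 A" and cl: "classes t A"
    using inv by (auto simp: inv_def valid_def)
  have tn: "t < x" "1 \<le> x" "t \<le> n" using x by auto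
  have st: "stair s t (?X s)" if "s < kk" for s using snd that by (simp add: sound_def kk_def)
  have p: "params \<sigma>" and lk: "\<And>s. s < kk \<Longrightarrow> linked (?X s) (row \<sigma> ''n'' s) (row \<sigma> ''p'' s) (row \<sigma> ''l'' s)"
    and fg: "\<And>s g. s < kk \<Longrightarrow> g < kk \<Longrightarrow> arr \<sigma> ''f'' (s * kk + g) = node (?X s) (fpos A s g)"
    and xg: "\<And>g. g < kk \<Longrightarrow> arr \<sigma> ''x'' g = lastx A g"
    and bst: "reg \<sigma> ''x'' = best A True" "reg \<sigma> ''y'' = best A False"
    and cnt: "reg \<sigma> ''U'' = length (tails A True)" "reg \<sigma> ''V'' = length (tails A False)"
    and tl: "\<And>j. j < length (tails A True) \<Longrightarrow> arr \<sigma> ''t'' j = tails A True ! j"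
      "\<And>j. j < length (tails A False) \<Longrightarrow> arr \<sigma> ''d'' j = tails A False ! j"
    using R unfolding represents_def by blast+
  have tlb: "1 \<le> tails A d ! j \<and> tails A d ! j \<le> n" if "j < length (tails A d)" for d j
    using phaseD(4,5)[OF ph that] tn by simp
  have tk: "length (tails A d) \<le> k" for d by (rule phaseD(8)[OF ph])
  have ck: "?c < kk" using cls_less[of A x] by (simp add: kk_def)
  have uv: "?u < W" "?v < W" "?u < k" "?v < k" "k < W" "1 < W" "Suc ?u < W" "k - 1 + ?v < W"
    using takeWhile_label(2)[of True "tails A True" x] takeWhile_label(2)[of False "tails A False" x] bounds
      bounds(4)[of ?u] bounds(4)[of ?v] bounds(2)[of ?u] bounds(2)[of "k - 1 + ?v"] by (auto simp: kk_def)
  have lx: "lastx A g \<le> t" for g using cl by (simp add: classes_def)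
  let ?L = "(lastx A)(?c := x)"
  have lab1: "run (label_prog True ''t'' ''U'' ''u'') \<sigma> (\<lambda>t \<sigma>'. t \<le> 50 * k + 80 \<and>
    reg \<sigma>' = (reg \<sigma>)(''u'' := ?u, ''U'' := length (put ?u x (tails A True))) \<and>
    arr \<sigma>' = (arr \<sigma>)(''t'' := (arr \<sigma> ''t'')(?u := x)))"
    by (rule run_label_prog[OF p i tn(2) x(2) cnt(1) tl(1) tlb tk]) auto
  show ?thesis
    unfolding advance_prog_def wp_Seq
  proof (rule wp_mono[OF lab1], elim conjE, goal_cases)
    case (1 t1 \<sigma>1)
    note r1 = 1(2) and a1 = 1(3)
    note time1 = 1(1)
    have p1: "params \<sigma>1" "reg \<sigma>1 ''i'' = x" "reg \<sigma>1 ''V'' = length (tails A False)"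
      "\<And>j. j < length (tails A False) \<Longrightarrow> arr \<sigma>1 ''d'' j = tails A False ! j"
      using p i cnt tl r1 a1 by (auto simp: params_def)
    have lab2: "run (label_prog False ''d'' ''V'' ''v'') \<sigma>1 (\<lambda>t \<sigma>'. t \<le> 50 * k + 80 \<and>
      reg \<sigma>' = (reg \<sigma>1)(''v'' := ?v, ''V'' := length (put ?v x (tails A False))) \<and>
      arr \<sigma>' = (arr \<sigma>1)(''d'' := (arr \<sigma>1 ''d'')(?v := x)))"
      by (rule run_label_prog[OF p1(1,2) tn(2) x(2) p1(3,4) tlb tk]) auto
    show ?case
    proof (rule wp_mono[OF lab2], elim conjE, goal_cases)
      case (1 t2 \<sigma>2)
      note r2 = 1(2) and a2 = 1(3)
      note time2 = 1(1)
      have regs2: "reg \<sigma>2 ''u'' = ?u" "reg \<sigma>2 ''v'' = ?v" "reg \<sigma>2 ''k'' = k"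
        using r1 r2 params_simps[OF p] by auto
      have cprog: "run (If (Less (plus1 (Reg ''u'')) (Reg ''k'')) (Assign ''c'' (Reg ''u''))
        (Assign ''c'' (Plus (minus1 (Reg ''k'')) (Reg ''v'')))) \<sigma>2 (\<lambda>t' \<tau>. t' \<le> 20 \<and>
        reg \<tau> = (reg \<sigma>2)(''c'' := ?c) \<and> arr \<tau> = arr \<sigma>2)"
        unfolding wp_If wp_Assign using regs2 uv by (auto simp: cls_def Let_def)
      show ?case
      proof (rule wp_mono[OF cprog], elim conjE, goal_cases)
        case (1 t3 \<sigma>3)
        note time3 = 1(1)
        have r3: "reg \<sigma>3 r = reg \<sigma> r" if "r \<notin> {''u'', ''U'', ''v'', ''V'', ''c''}" for r
          using that 1(2) r2 r1 by simp
        have r3': "reg \<sigma>3 ''c'' = ?c" "reg \<sigma>3 ''U'' = length (put ?u x (tails A True))"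
          "reg \<sigma>3 ''V'' = length (put ?v x (tails A False))"
          using 1(2) r2 r1 by auto
        have a3: "arr \<sigma>3 a = arr \<sigma> a" if "a \<notin> {''t'', ''d''}" for a using that 1(3) a2 a1 by simp
        have a3': "arr \<sigma>3 ''t'' = (arr \<sigma> ''t'')(?u := x)" "arr \<sigma>3 ''d'' = (arr \<sigma> ''d'')(?v := x)"
          using 1(3) a2 a1 by auto
        have p3: "params \<sigma>3" "reg \<sigma>3 ''i'' = x" using p i r3 by (auto simp: params_def)
        have lk3: "linked (?X s) (row \<sigma>3 ''n'' s) (row \<sigma>3 ''p'' s) (row \<sigma>3 ''l'' s)" if "s < kk" for s
          using lk[OF that] a3 by simp
        have fg3: "arr \<sigma>3 ''f'' (s * kk + g) = node (?X s) (fpos A s g) \<and> fpos A s g \<le> length (?X s)"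
          if "s < kk" "g < kk" for s g using fg[OF that] a3 rk_le by (simp add: fpos_def)
        note sa = run_search_all[OF p3 tn(1) x(2) r3'(1) ck st lk3 fg3]
        show ?case
        proof (rule wp_mono[OF sa], assumption, assumption, assumption, assumption, elim conjE, goal_cases)
          case (1 t4 \<sigma>4)
          note time4 = 1(1)
          have r4: "reg \<sigma>4 r = reg \<sigma>3 r" if "r \<notin> {''s'', ''p'', ''q''}" for r using that 1(2) by blast
          have a4: "arr \<sigma>4 a = arr \<sigma>3 a" if "a \<notin> {''f'', ''w''}" for a using that 1(3) by blast
          note w4 = 1(4) and f4 = 1(5)
          let ?s5 = "\<sigma>4\<lparr>arr := (arr \<sigma>4)(''x'' := (arr \<sigma>4 ''x'')(?c := x))\<rparr>"
          have reg4: "reg \<sigma>4 ''c'' = ?c" "reg \<sigma>4 ''i'' = x" using r4 r3' p3 by auto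
          have cW: "?c < W" "x < W" using bounds(2)[of ?c] bounds(1)[of x] ck x by auto
          have p5: "params ?s5" using p3(1) r4 by (simp add: params_def)
          have bst5: "reg ?s5 ''x'' = best A True" "reg ?s5 ''y'' = best A False" using r4 r3 bst by auto
          have w5: "arr ?s5 ''w'' (Suc s) = succ0 (pred_len ?X s x)" "succ0 (pred_len ?X s x) \<le> x" if "s < kk" for s
            using w4 that pred_len_witness(1)[OF snd tn(1) x(2), of s] by (auto simp: kk_def)
          have bn: "best A d \<le> n" for d using best_sound_le[OF bs, of d] tn by simp
          note le = run_lengths_prog[OF p5 x(2) w5 bst5 bn]
          show ?case
            unfolding wp_Store
          proof (intro conjI, goal_cases)
            case 1 show ?case using cW reg4 by simp
          next
            case 2 show ?case using cW reg4 by simp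
          next
            case 3
            have e5: "\<sigma>4\<lparr>arr := (arr \<sigma>4)(''x'' := (arr \<sigma>4 ''x'')(aval (Reg ''c'') \<sigma>4 := aval (Reg ''i'') \<sigma>4))\<rparr> = ?s5"
              using reg4 by simp
            show ?case
              unfolding e5
            proof (rule wp_mono[OF le], assumption, assumption, elim conjE, goal_cases)
              case (1 t6 \<sigma>6)
              note time6 = 1(1)
              have r6: "reg \<sigma>6 r = reg \<sigma>4 r" if "r \<notin> {''a'', ''b'', ''x'', ''y''}" for r using that 1(2) by simp
              have a6: "arr \<sigma>6 a = arr ?s5 a" if "a \<noteq> ''w''" for a using that 1(5) by blast
              note b6 = 1(3,4) and w6 = 1(6)
              have p6: "params \<sigma>6" "reg \<sigma>6 ''i'' = x" "reg \<sigma>6 ''c'' = ?c"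
                using p5 r6 reg4 by (auto simp: params_def)
              have lk6: "linked (?X s) (row \<sigma>6 ''n'' s) (row \<sigma>6 ''p'' s) (row \<sigma>6 ''l'' s)" if "s < kk" for s
                using lk3[OF that] a6 a4 by simp
              have w6': "arr \<sigma>6 ''w'' s = new_len ?X s x \<and> new_len ?X s x \<le> x" if "s < kk" for s
                using w6 that new_len_witness(1)[OF snd x, of s] by (simp add: kk_def)
              have x6: "arr \<sigma>6 ''x'' g = ?L g \<and> ?L g \<le> x" if "g < kk" for g
                using a6 a4 a3 xg[OF that] lx[of g] x by simp
              have f6: "arr \<sigma>6 ''f'' (s * kk + g) = node (?X s) (if ?L g = 0 then 0 else rk s (?X s) (?L g))"
                if "s < kk" "g < kk" for s g
                using a6 f4 that x by (simp add: fpos_def)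
              have Lc: "?L ?c = x" by simp
              note ia = run_insert_all[OF p6(1,2) x p6(3) ck Lc st lk6 w6' x6 f6]
              show ?case
              proof (rule wp_mono[OF ia], assumption, assumption, assumption, assumption, assumption, assumption,
                  elim conjE, goal_cases)
                case (1 t7 \<sigma>7)
                note time7 = 1(1)
                have r7: "reg \<sigma>7 r = reg \<sigma>6 r" if "r \<notin> {''s'', ''p'', ''q'', ''w'', ''g''}" for r
                  using that 1(2) by blast
                have a7: "arr \<sigma>7 a = arr \<sigma>6 a" if "a \<notin> {''n'', ''p'', ''l'', ''f''}" for a
                  using that 1(3) by blast
                note lk7 = 1(4) and f7 = 1(5)
                have "represents \<sigma>7 ?B"
                  unfolding represents_def
                proof (intro conjI allI impI)
                  show "params \<sigma>7" using p6 r7 by (simp add: params_def)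
                  fix s assume s: "s < kk"
                  show "linked (stairs ?B s) (row \<sigma>7 ''n'' s) (row \<sigma>7 ''p'' s) (row \<sigma>7 ''l'' s)"
                    using lk7 s by simp
                  fix g assume "g < kk"
                  then show "arr \<sigma>7 ''f'' (s * kk + g) = node (stairs ?B s) (fpos ?B s g)"
                    using f7 s by (simp add: fpos_def)
                next
                  fix g assume "g < kk"
                  then show "arr \<sigma>7 ''x'' g = lastx ?B g" using a7 x6 by simp
                next
                  show "reg \<sigma>7 ''x'' = best ?B True" "reg \<sigma>7 ''y'' = best ?B False" using r7 b6 by auto
                  show "reg \<sigma>7 ''U'' = length (tails ?B True)" "reg \<sigma>7 ''V'' = length (tails ?B False)"
                    using r7 r6 r4 r3' by auto
                next
                  fix j assume j: "j < length (tails ?B True)"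
                  have "arr \<sigma>7 ''t'' j = ((arr \<sigma> ''t'')(?u := x)) j" using a7 a6 a4 a3' by simp
                  then show "arr \<sigma>7 ''t'' j = tails ?B True ! j"
                    using j nth_put[OF takeWhile_label(1), of j True "tails A True" x] tl by auto
                next
                  fix j assume j: "j < length (tails ?B False)"
                  have "arr \<sigma>7 ''d'' j = ((arr \<sigma> ''d'')(?v := x)) j" using a7 a6 a4 a3' by simp
                  then show "arr \<sigma>7 ''d'' j = tails ?B False ! j"
                    using j nth_put[OF takeWhile_label(1), of j False "tails A False" x] tl by auto
                qed
                moreover have "reg \<sigma>7 ''i'' = x" using r7 p6 by simp
                moreover have "1 + t1 + (1 + t2 + (1 + t3 + (1 + t4 +
                    (1 + (1 + acost (Reg ''c'') + acost (Reg ''i'')) + (1 + t6 + t7)))))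
                  \<le> 2000 * k\<^sup>2 + 60 * ((\<Sum>s<kk. moves x A s) + (\<Sum>s<kk. dels x A s))"
                proof -
                  have s4: "(\<Sum>s<kk. 50 * gap (fpos A s ?c) (rk s (?X s) x) + 210) = 50 * (\<Sum>s<kk. moves x A s) + 210 * kk"
                    by (simp add: moves_def sum.distrib sum_distrib_left)
                  have s7: "(\<Sum>s<kk. 60 * (Suc (length (?X s)) - length (insert_all ?X x s)) + 150 * kk + 410)
                      = 60 * (\<Sum>s<kk. dels x A s) + 150 * (kk * kk) + 410 * kk"
                    by (simp add: dels_def sum.distrib sum_distrib_left)
                  \<comment> \<open>The truly quadratic term is the repair of all fingers in all
                    staircases; as \<open>3 \<le> k\<close>, linear terms and constants are absorbed
                    into multiples of \<open>k\<^sup>2\<close>.\<close>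
                  have q: "3 * k \<le> k\<^sup>2" "9 \<le> k\<^sup>2" "kk * kk = 4 * k\<^sup>2"
                    using k3 mult_le_mono[OF k3 k3] by (auto simp: power2_eq_square kk_def)
                  show ?thesis
                    using time1 time2 time3 time4 time6 time7 q unfolding s4 s7 by (simp add: kk_def)
                qed
                ultimately show ?case by blast
              qed
            qed
          qed
        qed
      qed
    qed
  qed
qed

lemma run_reset_prog:
  assumes R: "represents \<sigma> B" and v: "valid t B" "t \<le> n"
  shows "run reset_prog \<sigma> (\<lambda>t' \<tau>. t' \<le> 2000 * k\<^sup>2 + 60 * (\<Sum>s<kk. cuts B s) \<and>
    represents \<tau> (reset B) \<and> reg \<tau> ''i'' = reg \<sigma> ''i'')"
proof -
  let ?m = "min (best B True) (best B False)"
  have snd: "sound t (stairs B)" and bs: "best_sound t (best B)" using v by (auto simp: valid_def)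
  have bn: "best B d \<le> n" for d using best_sound_le[OF bs, of d] v(2) by simp
  then have m: "?m \<le> n" by (simp add: min.coboundedI1)
  have st: "stair s t (stairs B s)" if "s < kk" for s using snd that by (simp add: sound_def kk_def)
  have p: "params \<sigma>" and lk: "\<And>s. s < kk \<Longrightarrow> linked (stairs B s) (row \<sigma> ''n'' s) (row \<sigma> ''p'' s) (row \<sigma> ''l'' s)"
    and bst: "reg \<sigma> ''x'' = best B True" "reg \<sigma> ''y'' = best B False"
    using R unfolding represents_def by blast+
  let ?s1 = "\<sigma>\<lparr>reg := (reg \<sigma>)(''l'' := ?m)\<rparr>"
  have p1: "params ?s1" "reg ?s1 ''l'' = ?m" using p by (auto simp: params_def)
  have lk1: "linked (stairs B s) (row ?s1 ''n'' s) (row ?s1 ''p'' s) (row ?s1 ''l'' s)" if "s < kk" for s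
    using lk[OF that] by simp
  note pa = run_prune_all[OF p1(1) v(2) p1(2) m st lk1]
  show ?thesis
    unfolding reset_prog_def wp_Seq wp_Assign[of _ _ "''l''"]
  proof (intro conjI, goal_cases)
    case 1
    show ?case using bst bn bounds(1)[of "best B True"] bounds(1)[of "best B False"] by (simp add: le_SucI)
  next
    case 2
    have e1: "\<sigma>\<lparr>reg := (reg \<sigma>)(''l'' := aval (Minus (Reg ''x'') (Minus (Reg ''x'') (Reg ''y''))) \<sigma>)\<rparr> = ?s1"
      using bst by (simp add: min_def)
    show ?case
      unfolding e1
    proof (rule wp_mono[OF pa], assumption, assumption, elim conjE, goal_cases)
      case (1 t2 \<sigma>2)
      note time2 = 1(1)
      have r2: "reg \<sigma>2 r = reg ?s1 r" if "r \<notin> {''s'', ''p'', ''g''}" for r using that 1(2) by blast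
      have a2: "arr \<sigma>2 a = arr \<sigma> a" if "a \<notin> {''n'', ''p'', ''f''}" for a using that 1(3) by simp
      note lk2 = 1(4) and f2 = 1(5)
      have p2: "params \<sigma>2" using p1 r2 by (simp add: params_def)
      define J where "J = (\<lambda>j (\<tau> :: state). j \<le> kk \<and> reg \<tau> ''g'' = j \<and> (\<forall>r. r \<noteq> ''g'' \<longrightarrow> reg \<tau> r = reg \<sigma>2 r) \<and>
        (\<forall>a. a \<noteq> ''x'' \<longrightarrow> arr \<tau> a = arr \<sigma>2 a) \<and> (\<forall>g<j. arr \<tau> ''x'' g = 0))"
      have cl: "run (for_loop ''g'' (Store ''x'' (Reg ''g'') (Const 0))) \<sigma>2
        (\<lambda>t \<tau>. J kk \<tau> \<and> t \<le> (\<Sum>j<kk. 10 + 10) + 10)"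
      proof (rule run_for_loop)
        show "J 0 (\<sigma>2\<lparr>reg := (reg \<sigma>2)(''g'' := 0)\<rparr>)" by (simp add: J_def)
        show "reg \<tau> ''g'' = j \<and> j \<le> kk \<and> reg \<tau> ''K'' = kk" if "J j \<tau>" for j \<tau>
          using that params_simps[OF p2] by (simp add: J_def)
        fix j \<tau> assume J: "J j \<tau>" and j: "j < kk"
        show "run (Store ''x'' (Reg ''g'') (Const 0)) \<tau> (\<lambda>t \<tau>'. t \<le> 10 \<and> reg \<tau>' ''g'' = j \<and>
            J (Suc j) (\<tau>'\<lparr>reg := (reg \<tau>')(''g'' := Suc j)\<rparr>))"
          unfolding wp_Store using J j bounds(2)[of j] bounds(11) by (simp add: J_def less_Suc_eq)
      qed
      show ?case
      proof (rule wp_mono[OF cl], elim conjE, goal_cases)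
        case (1 t3 \<sigma>3)
        have r3: "reg \<sigma>3 r = reg \<sigma>2 r" if "r \<noteq> ''g''" for r using that 1(1) by (simp add: J_def)
        have a3: "arr \<sigma>3 a = arr \<sigma>2 a" if "a \<noteq> ''x''" for a using that 1(1) by (simp add: J_def)
        have x3: "arr \<sigma>3 ''x'' g = 0" if "g < kk" for g using that 1(1) by (simp add: J_def)
        have "represents \<tau> (reset B)" if \<tau>: "reg \<tau> = (reg \<sigma>3)(''U'' := 0, ''V'' := 0)" "arr \<tau> = arr \<sigma>3" for \<tau>
          unfolding represents_def
        proof (intro conjI allI impI)
          show "params \<tau>" using p2 r3 \<tau> by (simp add: params_def)
          fix s assume s: "s < kk"
          show "linked (stairs (reset B) s) (row \<tau> ''n'' s) (row \<tau> ''p'' s) (row \<tau> ''l'' s)"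
            using lk2 s a3 \<tau> by simp
          fix g assume "g < kk"
          then show "arr \<tau> ''f'' (s * kk + g) = node (stairs (reset B) s) (fpos (reset B) s g)"
            using f2 s a3 \<tau> by (simp add: fpos_def)
        next
          show "reg \<tau> ''x'' = best (reset B) True" "reg \<tau> ''y'' = best (reset B) False"
            using \<tau> r3 r2 bst by auto
        qed (use \<tau> x3 in auto)
        moreover have "1 + (1 + acost (Minus (Reg ''x'') (Minus (Reg ''x'') (Reg ''y'')))) + (1 + t2 + (1 + t3 +
            (1 + (1 + acost (Const 0)) + (1 + acost (Const 0))))) \<le> 2000 * k\<^sup>2 + 60 * (\<Sum>s<kk. cuts B s)"
        proof -
          have s2: "(\<Sum>s<kk. 60 * (length (stairs B s) - length (prune ?m (stairs B s))) + 50 * kk + 210)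
            = 60 * (\<Sum>s<kk. cuts B s) + 50 * (kk * kk) + 210 * kk"
            by (simp add: cuts_def sum.distrib sum_distrib_left)
          have q: "3 * k \<le> k\<^sup>2" "9 \<le> k\<^sup>2" "kk * kk = 4 * k\<^sup>2"
            using k3 mult_le_mono[OF k3 k3] by (auto simp: power2_eq_square kk_def)
          show ?thesis using time2 1(2) q unfolding s2 by (simp add: kk_def)
        qed
        moreover have "reg \<sigma>3 ''i'' = reg \<sigma> ''i''" using r3 r2 by simp
        ultimately show ?case
          unfolding wp_Assign using bounds(11) by simp
      qed
    qed
  qed
qed

lemma run_step_prog:
  assumes R: "represents \<sigma> A" and inv: "inv t t0 L0 A" and i: "reg \<sigma> ''i'' = x" and x: "x = Suc t" "x \<le> n"
  shows "run step_prog \<sigma> (\<lambda>t' \<tau>. t' \<le> 4100 * k\<^sup>2 + 60 * work x A \<and>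
    represents \<tau> (step x A) \<and> reg \<tau> ''i'' = x)"
  unfolding step_prog_def wp_Seq
proof (rule wp_mono[OF run_advance_prog[OF R inv i x]], elim conjE, goal_cases)
  case (1 t1 \<sigma>1)
  let ?B = "advance x A"
  let ?b = "Conj (Neg (Less (Reg ''U'') (Reg ''k''))) (Neg (Less (Reg ''V'') (Reg ''k'')))"
  have v: "valid x ?B" using valid_advance inv x by (simp add: inv_def)
  have ph: "phase x t0 L0 ?B"
    using phase_advance[of t t0 L0 A x] inv x by (simp add: inv_def valid_def)
  have rg: "reg \<sigma>1 ''U'' = length (tails ?B True)" "reg \<sigma>1 ''V'' = length (tails ?B False)" "reg \<sigma>1 ''k'' = k"
    using 1(2) params_simps unfolding represents_def by blast+
  have lW: "length (tails ?B d) < W" for d using phaseD(8)[OF ph, of d] bounds(4) by blast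
  have b: "bval S ?b \<sigma>1 \<longleftrightarrow> full ?B" using rg by (auto simp: full_def not_less)
  have bf: "bfits W S ?b \<sigma>1" using rg lW[of True] lW[of False] bounds(7) by simp
  have bc: "bcost ?b = 9" by simp
  have k2: "9 \<le> k\<^sup>2" using mult_le_mono[OF k3 k3] by (simp add: power2_eq_square)
  have wk: "work x A = (\<Sum>s<kk. moves x A s) + (\<Sum>s<kk. dels x A s) + (if full ?B then (\<Sum>s<kk. cuts ?B s) else 0)"
    by (simp add: work_def kk_def)
  show ?case
  proof (cases "full ?B")
    case True
    have st: "step x A = reset ?B" using True by (simp add: step_def Let_def)
    have bt: "bval S ?b \<sigma>1" using b True by blast
    show ?thesis
      unfolding wp_If if_P[OF bt] st bc
    proof (rule conjI[OF bf], rule wp_mono[OF run_reset_prog[OF 1(2) v x(2)]], elim conjE, intro conjI, goal_cases)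
      case (1 t2 \<sigma>2)
      then show ?case using \<open>t1 \<le> _\<close> k2 True unfolding wk by simp
    qed (use 1(3) in auto)
  next
    case False
    have st: "step x A = ?B" using False by (simp add: step_def Let_def)
    have bt: "\<not> bval S ?b \<sigma>1" using b False by blast
    show ?thesis
      unfolding wp_If if_not_P[OF bt] st bc wp_Skip
      using bf 1 k2 False unfolding wk by simp
  qed
qed

lemma run_rollercoaster_prog:
  assumes "reg \<sigma> = (\<lambda>x. 0)(''n'' := n, ''k'' := k)" "arr \<sigma> = (\<lambda>a i. 0)"
  shows "run rollercoaster_prog \<sigma> (\<lambda>t \<tau>. t \<le> 7000 * (n * k\<^sup>2) + 50 \<and>
    reg \<tau> ''out'' = longest_rollercoaster k S)"
proof -
  let ?s = "\<sigma>\<lparr>reg := (reg \<sigma>)(''M'' := mm, ''K'' := kk, ''i'' := 1)\<rparr>"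
  let ?b = "Less (Reg ''i'') (Reg ''M'')"
  define I where "I = (\<lambda>(t, t0, L0, A) (\<tau> :: state). t \<le> n \<and> reg \<tau> ''i'' = Suc t \<and> represents \<tau> A \<and> inv t t0 L0 A)"
  \<comment> \<open>The factor 60 converts pointer movements into time units. One element costs
    \<open>4100 * k\<^sup>2\<close> directly and \<open>60 * 40 * k\<^sup>2\<close> through the
    potential, which leaves \<open>500 * k\<^sup>2\<close> of the 7000 for loop overhead.\<close>
  define f where "f = (\<lambda>(t, t0, L0 :: bool \<Rightarrow> nat, A). 7000 * ((n - t) * k\<^sup>2) + 60 * pot (t - t0) A)"
  have k2: "9 \<le> k\<^sup>2" using mult_le_mono[OF k3 k3] by (simp add: power2_eq_square)
  \<comment> \<open>All-zero memory already represents the start, as the head node linked to itself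
    is the empty staircase; the arrays thus take no initialization time.\<close>
  have start: "I (0, 0, \<lambda>_. 0, start) ?s"
    using inv_start assms
    by (simp add: I_def represents_def params_def start_def linked_def succ_node_def fpos_def node_def)
  have loop: "run (While ?b (Seq step_prog (incr ''i''))) ?s
    (\<lambda>t \<tau>. \<exists>j. I j \<tau> \<and> \<not> bval S ?b \<tau> \<and> t + f j \<le> f (0, 0, \<lambda>_. 0, start) + 1 + bcost ?b)"
  proof (rule wp_While[where I = I, OF start])
    show "bfits W S ?b \<tau>" if "I j \<tau>" for j \<tau>
      using that bounds(1)[of "Suc (fst j)"] bounds(5) params_simps(3)[of \<tau>]
      by (cases j) (simp add: I_def represents_def)
    fix j \<tau> assume I: "I j \<tau>" and b: "bval S ?b \<tau>"
    obtain t t0 L0 A where j: "j = (t, t0, L0, A)" by (cases j)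
    have R: "represents \<tau> A" "inv t t0 L0 A" "reg \<tau> ''i'' = Suc t" using I j by (auto simp: I_def)
    have M: "reg \<tau> ''M'' = mm" using R(1) params_simps(3) by (auto simp: represents_def)
    have t: "Suc t \<le> n" using b R(3) M by (simp add: mm_def)
    obtain t0' L0' where N: "inv (Suc t) t0' L0' (step (Suc t) A)"
      "work (Suc t) A + pot (Suc t - t0') (step (Suc t) A) \<le> pot (t - t0) A + 40 * k\<^sup>2"
      using inv_step[OF R(2) refl t] .
    let ?j = "(Suc t, t0', L0', step (Suc t) A)"
    obtain r where r: "n - t = Suc r" "n - Suc t = r" using t by (metis Suc_diff_Suc Suc_le_lessD)
    show "run (Seq step_prog (incr ''i'')) \<tau> (\<lambda>t' \<tau>'. \<exists>j'. I j' \<tau>' \<and> t' + 1 + bcost ?b + f j' \<le> f j)"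
      unfolding wp_Seq incr_def wp_Assign
    proof (rule wp_mono[OF run_step_prog[OF R refl t]], elim conjE, intro conjI, goal_cases)
      case (1 t1 \<sigma>1)
      then show ?case using bounds(1)[of "Suc t"] bounds(1)[of "Suc (Suc t)"] bounds(9) t W by simp
    next
      case (2 t1 \<sigma>1)
      let ?s' = "\<sigma>1\<lparr>reg := (reg \<sigma>1)(''i'' := aval (plus1 (Reg ''i'')) \<sigma>1)\<rparr>"
      have "I ?j ?s'"
        using 2 N(1) t unfolding I_def represents_def by (simp add: params_def)
      moreover have "1 + t1 + (1 + acost (plus1 (Reg ''i''))) + 1 + bcost ?b + f ?j \<le> f j"
      proof -
        have "60 * work (Suc t) A + 60 * pot (Suc t - t0') (step (Suc t) A) \<le> 60 * pot (t - t0) A + 2400 * k\<^sup>2"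
          using N(2) by simp
        then show ?thesis using 2(1) k2 unfolding j f_def by (simp add: r)
      qed
      ultimately show ?case by blast
    qed
  qed
  have nk: "reg \<sigma> ''n'' = n" "reg \<sigma> ''k'' = k" using assms(1) by auto
  have W': "n < W" "Suc n < W" "2 < W" "1 < W" "k < W" "2 * k < W" using bounds W by (auto simp: kk_def)
  show ?thesis
    unfolding rollercoaster_prog_def wp_Seq[of _ _ "Assign _ _"] wp_Seq[of _ _ "While _ _"] wp_Assign[of _ _ "''M''"]
      wp_Assign[of _ _ "''K''"] wp_Assign[of _ _ "''i''"]
  proof (intro conjI, goal_cases)
    case 4
    have st: "\<sigma>\<lparr>reg := (reg \<sigma>)(''M'' := aval (plus1 (Reg ''n'')) \<sigma>)\<rparr>
      = \<sigma>\<lparr>reg := (reg \<sigma>)(''M'' := mm)\<rparr>"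
      "\<sigma>\<lparr>reg := (reg \<sigma>)(''M'' := mm)\<rparr>\<lparr>reg := (reg (\<sigma>\<lparr>reg := (reg \<sigma>)(''M'' := mm)\<rparr>))(''K'' :=
         aval (Times (Const 2) (Reg ''k'')) (\<sigma>\<lparr>reg := (reg \<sigma>)(''M'' := mm)\<rparr>))\<rparr>
       = \<sigma>\<lparr>reg := (reg \<sigma>)(''M'' := mm, ''K'' := kk)\<rparr>"
      "\<sigma>\<lparr>reg := (reg \<sigma>)(''M'' := mm, ''K'' := kk)\<rparr>\<lparr>reg := (reg (\<sigma>\<lparr>reg := (reg \<sigma>)(''M'' := mm, ''K'' := kk)\<rparr>))(''i'' :=
         aval (Const 1) (\<sigma>\<lparr>reg := (reg \<sigma>)(''M'' := mm, ''K'' := kk)\<rparr>))\<rparr> = ?s"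
      using nk by (simp_all add: mm_def kk_def)
    show ?case
      unfolding st
    proof (rule wp_mono[OF loop], elim exE conjE, goal_cases)
      case (1 t1 \<tau> j)
      obtain t t0 L0 A where j: "j = (t, t0, L0, A)" by (cases j)
      have I: "t \<le> n" "reg \<tau> ''i'' = Suc t" "represents \<tau> A" "inv t t0 L0 A" using 1(1) j by (auto simp: I_def)
      have M: "reg \<tau> ''M'' = mm" using I(3) params_simps(3) by (auto simp: represents_def)
      have t: "t = n" using 1(2) I(1,2) M by (simp add: mm_def)
      have val: "valid n A" using I(4) t by (simp add: inv_def)
      have bst: "reg \<tau> ''x'' = best A True" "reg \<tau> ''y'' = best A False" using I(3) by (auto simp: represents_def)
      have opt: "max (best A True) (best A False) = longest_rollercoaster k S"
        using best_optimal val by (auto simp: valid_def)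
      have bW: "best A d < W" for d
        using best_sound_le[of n "best A" d] val bounds(1)[of "best A d"] by (simp add: valid_def)
      have "f (0, 0, \<lambda>_. 0, start) = 7000 * (n * k\<^sup>2)" by (simp add: f_def pot_start)
      then have "t1 \<le> 7000 * (n * k\<^sup>2) + 5" using 1(3) by simp
      then show ?case
        using bst bW opt unfolding wp_If wp_Assign by (simp add: max_def split: if_splits)
    qed
  qed (use nk W' in auto)
qed

end

theorem theorem7:
  shows "\<exists>(P :: com) (d :: nat) (c :: nat). \<forall>(S :: real list) (k :: nat).
    distinct S \<and> k \<ge> 3 \<longrightarrow>
    (\<exists>t. computes d P S k t (longest_rollercoaster k S) \<and>
         (length S \<ge> 1 \<longrightarrow> t \<le> c * (length S * k ^ 2)))"
proof (rule exI[of _ rollercoaster_prog], rule exI[of _ 5], rule exI[of _ 8000], intro allI impI, elim conjE)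
  fix S :: "real list" and k :: nat
  assume S: "distinct S" and k: "3 \<le> k"
  let ?m = "length S + k"
  have m: "3 \<le> ?m" using k by simp
  \<comment> \<open>The required bound is quadratic in \<open>?m\<close>, namely at most
    \<open>6 * ?m^2 + 6 * ?m + 3\<close>, which is below \<open>27 * ?m^2\<close>. Since
    \<open>?m\<close> may be as small as 3, three further factors \<open>?m\<close> pay for the
    constant 27, whence the exponent 5.\<close>
  have W: "(2 * k + 1) * (length S + 1) + (2 * k + 1) * (2 * k) + length S + k + 2 < ?m ^ 5"
  proof -
    have "(2 * k + 1) * (length S + 1) + (2 * k + 1) * (2 * k) + length S + k + 2
        \<le> (2 * ?m + 1) * (?m + 1) + (2 * ?m + 1) * (2 * ?m) + length S + k + 2"
      by (intro add_mono mult_mono) auto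
    also have "\<dots> = 6 * (?m * ?m) + 6 * ?m + 3" by (simp add: algebra_simps)
    also have "\<dots> < 27 * (?m * ?m)"
    proof -
      have "3 * ?m \<le> ?m * ?m" using m by (intro mult_le_mono1)
      moreover have "6 * q + 6 * p + 3 < 27 * q" if "3 * p \<le> q" "3 \<le> p" for p q :: nat
        using that by linarith
      ultimately show ?thesis using m by blast
    qed
    also have "\<dots> \<le> ?m ^ 3 * (?m * ?m)"
      using power_mono[OF m, of 3] by (intro mult_le_mono1) simp
    also have "\<dots> = ?m ^ 5" by (simp add: eval_nat_numeral algebra_simps)
    finally show ?thesis .
  qed
  interpret machine S k "?m ^ 5" by unfold_locales (use S k W in auto)
  have "wp (?m ^ 5) S rollercoaster_prog (initial_state S k) (\<lambda>t \<tau>. t \<le> 7000 * (length S * k\<^sup>2) + 50 \<and>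
    reg \<tau> ''out'' = longest_rollercoaster k S)"
    by (rule run_rollercoaster_prog) (simp_all add: initial_state_def)
  then obtain t \<tau> where *: "exec (?m ^ 5) S rollercoaster_prog (initial_state S k) t \<tau>"
      "t \<le> 7000 * (length S * k\<^sup>2) + 50" "reg \<tau> ''out'' = longest_rollercoaster k S"
    unfolding wp_def by blast
  \<comment> \<open>For a nonempty input the product is at least 9, so the additive 50 fits into the
    raised constant; for the empty input the right-hand side would be 0.\<close>
  have "t \<le> 8000 * (length S * k ^ 2)" if "1 \<le> length S"
  proof -
    have "1 * 3\<^sup>2 \<le> length S * k\<^sup>2" using that k by (intro mult_le_mono power_mono) auto
    then show ?thesis using *(2) by simp
  qed
  with * show "\<exists>t. computes 5 rollercoaster_prog S k t (longest_rollercoaster k S) \<and>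
      (1 \<le> length S \<longrightarrow> t \<le> 8000 * (length S * k ^ 2))"
    unfolding computes_def by blast
qed

end
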